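(* Let $n$ be a positive integer. Every finite-type (FT) link invariant of order $<2n$ (with values in an abelian group) is a $\Delta$FT invariant of order $<n$.
   Context: Links are oriented links in $S^3$ (finitely many components) up to ambient isotopy. $\mathbb{Z}\mathcal{L}$ is the free $\mathbb{Z}$-module on all link types; a link invariant $v$ with values in an abelian group is extended linearly to $\mathbb{Z}\mathcal{L}$. FT invariants (finite-type, Vassiliev): $v$ is FT of order $<m$ if for every link diagram $L$ with $m$ chosen distinct crossings, $\sum_{T\subset\{1,\dots,m\}}(-1)^{|T|}v(L_T)=0$, where $L_T$ is obtained from $L$ by changing the $i$-th chosen crossing for all $i\in T$. Delta move: consider a disk in which a link diagram consists of three arcs $a,b,c$ properly embedded in the disk (each with its two endpoints on the boundary), every two of them crossing exactly once (so that the three crossings are the vertices of a triangle), such that, up to naming, $a$ passes over $b$, $b$ passes over $c$ and $c$ passes over $a$. The delta move replaces this by the diagram with the same arc endpoints in which one arc has been pushed to the other side of the crossing of the other two arcs (so the central triangle is reversed), keeping the same over/under relation for each pair of arcs. Orientations of the arcs are arbitrary. In braid form the move exchanges $\sigma_1\sigma_2^{-1}\sigma_1$ and $\sigma_2\sigma_1^{-1}\sigma_2$. The inverse of a delta move is again a delta move. $\Delta$FT invariants: let $L$ be a link diagram together with $n$ disjoint sets $S_1,\dots,S_n$ of pairwise disjoint disks, such that inside each disk the diagram is one side of a delta move. For $T\subset\{1,\dots,n\}$, $L_T$ denotes the link obtained by applying the delta move in every disk of $S_i$ for all $i\in T$. Let $C_n\subset\mathbb{Z}\mathcal{L}$ be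 the submodule generated by all $\sum_{T\subset\{1,\dots,n\}}(-1)^{|T|}L_T$ over all such diagrams. Then $v$ is $\Delta$FT of order $<n$ if it vanishes on $C_n$. *)

theory Defs
  imports "HOL-Analysis.Analysis" "HOL-Library.Poly_Mapping" "HOL-Combinatorics.Permutations"
begin

text \<open>
  Everything is done in the topological category.  The source of a link with \<open>k\<close> components is
  \<open>circles k\<close>; since \<open>nat\<close> carries the discrete topology, this is a disjoint union of \<open>k\<close> circles.
\<close>

definition circles :: "nat \<Rightarrow> (nat \<times> complex) set" where
  "circles k = {..<k} \<times> sphere 0 1"

abbreviation S3 :: "(complex \<times> complex) set" where
  "S3 \<equiv> sphere 0 1"

text \<open>Inverse stereographic projection, embedding \<open>\<real>\<^sup>3 = \<complex> \<times> \<real>\<close> onto \<open>S3\<close> minus a point.\<close>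

definition stereo :: "complex \<times> real \<Rightarrow> complex \<times> complex" where
  "stereo = (\<lambda>(w, h). let N = 1 + (cmod w)\<^sup>2 + h\<^sup>2
                      in ((2 / N) *\<^sub>R w, Complex (2 * h / N) ((N - 2) / N)))"


section \<open>Links up to ambient isotopy\<close>

text \<open>A parametrized link; the orientation is the one induced by the parametrization.\<close>

record link =
  ncomponents :: nat
  embedding :: "nat \<times> complex \<Rightarrow> complex \<times> complex"

definition embedded_link :: "link \<Rightarrow> bool" where
  "embedded_link K \<longleftrightarrow>
     continuous_on (circles (ncomponents K)) (embedding K) \<and>
     inj_on (embedding K) (circles (ncomponents K)) \<and>
     embedding K ` circles (ncomponents K) \<subseteq> S3"

text \<open>
  Two parametrizations give the same oriented link if they differ by a bijection of the components
  and orientation-preserving reparametrizations, i.e. homeomorphisms of the circle that are homotopic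
  to the identity.
\<close>

definition ambient_isotopic :: "link \<Rightarrow> link \<Rightarrow> bool" where
  "ambient_isotopic K K' \<longleftrightarrow>
     ncomponents K = ncomponents K' \<and>
     (\<exists>H :: real \<times> complex \<times> complex \<Rightarrow> complex \<times> complex.
        continuous_on ({0..1} \<times> S3) H \<and>
        (\<forall>t\<in>{0..1}. \<exists>G. homeomorphism S3 S3 (\<lambda>x. H (t, x)) G) \<and>
        (\<forall>x\<in>S3. H (0, x) = x) \<and>
        (\<exists>\<pi> \<rho>. \<pi> permutes {..<ncomponents K} \<and>
           (\<forall>i<ncomponents K.
              (\<exists>\<rho>'. homeomorphism (sphere 0 1) (sphere 0 1) (\<rho> i) \<rho>') \<and>
              homotopic_with_canon (\<lambda>_. True) (sphere 0 1) (sphere 0 1) (\<rho> i) id \<and>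
              (\<forall>z\<in>sphere 0 1. H (1, embedding K (i, z)) = embedding K' (\<pi> i, \<rho> i z)))))"


section \<open>Link diagrams\<close>

text \<open>
  \<open>s \<in> over L\<close> says that the strand through \<open>s\<close> is the upper one; it is only meaningful if
  \<open>curve L s\<close> is a crossing.
\<close>

record diagram =
  ncomp :: nat
  curve :: "nat \<times> complex \<Rightarrow> complex"
  over :: "(nat \<times> complex) set"

abbreviation source :: "diagram \<Rightarrow> (nat \<times> complex) set" where
  "source L \<equiv> circles (ncomp L)"

definition crossings :: "diagram \<Rightarrow> complex set" where
  "crossings L = {p. \<exists>s\<in>source L. \<exists>t\<in>source L. s \<noteq> t \<and> curve L s = p \<and> curve L t = p}"

text \<open>
  Over some open neighbourhood \<open>U\<close> of \<open>p\<close> the curve consists of two branches \<open>A\<close> and \<open>B\<close>, and some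
  chart of \<open>U\<close> takes these to the two coordinate axes of the unit disk.  Openness of \<open>A\<close> and \<open>B\<close>
  excludes branches that touch without crossing.
\<close>

definition transverse_crossing :: "diagram \<Rightarrow> complex \<Rightarrow> bool" where
  "transverse_crossing L p \<longleftrightarrow>
     (\<exists>A B U \<phi> \<psi>.
        open U \<and> p \<in> U \<and> homeomorphism U (ball (0::complex) 1) \<phi> \<psi> \<and> \<phi> p = 0 \<and>
        {s \<in> source L. curve L s \<in> U} = A \<union> B \<and> A \<inter> B = {} \<and>
        openin (top_of_set (source L)) A \<and> openin (top_of_set (source L)) B \<and>
        bij_betw (\<phi> \<circ> curve L) A {z \<in> ball 0 1. Im z = 0} \<and>
        bij_betw (\<phi> \<circ> curve L) B {z \<in> ball 0 1. Re z = 0})"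

definition link_diagram :: "diagram \<Rightarrow> bool" where
  "link_diagram L \<longleftrightarrow>
     continuous_on (source L) (curve L) \<and>
     finite (crossings L) \<and>
     (\<forall>p\<in>crossings L. transverse_crossing L p) \<and>
     (\<forall>s\<in>source L. \<forall>t\<in>source L. s \<noteq> t \<and> curve L s = curve L t \<longrightarrow> (s \<in> over L \<longleftrightarrow> t \<notin> over L))"

text \<open>Height functions realizing the over/under information of a diagram.\<close>

definition heights :: "diagram \<Rightarrow> (nat \<times> complex \<Rightarrow> real) \<Rightarrow> bool" where
  "heights L h \<longleftrightarrow>
     continuous_on (source L) h \<and>
     (\<forall>s\<in>source L. \<forall>t\<in>source L.
        s \<noteq> t \<and> curve L s = curve L t \<and> s \<in> over L \<longrightarrow> h t < h s)"

definition lift :: "diagram \<Rightarrow> (nat \<times> complex \<Rightarrow> real) \<Rightarrow> link" where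
  "lift L h = \<lparr>ncomponents = ncomp L, embedding = (\<lambda>s. stereo (curve L s, h s))\<rparr>"


section \<open>Link types and the module they generate\<close>

text \<open>As usual, links are tame: up to ambient isotopy they have a diagram.\<close>

definition tame_link :: "link \<Rightarrow> bool" where
  "tame_link K \<longleftrightarrow>
     embedded_link K \<and> (\<exists>L h. link_diagram L \<and> heights L h \<and> ambient_isotopic K (lift L h))"

definition isotopy_rel :: "(link \<times> link) set" where
  "isotopy_rel = {(K, K'). tame_link K \<and> tame_link K' \<and> ambient_isotopic K K'}"

lemma ambient_isotopic_refl: "ambient_isotopic K K"
proof -
  have id: "homeomorphism S S (\<lambda>x. x) (\<lambda>x. x)" for S :: "'a::topological_space set"
    by (simp add: homeomorphism_def)
  have "\<exists>\<pi> \<rho>. \<pi> permutes {..<ncomponents K} \<and>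
          (\<forall>i<ncomponents K.
             (\<exists>\<rho>'. homeomorphism (sphere 0 1) (sphere 0 1) (\<rho> i) \<rho>') \<and>
             homotopic_with_canon (\<lambda>_. True) (sphere 0 1) (sphere 0 1) (\<rho> i) id \<and>
             (\<forall>z\<in>sphere 0 1. snd (1::real, embedding K (i, z)) = embedding K (\<pi> i, \<rho> i z)))"
    by (rule exI[of _ id], rule exI[of _ "\<lambda>_ x. x"])
      (use id permutes_id in \<open>auto simp: id_def\<close>)
  moreover have "\<forall>t\<in>{0..1::real}. \<exists>G. homeomorphism S3 S3 (\<lambda>x. snd (t, x)) G"
    using id by auto
  ultimately show ?thesis
    unfolding ambient_isotopic_def
    by (intro conjI refl, intro exI[of _ snd] conjI) (auto intro!: continuous_intros)
qed

lemma ambient_isotopic_sym: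
  assumes "ambient_isotopic K K'" and "embedded_link K"
  shows "ambient_isotopic K' K"
proof -
  let ?n = "ncomponents K"
  let ?C = "sphere 0 1 :: complex set"
  obtain H :: "real \<times> complex \<times> complex \<Rightarrow> complex \<times> complex" and \<pi> \<rho>
    where n: "ncomponents K = ncomponents K'"
      and H: "continuous_on ({0..1} \<times> S3) H"
      and hom: "\<And>t. t \<in> {0..1} \<Longrightarrow> \<exists>G. homeomorphism S3 S3 (\<lambda>x. H (t, x)) G"
      and H0: "\<And>x. x \<in> S3 \<Longrightarrow> H (0, x) = x"
      and \<pi>: "\<pi> permutes {..<?n}"
      and \<rho>: "\<And>i. i < ?n \<Longrightarrow> \<exists>\<rho>'. homeomorphism ?C ?C (\<rho> i) \<rho>'"
      and \<rho>_id: "\<And>i. i < ?n \<Longrightarrow> homotopic_with_canon (\<lambda>_. True) ?C ?C (\<rho> i) id"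
      and H1: "\<And>i z. i < ?n \<Longrightarrow> z \<in> ?C \<Longrightarrow>
                 H (1, embedding K (i, z)) = embedding K' (\<pi> i, \<rho> i z)"
    using assms(1) unfolding ambient_isotopic_def by blast
  have K: "embedding K (i, z) \<in> S3" if "i < ?n" "z \<in> ?C" for i z
    using assms(2) that unfolding embedded_link_def circles_def by blast
  obtain \<rho>' where \<rho>': "\<And>i. i < ?n \<Longrightarrow> homeomorphism ?C ?C (\<rho> i) (\<rho>' i)"
    using \<rho> by metis
  obtain G where G: "homeomorphism S3 S3 (\<lambda>x. H (1, x)) G"
    using hom[of 1] by auto
  define H' where "H' = (\<lambda>(t, x). H (1 - t, G x))"
  define \<sigma> where "\<sigma> = (\<lambda>j. \<rho>' (inv \<pi> j))"
  have G_S3: "G x \<in> S3" if "x \<in> S3" for x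
    using G that unfolding homeomorphism_def by blast
  have inv_less: "inv \<pi> j < ?n" if "j < ?n" for j
    using permutes_in_image[OF permutes_inv[OF \<pi>], of j] that by auto
  show ?thesis
    unfolding ambient_isotopic_def
  proof (intro conjI exI[of _ H'] exI[of _ "inv \<pi>"] exI[of _ \<sigma>] allI impI ballI)
    show "ncomponents K' = ncomponents K" using n by simp
    have "continuous_on S3 G"
      using G unfolding homeomorphism_def by blast
    then have "continuous_on ({0..1} \<times> S3) (\<lambda>p :: real \<times> complex \<times> complex. G (snd p))"
      by (rule continuous_on_compose2[OF _ continuous_on_snd[OF continuous_on_id]]) auto
    moreover have "continuous_on ({0..1} \<times> S3) (\<lambda>p :: real \<times> complex \<times> complex. 1 - fst p)"
      by (intro continuous_intros)
    ultimately have "continuous_on ({0..1} \<times> S3) (\<lambda>p. (1 - fst p :: real, G (snd p)))"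
      by (intro continuous_on_Pair)
    then have "continuous_on ({0..1} \<times> S3) (\<lambda>p. H (1 - fst p, G (snd p)))"
      by (rule continuous_on_compose2[OF H]) (use G_S3 in auto)
    then show "continuous_on ({0..1} \<times> S3) H'"
      by (simp add: H'_def case_prod_beta)
  next
    fix t :: real assume "t \<in> {0..1}"
    then obtain F where "homeomorphism S3 S3 (\<lambda>x. H (1 - t, x)) F"
      using hom[of "1 - t"] by auto
    from homeomorphism_compose[OF homeomorphism_symD[OF G] this]
    show "\<exists>F. homeomorphism S3 S3 (\<lambda>x. H' (t, x)) F"
      by (auto simp: H'_def o_def)
  next
    fix x :: "complex \<times> complex" assume "x \<in> S3"
    then show "H' (0, x) = x"
      using G by (simp add: H'_def homeomorphism_def)
  next
    show "inv \<pi> permutes {..<ncomponents K'}"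
      using permutes_inv[OF \<pi>] n by simp
  next
    fix j assume "j < ncomponents K'"
    then show "\<exists>\<tau>. homeomorphism ?C ?C (\<sigma> j) \<tau>"
      unfolding \<sigma>_def using \<rho>' homeomorphism_symD inv_less n by metis
  next
    fix j assume j: "j < ncomponents K'"
    define i where "i = inv \<pi> j"
    have i: "i < ?n" using inv_less j n i_def by simp
    have h: "homeomorphism ?C ?C (\<rho> i) (\<rho>' i)" using \<rho>' i by blast
    have "homotopic_with_canon (\<lambda>_. True) ?C ?C (\<rho>' i \<circ> \<rho> i) (\<rho>' i \<circ> id)"
      using h by (intro homotopic_with_compose_continuous_left[OF \<rho>_id[OF i]])
        (auto simp: homeomorphism_def)
    then have "homotopic_with_canon (\<lambda>_. True) ?C ?C id (\<rho>' i)"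
      by (rule homotopic_with_eq) (use h in \<open>auto simp: homeomorphism_def\<close>)
    then show "homotopic_with_canon (\<lambda>_. True) ?C ?C (\<sigma> j) id"
      by (simp add: homotopic_with_sym \<sigma>_def i_def)
  next
    fix j z assume j: "j < ncomponents K'" and z: "z \<in> ?C"
    define i where "i = inv \<pi> j"
    have i: "i < ?n" using inv_less j n i_def by simp
    have h: "homeomorphism ?C ?C (\<rho> i) (\<rho>' i)" using \<rho>' i by blast
    have z': "\<rho>' i z \<in> ?C" and \<rho>z: "\<rho> i (\<rho>' i z) = z"
      using h z unfolding homeomorphism_def by blast+
    have "\<pi> i = j" using \<pi> by (simp add: i_def permutes_inverses)
    then have eq: "embedding K' (j, z) = H (1, embedding K (i, \<rho>' i z))"
      using H1[OF i z'] \<rho>z by simp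
    have S: "embedding K (i, \<rho>' i z) \<in> S3" using K[OF i z'] .
    then have "G (embedding K' (j, z)) = embedding K (i, \<rho>' i z)"
      using G eq by (simp add: homeomorphism_def)
    then show "H' (1, embedding K' (j, z)) = embedding K (inv \<pi> j, \<sigma> j z)"
      using H0[OF S] by (simp add: H'_def \<sigma>_def i_def)
  qed
qed

lemma ambient_isotopic_trans:
  assumes "ambient_isotopic K K'" and "ambient_isotopic K' K''" and "embedded_link K"
  shows "ambient_isotopic K K''"
proof -
  let ?n = "ncomponents K"
  let ?C = "sphere 0 1 :: complex set"
  obtain H :: "real \<times> complex \<times> complex \<Rightarrow> complex \<times> complex" and \<pi> \<rho>
    where n: "ncomponents K = ncomponents K'"
      and H: "continuous_on ({0..1} \<times> S3) H"
      and hom: "\<And>t. t \<in> {0..1} \<Longrightarrow> \<exists>G. homeomorphism S3 S3 (\<lambda>x. H (t, x)) G"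
      and H0: "\<And>x. x \<in> S3 \<Longrightarrow> H (0, x) = x"
      and \<pi>: "\<pi> permutes {..<?n}"
      and \<rho>: "\<And>i. i < ?n \<Longrightarrow> \<exists>\<rho>'. homeomorphism ?C ?C (\<rho> i) \<rho>'"
      and \<rho>_id: "\<And>i. i < ?n \<Longrightarrow> homotopic_with_canon (\<lambda>_. True) ?C ?C (\<rho> i) id"
      and H1: "\<And>i z. i < ?n \<Longrightarrow> z \<in> ?C \<Longrightarrow>
                 H (1, embedding K (i, z)) = embedding K' (\<pi> i, \<rho> i z)"
    using assms(1) unfolding ambient_isotopic_def by blast
  obtain J :: "real \<times> complex \<times> complex \<Rightarrow> complex \<times> complex" and \<pi>' \<rho>'
    where n': "ncomponents K' = ncomponents K''"
      and J: "continuous_on ({0..1} \<times> S3) J"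
      and hom': "\<And>t. t \<in> {0..1} \<Longrightarrow> \<exists>G. homeomorphism S3 S3 (\<lambda>x. J (t, x)) G"
      and J0: "\<And>x. x \<in> S3 \<Longrightarrow> J (0, x) = x"
      and \<pi>': "\<pi>' permutes {..<ncomponents K'}"
      and \<rho>': "\<And>i. i < ncomponents K' \<Longrightarrow> \<exists>\<tau>. homeomorphism ?C ?C (\<rho>' i) \<tau>"
      and \<rho>'_id: "\<And>i. i < ncomponents K' \<Longrightarrow> homotopic_with_canon (\<lambda>_. True) ?C ?C (\<rho>' i) id"
      and J1: "\<And>i z. i < ncomponents K' \<Longrightarrow> z \<in> ?C \<Longrightarrow>
                 J (1, embedding K' (i, z)) = embedding K'' (\<pi>' i, \<rho>' i z)"
    using assms(2) unfolding ambient_isotopic_def by blast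
  define F where "F = (\<lambda>(t, x). J (t, H (t, x)))"
  define \<sigma> where "\<sigma> = (\<lambda>i. \<rho>' (\<pi> i) \<circ> \<rho> i)"
  have H_S3: "H (t, x) \<in> S3" if "t \<in> {0..1}" "x \<in> S3" for t x
    using hom[OF that(1)] that(2) unfolding homeomorphism_def by blast
  have \<pi>_less: "\<pi> i < ncomponents K'" if "i < ?n" for i
    using permutes_in_image[OF \<pi>, of i] that n by auto
  show ?thesis
    unfolding ambient_isotopic_def
  proof (intro conjI exI[of _ F] exI[of _ "\<pi>' \<circ> \<pi>"] exI[of _ \<sigma>] allI impI ballI)
    show "ncomponents K = ncomponents K''" using n n' by simp
    have "continuous_on ({0..1} \<times> S3) (\<lambda>p. (fst p, H p))"
      by (intro continuous_intros H)
    then have "continuous_on ({0..1} \<times> S3) (\<lambda>p. J (fst p, H p))"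
      by (rule continuous_on_compose2[OF J]) (use H_S3 in auto)
    then show "continuous_on ({0..1} \<times> S3) F"
      by (simp add: F_def case_prod_beta)
  next
    fix t :: real assume t: "t \<in> {0..1}"
    obtain A B where "homeomorphism S3 S3 (\<lambda>x. H (t, x)) A" "homeomorphism S3 S3 (\<lambda>x. J (t, x)) B"
      using hom[OF t] hom'[OF t] by blast
    from homeomorphism_compose[OF this]
    show "\<exists>E. homeomorphism S3 S3 (\<lambda>x. F (t, x)) E"
      by (auto simp: F_def o_def)
  next
    fix x :: "complex \<times> complex" assume "x \<in> S3"
    then show "F (0, x) = x" using H0 J0 by (simp add: F_def)
  next
    show "\<pi>' \<circ> \<pi> permutes {..<?n}"
      using permutes_compose[OF \<pi>] \<pi>' n by simp
  next
    fix i assume i: "i < ?n"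
    obtain A B where "homeomorphism ?C ?C (\<rho> i) A" "homeomorphism ?C ?C (\<rho>' (\<pi> i)) B"
      using \<rho>[OF i] \<rho>'[OF \<pi>_less[OF i]] by blast
    from homeomorphism_compose[OF this]
    show "\<exists>E. homeomorphism ?C ?C (\<sigma> i) E"
      by (auto simp: \<sigma>_def)
  next
    fix i assume i: "i < ?n"
    have "homotopic_with_canon (\<lambda>_. True) ?C ?C (\<rho>' (\<pi> i) \<circ> \<rho> i) (id \<circ> id)"
      by (rule homotopic_compose[OF \<rho>_id[OF i] \<rho>'_id[OF \<pi>_less[OF i]]])
    then show "homotopic_with_canon (\<lambda>_. True) ?C ?C (\<sigma> i) id"
      by (simp add: \<sigma>_def)
  next
    fix i z assume i: "i < ?n" and z: "z \<in> ?C"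
    have "\<rho> i z \<in> ?C"
      using \<rho>[OF i] z unfolding homeomorphism_def by blast
    then show "F (1, embedding K (i, z)) = embedding K'' ((\<pi>' \<circ> \<pi>) i, \<sigma> i z)"
      using H1[OF i z] J1[OF \<pi>_less[OF i]] by (simp add: F_def \<sigma>_def)
  qed
qed

lemma equiv_isotopy_rel: "equiv (Collect tame_link) isotopy_rel"
proof (rule equivI)
  show "isotopy_rel \<subseteq> Collect tame_link \<times> Collect tame_link"
    by (auto simp: isotopy_rel_def)
  show "refl_on (Collect tame_link) isotopy_rel"
    by (auto simp: refl_on_def isotopy_rel_def ambient_isotopic_refl)
  show "sym isotopy_rel"
    unfolding sym_def isotopy_rel_def tame_link_def by (blast intro: ambient_isotopic_sym)
  show "trans isotopy_rel"
    unfolding trans_def isotopy_rel_def tame_link_def by (blast intro: ambient_isotopic_trans)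
qed

lemma ex_tame_link: "\<exists>K. tame_link K"
proof -
  define L where "L = \<lparr>ncomp = 0, curve = (\<lambda>_. 0), over = {}\<rparr>"
  have "source L = {}"
    by (simp add: L_def circles_def)
  then have "link_diagram L" "heights L (\<lambda>_. 0)" "embedded_link (lift L (\<lambda>_. 0))"
    by (auto simp: link_diagram_def heights_def embedded_link_def lift_def crossings_def)
  then show ?thesis
    using ambient_isotopic_refl unfolding tame_link_def by blast
qed

typedef link_type = "Collect tame_link // isotopy_rel"
  using ex_tame_link by (auto simp: quotient_def)

definition link_type_of :: "link \<Rightarrow> link_type" where
  "link_type_of K = Abs_link_type (isotopy_rel `` {K})"

text \<open>
  The link presented by a diagram; heights always exist, and up to ambient isotopy the lift does
  not depend on them.
\<close>

definition diagram_type :: "diagram \<Rightarrow> link_type" where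
  "diagram_type L = link_type_of (lift L (SOME h. heights L h))"

text \<open>The free abelian group on the link types is \<open>link_type \<Rightarrow>\<^sub>0 int\<close>.\<close>

lemma module_frag_cmul: "module frag_cmul"
  by unfold_locales (simp_all add: frag_cmul_distrib frag_cmul_distrib2)

definition int_scale :: "int \<Rightarrow> 'a::ab_group_add \<Rightarrow> 'a" where
  "int_scale c a = (\<Sum>i<nat c. a) - (\<Sum>i<nat (- c). a)"

definition linear_extension :: "(link_type \<Rightarrow> 'a::ab_group_add) \<Rightarrow> (link_type \<Rightarrow>\<^sub>0 int) \<Rightarrow> 'a" where
  "linear_extension v x = (\<Sum>K\<in>Poly_Mapping.keys x. int_scale (Poly_Mapping.lookup x K) (v K))"

definition alternating_sum :: "nat \<Rightarrow> (nat set \<Rightarrow> diagram) \<Rightarrow> (link_type \<Rightarrow>\<^sub>0 int)" where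
  "alternating_sum n L =
     (\<Sum>T\<in>Pow {..<n}. frag_cmul ((- 1) ^ card T) (frag_of (diagram_type (L T))))"


section \<open>Finite-type invariants\<close>

definition change_crossings :: "complex set \<Rightarrow> diagram \<Rightarrow> diagram" where
  "change_crossings X L = L\<lparr>over := {s. (s \<in> over L) \<noteq> (curve L s \<in> X)}\<rparr>"

definition finite_type_less :: "nat \<Rightarrow> (link_type \<Rightarrow> 'a::ab_group_add) \<Rightarrow> bool" where
  "finite_type_less m v \<longleftrightarrow>
     (\<forall>L c. link_diagram L \<and> inj_on c {..<m} \<and> c ` {..<m} \<subseteq> crossings L \<longrightarrow>
        linear_extension v (alternating_sum m (\<lambda>T. change_crossings (c ` T) L)) = 0)"


section \<open>Delta moves\<close>

text \<open>The arc \<open>a\<close> in the source of \<open>L\<close> parametrizes an arc of the diagram that is properly embedded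
  in the disk \<open>D\<close>; the direction of \<open>a\<close> is unrelated to the orientation of the link.\<close>

definition proper_arc :: "complex set \<Rightarrow> diagram \<Rightarrow> (real \<Rightarrow> nat \<times> complex) \<Rightarrow> bool" where
  "proper_arc D L a \<longleftrightarrow>
     arc a \<and> path_image a \<subseteq> source L \<and> arc (curve L \<circ> a) \<and>
     curve L (pathstart a) \<in> frontier D \<and> curve L (pathfinish a) \<in> frontier D \<and>
     (\<forall>u\<in>{0<..<1}. curve L (a u) \<in> interior D)"

text \<open>The arcs \<open>a\<close> and \<open>b\<close> cross exactly once in \<open>D\<close>, and \<open>a\<close> passes over \<open>b\<close>.\<close>

definition crosses_once_over ::
    "complex set \<Rightarrow> diagram \<Rightarrow> (real \<Rightarrow> nat \<times> complex) \<Rightarrow> (real \<Rightarrow> nat \<times> complex) \<Rightarrow> bool" where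
  "crosses_once_over D L a b \<longleftrightarrow>
     (\<exists>u\<in>path_image a. \<exists>w\<in>path_image b.
        curve L ` path_image a \<inter> curve L ` path_image b = {curve L u} \<and>
        curve L u = curve L w \<and> curve L u \<in> interior D \<and> u \<in> over L \<and> w \<notin> over L)"

text \<open>Inside \<open>D\<close> the diagram is a triangle with cyclic over/under information.\<close>

definition delta_triangle ::
    "complex set \<Rightarrow> diagram \<Rightarrow> (real \<Rightarrow> nat \<times> complex) \<Rightarrow> (real \<Rightarrow> nat \<times> complex)
       \<Rightarrow> (real \<Rightarrow> nat \<times> complex) \<Rightarrow> bool" where
  "delta_triangle D L a b c \<longleftrightarrow>
     {s \<in> source L. curve L s \<in> D} = path_image a \<union> path_image b \<union> path_image c \<and>
     path_image a \<inter> path_image b = {} \<and> path_image b \<inter> path_image c = {} \<and>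
     path_image c \<inter> path_image a = {} \<and>
     proper_arc D L a \<and> proper_arc D L b \<and> proper_arc D L c \<and>
     crosses_once_over D L a b \<and> crosses_once_over D L b c \<and> crosses_once_over D L c a"

text \<open>
  Inside \<open>D\<close>, the diagram \<open>L'\<close> is obtained from \<open>L\<close> by pushing the arc \<open>a\<close> across the crossing
  \<open>p\<close> of \<open>b\<close> and \<open>c\<close>: an arc in the boundary of \<open>D\<close> on the same side of the old \<open>a\<close> as \<open>p\<close> is on
  the other side of the new \<open>a\<close>.  Naming the pushed arc \<open>a\<close> is no restriction, as the roles of
  \<open>a\<close>, \<open>b\<close>, \<open>c\<close> in \<open>delta_triangle\<close> are cyclic.
\<close>

definition delta_move_in :: "complex set \<Rightarrow> diagram \<Rightarrow> diagram \<Rightarrow> bool" where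
  "delta_move_in D L L' \<longleftrightarrow>
     D homeomorphic cball (0::complex) 1 \<and> ncomp L' = ncomp L \<and>
     (\<exists>a b c. delta_triangle D L a b c \<and> delta_triangle D L' a b c \<and>
        curve L' (pathstart a) = curve L (pathstart a) \<and>
        curve L' (pathfinish a) = curve L (pathfinish a) \<and>
        (\<forall>s\<in>path_image b \<union> path_image c. curve L' s = curve L s) \<and>
        (\<forall>p \<in> curve L ` path_image b \<inter> curve L ` path_image c.
           \<forall>q \<in> frontier D - {curve L (pathstart a), curve L (pathfinish a)}.
             connected_component (D - curve L ` path_image a) p q \<longleftrightarrow>
             \<not> connected_component (D - curve L' ` path_image a) p q))"

text \<open>\<open>L\<close> with the part inside \<open>U\<close> replaced by the corresponding part of \<open>L'\<close>; used only if
  \<open>curve L s \<in> U \<longleftrightarrow> curve L' s \<in> U\<close>.\<close>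

definition replace_inside :: "complex set \<Rightarrow> diagram \<Rightarrow> diagram \<Rightarrow> diagram" where
  "replace_inside U L' L =
     L\<lparr>curve := (\<lambda>s. if curve L s \<in> U then curve L' s else curve L s),
       over := {s. if curve L s \<in> U then s \<in> over L' else s \<in> over L}\<rparr>"

text \<open>
  \<open>L'\<close> is the result of applying delta moves in all the disks \<open>\<D>\<close>, so that
  \<open>replace_inside (\<Union>\<E>) L' L\<close> is the result of applying them only in the disks \<open>\<E> \<subseteq> \<D>\<close>.
\<close>

definition delta_moves :: "complex set set \<Rightarrow> diagram \<Rightarrow> diagram \<Rightarrow> bool" where
  "delta_moves \<D> L L' \<longleftrightarrow>
     link_diagram L \<and> link_diagram L' \<and> ncomp L' = ncomp L \<and>
     pairwise disjnt \<D> \<and> (\<forall>D\<in>\<D>. delta_move_in D L L') \<and>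
     (\<forall>s\<in>source L. curve L s \<notin> \<Union>\<D> \<longrightarrow>
        curve L' s = curve L s \<and> (s \<in> over L' \<longleftrightarrow> s \<in> over L))"

definition delta_submodule :: "nat \<Rightarrow> (link_type \<Rightarrow>\<^sub>0 int) set" where
  "delta_submodule n = module.span frag_cmul
     {alternating_sum n (\<lambda>T. replace_inside (\<Union>i\<in>T. \<Union>(S i)) L' L) | S L L'.
        disjoint_family_on S {..<n} \<and> delta_moves (\<Union>i<n. S i) L L'}"

definition delta_finite_type_less :: "nat \<Rightarrow> (link_type \<Rightarrow> 'a::ab_group_add) \<Rightarrow> bool" where
  "delta_finite_type_less n v \<longleftrightarrow> (\<forall>x\<in>delta_submodule n. linear_extension v x = 0)"

end

theory Submission
  imports Defs
begin

text \<open>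
  The central triangle of a delta move has three crossings.  Changing one of them, or two of them,
  destroys the cyclic order of the three arcs: one arc then lies on top, one in the middle and one at
  the bottom, and the pushed arc can be moved past the crossing of the other two by an isotopy.
  Hence, if \<open>L\<close> and \<open>L'\<close> are the two sides of a delta move, and \<open>L\<^sub>T\<close>, \<open>L'\<^sub>T\<close> arise from them by
  changing a set \<open>T\<close> of the two crossings on the pushed arc, then \<open>L\<^sub>T\<close> and \<open>L'\<^sub>T\<close> have the
  same link type for \<open>T \<noteq> {}\<close>, so that
  \<open>L - L' = (\<Sum>T. (-1)\<^bsup>|T|\<^esup> L\<^sub>T) - (\<Sum>T. (-1)\<^bsup>|T|\<^esup> L'\<^sub>T)\<close>.
  One delta move is thus worth two crossing changes, and an alternating sum over \<open>n\<close> disks becomes an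
  alternating sum of \<open>2\<^sup>n\<close> alternating sums over \<open>2n\<close> crossings (\<open>altsum_single_disks\<close>).  Sets
  of several disks are reduced to single disks by telescoping (\<open>altsum_Union_eq_0\<close>).

  The topological part is the isotopy (\<open>diagram_type_push_arc\<close>).  The disks and the arcs are merely
  topological, and the third dimension is used to avoid the study of arcs in a planar disk: the heights can
  be chosen such that the pushed arc climbs from height \<open>0\<close> to height \<open>1\<close> while the two other arcs
  stay outside of these heights.
  Then every level of the cylinder over the disk contains a single point of the pushed arc, and it
  suffices to move one point of a round disk to another, with the boundary fixed and continuously in
  the level.  This is done by the homeomorphism that maps the cone from \<open>p\<close> over the unit circle
  linearly to the cone from \<open>q\<close> (\<open>push\<close>).  That the heights may be chosen freely rests on
  \<open>lift_heights_isotopic\<close>: two height functions of a diagram differ by a shear of \<open>\<complex> \<times> \<real>\<close> along the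
  second factor.  It is glued from local shears by convex combinations, which is possible because the
  increasing functions with prescribed values form a convex set.
\<close>

section \<open>Alternating sums over the subsets of a finite set\<close>

definition altsum :: "'i set \<Rightarrow> ('i set \<Rightarrow> 'a::ab_group_add) \<Rightarrow> 'a" where
  "altsum I g = (\<Sum>T\<in>Pow I. if even (card T) then g T else - g T)"

lemma altsum_cong: "(\<And>T. T \<subseteq> I \<Longrightarrow> g T = h T) \<Longrightarrow> altsum I g = altsum I h"
  unfolding altsum_def by (rule sum.cong) auto

lemma altsum_insert:
  assumes "finite I" "i \<notin> I"
  shows "altsum (insert i I) g = altsum I g - altsum I (\<lambda>T. g (insert i T))"
proof -
  let ?s = "\<lambda>T. if even (card T) then g T else - g T"
  have "altsum (insert i I) g = sum ?s (Pow I \<union> insert i ` Pow I)"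
    unfolding altsum_def by (simp add: Pow_insert)
  also have "\<dots> = sum ?s (Pow I) + sum ?s (insert i ` Pow I)"
    using assms by (intro sum.union_disjoint) auto
  also have "sum ?s (insert i ` Pow I) = (\<Sum>T\<in>Pow I. ?s (insert i T))"
    using assms by (subst sum.reindex) (auto simp: inj_on_def)
  also have "\<dots> = (\<Sum>T\<in>Pow I. - (if even (card T) then g (insert i T) else - g (insert i T)))"
  proof (rule sum.cong[OF refl])
    fix T assume "T \<in> Pow I"
    then have "finite T" "i \<notin> T" using assms by (auto intro: finite_subset)
    then show "?s (insert i T) = - (if even (card T) then g (insert i T) else - g (insert i T))"
      by simp
  qed
  finally show ?thesis by (simp add: altsum_def sum_negf)
qed

lemma altsum_zero: "altsum I (\<lambda>_. 0) = 0"
  by (simp add: altsum_def cong: if_cong)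

text \<open>The two members of each pair \<open>T\<close>, \<open>insert i T\<close> enter with opposite signs.\<close>

lemma altsum_pairing:
  assumes "finite I" "i \<in> I" and eq: "\<And>T. T \<subseteq> I - {i} \<Longrightarrow> g T = g (insert i T)"
  shows "altsum I g = 0"
proof -
  have "altsum (insert i (I - {i})) g = 0"
    using assms by (subst altsum_insert) (auto intro!: altsum_cong)
  then show ?thesis using assms by (simp add: insert_absorb)
qed

lemma altsum_commute:
  "altsum I (\<lambda>T. altsum J (\<lambda>U. f T U)) = altsum J (\<lambda>U. altsum I (\<lambda>T. f T U))"
proof -
  have "altsum I (\<lambda>T. altsum J (\<lambda>U. f T U)) =
      (\<Sum>T\<in>Pow I. \<Sum>U\<in>Pow J. if even (card T) = even (card U) then f T U else - f T U)"
    unfolding altsum_def by (intro sum.cong refl) (auto simp: sum_negf[symmetric] intro!: sum.cong)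
  also have "\<dots> = (\<Sum>U\<in>Pow J. \<Sum>T\<in>Pow I. if even (card T) = even (card U) then f T U else - f T U)"
    by (rule sum.swap)
  also have "\<dots> = altsum J (\<lambda>U. altsum I (\<lambda>T. f T U))"
    unfolding altsum_def by (intro sum.cong refl) (auto simp: sum_negf[symmetric] intro!: sum.cong)
  finally show ?thesis .
qed

lemma altsum_only_empty:
  assumes "finite I" "\<And>T. T \<subseteq> I \<Longrightarrow> T \<noteq> {} \<Longrightarrow> g T = 0"
  shows "altsum I g = g {}"
proof -
  have "altsum I g = (\<Sum>T\<in>{{}}. if even (card T) then g T else - g T)"
    unfolding altsum_def using assms by (intro sum.mono_neutral_right) auto
  then show ?thesis by simp
qed

text \<open>
  If a block is split as \<open>S j = insert D S'\<close>, the sum for \<open>S\<close> is the sum with \<open>D\<close> in place of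
  \<open>S j\<close> plus the sum with \<open>S'\<close> in place of \<open>S j\<close> and with \<open>D\<close> moved to the background \<open>B\<close>.  A sum with
  an empty block cancels in pairs, so that only singleton blocks are left.
\<close>

lemma altsum_Union_eq_0:
  fixes f :: "'d set \<Rightarrow> 'a::ab_group_add"
  assumes single: "\<And>B d. inj_on d I \<Longrightarrow> B \<inter> d ` I = {} \<Longrightarrow> B \<union> d ` I \<subseteq> \<D> \<Longrightarrow>
                     altsum I (\<lambda>T. f (B \<union> d ` T)) = 0"
    and I: "finite I"
    and S: "\<And>i. i \<in> I \<Longrightarrow> finite (S i)" "disjoint_family_on S I"
    and B: "B \<inter> \<Union>(S ` I) = {}" "B \<union> \<Union>(S ` I) \<subseteq> \<D>"
  shows "altsum I (\<lambda>T. f (B \<union> \<Union>(S ` T))) = 0"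
  using S B
proof (induction "\<Sum>i\<in>I. card (S i)" arbitrary: S B rule: less_induct)
  case less
  consider (empty) i where "i \<in> I" "S i = {}"
    | (single) "\<forall>i\<in>I. \<exists>D. S i = {D}"
    | (split) j D S' where "j \<in> I" "S j = insert D S'" "D \<notin> S'" "S' \<noteq> {}"
    by (metis mk_disjoint_insert equals0I)
  then show ?case
  proof cases
    case (empty i)
    then show ?thesis
      using I by (intro altsum_pairing[of I i]) auto
  next
    case single
    then obtain d where d: "\<And>i. i \<in> I \<Longrightarrow> S i = {d i}" by metis
    have inj: "inj_on d I"
    proof (rule inj_onI, rule ccontr)
      fix i k assume ik: "i \<in> I" "k \<in> I" "d i = d k" "i \<noteq> k"
      then have "S i \<inter> S k = {}" using less.prems(2) by (auto simp: disjoint_family_on_def)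
      then show False using ik d by auto
    qed
    have un: "\<Union>(S ` T) = d ` T" if "T \<subseteq> I" for T
      using d that by auto
    have "altsum I (\<lambda>T. f (B \<union> d ` T)) = 0"
      using assms(1)[OF inj] less.prems(3,4) un[OF subset_refl] by auto
    then show ?thesis
      using altsum_cong[of I "\<lambda>T. f (B \<union> \<Union>(S ` T))" "\<lambda>T. f (B \<union> d ` T)"] un by simp
  next
    case (split j D S')
    define J where "J = I - {j}"
    have J: "I = insert j J" "finite J" "j \<notin> J" using split(1) I by (auto simp: J_def)
    let ?S1 = "S(j := {D})" and ?S2 = "S(j := S')" and ?B2 = "insert D B"
    have same: "(\<Sum>i\<in>J. card ((S(j := X)) i)) = (\<Sum>i\<in>J. card (S i))" for X
      using J(3) by (intro sum.cong) auto
    have fS': "finite S'" using less.prems(1)[OF split(1)] split(2) by simp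
    have c1: "(\<Sum>i\<in>I. card (?S1 i)) < (\<Sum>i\<in>I. card (S i))"
      unfolding J(1) sum.insert[OF J(2,3)] same
      using split fS' by (simp add: card_gt_0_iff)
    have c2: "(\<Sum>i\<in>I. card (?S2 i)) < (\<Sum>i\<in>I. card (S i))"
      unfolding J(1) sum.insert[OF J(2,3)] same
      using split fS' by simp
    have disj: "S i \<inter> S k = {}" if "i \<in> I" "k \<in> I" "i \<noteq> k" for i k
      using less.prems(2) that by (auto simp: disjoint_family_on_def)
    have DS: "D \<notin> S i" "S i \<inter> S' = {}" if "i \<in> J" for i
      using disj[of i j] that J split by auto
    have 1: "altsum I (\<lambda>T. f (B \<union> \<Union>(?S1 ` T))) = 0"
    proof (rule less.hyps[OF c1])
      show "disjoint_family_on ?S1 I"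
        using disj DS J unfolding disjoint_family_on_def by (simp add: Int_commute)
      show "finite (?S1 i)" if "i \<in> I" for i using less.prems(1) that by auto
      show "B \<inter> \<Union>(?S1 ` I) = {}" "B \<union> \<Union>(?S1 ` I) \<subseteq> \<D>"
        using less.prems(3,4) split(2) by (auto simp: J(1))
    qed
    have 2: "altsum I (\<lambda>T. f (?B2 \<union> \<Union>(?S2 ` T))) = 0"
    proof (rule less.hyps[OF c2])
      show "disjoint_family_on ?S2 I"
        using disj DS J unfolding disjoint_family_on_def by (simp add: Int_commute)
      show "finite (?S2 i)" if "i \<in> I" for i using less.prems(1) that fS' by auto
      show "?B2 \<inter> \<Union>(?S2 ` I) = {}"
        using less.prems(3) split DS J by (auto simp: J(1))
      show "?B2 \<union> \<Union>(?S2 ` I) \<subseteq> \<D>"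
        using less.prems(4) split J by (auto simp: J(1))
    qed
    have un: "\<Union>(S(j := X) ` T) = \<Union>(S ` T)" if "T \<subseteq> J" for T X
      using that J(3) by auto
    have e1: "altsum J (\<lambda>T. f (B \<union> \<Union>(?S1 ` T))) = altsum J (\<lambda>T. f (B \<union> \<Union>(S ` T)))"
      by (rule altsum_cong) (simp only: un)
    have e2: "altsum J (\<lambda>T. f (B \<union> \<Union>(?S1 ` insert j T))) = altsum J (\<lambda>T. f (?B2 \<union> \<Union>(?S2 ` T)))"
    proof (rule altsum_cong)
      fix T assume "T \<subseteq> J"
      then have "B \<union> \<Union>(?S1 ` insert j T) = ?B2 \<union> \<Union>(?S2 ` T)"
        unfolding image_insert Union_insert un[OF \<open>T \<subseteq> J\<close>] by auto
      then show "f (B \<union> \<Union>(?S1 ` insert j T)) = f (?B2 \<union> \<Union>(?S2 ` T))" by simp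
    qed
    have e3: "altsum J (\<lambda>T. f (?B2 \<union> \<Union>(?S2 ` insert j T))) = altsum J (\<lambda>T. f (B \<union> \<Union>(S ` insert j T)))"
    proof (rule altsum_cong)
      fix T assume "T \<subseteq> J"
      then have "?B2 \<union> \<Union>(?S2 ` insert j T) = B \<union> \<Union>(S ` insert j T)"
        using un[of T S'] split(2) by auto
      then show "f (?B2 \<union> \<Union>(?S2 ` insert j T)) = f (B \<union> \<Union>(S ` insert j T))" by simp
    qed
    show ?thesis
      using 1 2 unfolding J(1) altsum_insert[OF J(2,3)] e1 e2 e3 by simp
  qed
qed

section \<open>The linear extension of an invariant\<close>

lemma int_scale_add: "int_scale (c + d) a = int_scale c a + int_scale d a"
proof -
  have nat_diff: "int_scale (int m - int k) a = (\<Sum>i<m. a) - (\<Sum>i<k. a)" for m k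
  proof (cases "k \<le> m")
    case True
    then obtain l where "m = k + l" using le_Suc_ex by blast
    moreover have "(\<Sum>i<k+l. a) = (\<Sum>i<k. a) + (\<Sum>i<l. a)" by (induction l) (auto simp: algebra_simps)
    ultimately show ?thesis by (simp add: int_scale_def)
  next
    case False
    then obtain l where "k = m + l" using le_Suc_ex by (metis nat_le_linear)
    moreover have "(\<Sum>i<m+l. a) = (\<Sum>i<m. a) + (\<Sum>i<l. a)" by (induction l) (auto simp: algebra_simps)
    ultimately show ?thesis by (simp add: int_scale_def)
  qed
  have plus: "(\<Sum>i<k+l. a) = (\<Sum>i<k. a) + (\<Sum>i<l. a)" for k l :: nat
    by (induction l) (auto simp: algebra_simps)
  obtain m k m' k' where c: "c = int m - int k" and d: "d = int m' - int k'"
    by (metis int_diff_cases)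
  have cd: "c + d = int (m + m') - int (k + k')" using c d by simp
  show ?thesis
    unfolding cd nat_diff unfolding c d nat_diff plus by (simp add: algebra_simps)
qed

lemma int_scale_simps [simp]: "int_scale 0 a = 0" "int_scale 1 a = a" "int_scale (- 1) a = - a"
  by (simp_all add: int_scale_def)

lemma linear_extension_eq_sum:
  assumes "finite X" "Poly_Mapping.keys x \<subseteq> X"
  shows "linear_extension v x = (\<Sum>K\<in>X. int_scale (Poly_Mapping.lookup x K) (v K))"
  unfolding linear_extension_def
  using assms by (intro sum.mono_neutral_left) (auto simp: in_keys_iff)

lemma linear_extension_add:
  "linear_extension v (x + y) = linear_extension v x + linear_extension v y"
proof -
  let ?X = "Poly_Mapping.keys x \<union> Poly_Mapping.keys y"
  have "Poly_Mapping.keys (x + y) \<subseteq> ?X" by (rule keys_add)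
  then show ?thesis
    by (simp add: linear_extension_eq_sum[of ?X] lookup_add int_scale_add sum.distrib)
qed

lemma linear_extension_0 [simp]: "linear_extension v 0 = 0"
  by (simp add: linear_extension_def)

lemma linear_extension_minus: "linear_extension v (- x) = - linear_extension v x"
  using linear_extension_add[of v x "- x"] by (simp add: eq_neg_iff_add_eq_0 add.commute)

lemma linear_extension_sum: "linear_extension v (sum f A) = (\<Sum>a\<in>A. linear_extension v (f a))"
  by (induction A rule: infinite_finite_induct) (auto simp: linear_extension_add)

lemma linear_extension_frag_of [simp]: "linear_extension v (frag_of K) = v K"
  by (simp add: linear_extension_def keys_frag_of)

lemma linear_extension_frag_cmul_eq_0:
  assumes "linear_extension v x = 0"
  shows "linear_extension v (frag_cmul c x) = 0"
proof (induction c rule: int_induct[where k = 0])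
  case (step1 i)
  then show ?case using assms by (simp add: frag_cmul_distrib linear_extension_add)
next
  case (step2 i)
  have "linear_extension v (frag_cmul (i - 1) x + x) = 0"
    using step2 by (simp add: frag_cmul_diff_distrib)
  then show ?case using assms by (simp add: linear_extension_add)
qed simp

lemma linear_extension_alternating_sum:
  "linear_extension v (alternating_sum n L) = altsum {..<n} (\<lambda>T. v (diagram_type (L T)))"
  unfolding alternating_sum_def altsum_def linear_extension_sum
  by (intro sum.cong refl) (auto simp: minus_one_power_iff linear_extension_minus)

lemma linear_extension_span_eq_0:
  assumes "\<And>g. g \<in> G \<Longrightarrow> linear_extension v g = 0" "x \<in> module.span frag_cmul G"
  shows "linear_extension v x = 0"
proof (rule module.span_induct_alt[OF module_frag_cmul assms(2)])
  fix c x y assume "x \<in> G" "linear_extension v y = 0"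
  then show "linear_extension v (frag_cmul c x + y) = 0"
    using assms(1) by (simp add: linear_extension_add linear_extension_frag_cmul_eq_0)
qed simp

section \<open>Ambient isotopies from compactly supported isotopies of Euclidean space\<close>

text \<open>The inverse of \<open>stereo\<close> off its pole \<open>(0, \<i>)\<close>.\<close>

definition unstereo :: "complex \<times> complex \<Rightarrow> complex \<times> real" where
  "unstereo x = ((1 / (1 - Im (snd x))) *\<^sub>R fst x, Re (snd x) / (1 - Im (snd x)))"

lemma norm_pair_power2: "(norm (w::complex, z))\<^sup>2 = (cmod w)\<^sup>2 + (norm z)\<^sup>2"
  by (simp add: norm_Pair)

lemma stereo_in_S3: "stereo x \<in> S3"
  and Im_stereo: "Im (snd (stereo x)) = 1 - 2 / (1 + (norm x)\<^sup>2)"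
  and unstereo_stereo: "unstereo (stereo x) = x"
proof -
  obtain w h where x: "x = (w, h)" by (cases x)
  define N where "N = 1 + (cmod w)\<^sup>2 + h\<^sup>2"
  have N: "N > 0" unfolding N_def by (smt (verit) zero_le_power2)
  have s: "stereo x = ((2 / N) *\<^sub>R w, Complex (2 * h / N) ((N - 2) / N))"
    by (simp add: stereo_def x N_def Let_def)
  have nx: "1 + (norm x)\<^sup>2 = N"
    using norm_pair_power2[of w h] by (simp add: x N_def)
  have "(norm (stereo x))\<^sup>2 = (2 / N)\<^sup>2 * (cmod w)\<^sup>2 + ((2 * h / N)\<^sup>2 + ((N - 2) / N)\<^sup>2)"
    unfolding s norm_pair_power2 using N
    by (simp add: cmod_power2[of "Complex _ _"] power_mult_distrib power_divide)
  also have "\<dots> = (4 * ((cmod w)\<^sup>2 + h\<^sup>2) + (N - 2)\<^sup>2) / N\<^sup>2"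
    by (simp add: power_divide power_mult_distrib add_divide_distrib algebra_simps)
  also have "4 * ((cmod w)\<^sup>2 + h\<^sup>2) + (N - 2)\<^sup>2 = N\<^sup>2"
    unfolding N_def by (simp add: power2_eq_square algebra_simps)
  finally have "(norm (stereo x))\<^sup>2 = 1" using N by simp
  then show "stereo x \<in> S3" by (simp add: abs_square_eq_1 power2_eq_1_iff)
  have im: "Im (snd (stereo x)) = 1 - 2 / N" using N by (simp add: s diff_divide_distrib)
  then show "Im (snd (stereo x)) = 1 - 2 / (1 + (norm x)\<^sup>2)" by (simp add: nx)
  show "unstereo (stereo x) = x"
    unfolding unstereo_def im unfolding s using N by (simp add: x)
qed

lemma Im_snd_less_1:
  assumes "x \<in> S3" "x \<noteq> (0, \<i>)"
  shows "Im (snd x) < 1"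
proof -
  obtain w z where x: "x = (w, z)" by (cases x)
  have n: "(cmod w)\<^sup>2 + ((Re z)\<^sup>2 + (Im z)\<^sup>2) = 1"
    using assms(1) norm_pair_power2[of w z] by (simp add: x cmod_power2)
  have "Im z \<le> 1"
  proof -
    have "(Im z)\<^sup>2 \<le> 1" using n by (smt (verit) zero_le_power2)
    then show ?thesis by (metis abs_le_square_iff abs_le_D1 one_power2 abs_one)
  qed
  moreover have "Im z \<noteq> 1"
  proof
    assume "Im z = 1"
    then have "w = 0" "Re z = 0" using n
      by (smt (verit) one_power2 zero_le_power2 zero_eq_power2 norm_eq_zero)+
    then show False using assms(2) \<open>Im z = 1\<close> by (simp add: x complex_eq_iff)
  qed
  ultimately show ?thesis by (simp add: x)
qed

lemma stereo_unstereo: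
  assumes "x \<in> S3" "x \<noteq> (0, \<i>)"
  shows "stereo (unstereo x) = x"
proof -
  obtain w z where x: "x = (w, z)" by (cases x)
  define M where "M = 1 - Im z"
  have M: "M > 0" using Im_snd_less_1[OF assms] by (simp add: x M_def)
  have n: "(cmod w)\<^sup>2 + (Re z)\<^sup>2 = 1 - (1 - M)\<^sup>2"
    using assms(1) norm_pair_power2[of w z] by (simp add: x cmod_power2 M_def)
  have "1 + (cmod w / M)\<^sup>2 + (Re z / M)\<^sup>2 = (M\<^sup>2 + ((cmod w)\<^sup>2 + (Re z)\<^sup>2)) / M\<^sup>2"
    using M by (simp add: power_divide add_divide_distrib)
  also have "\<dots> = 2 / M"
    unfolding n using M by (simp add: power2_eq_square field_simps)
  finally have N: "1 + (cmod w / M)\<^sup>2 + (Re z / M)\<^sup>2 = 2 / M" .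
  have "unstereo x = ((1 / M) *\<^sub>R w, Re z / M)"
    by (simp add: unstereo_def x M_def)
  moreover have nw: "cmod ((1 / M) *\<^sub>R w) = cmod w / M" using M by simp
  ultimately have "stereo (unstereo x) =
      ((2 / (2 / M)) *\<^sub>R (1 / M) *\<^sub>R w, Complex (2 * (Re z / M) / (2 / M)) ((2 / M - 2) / (2 / M)))"
    by (simp only: stereo_def Let_def case_prod_conv nw N)
  also have "\<dots> = x"
    using M by (simp add: x complex_eq_iff M_def field_simps)
  finally show ?thesis .
qed

lemma stereo_neq_pole: "stereo x \<noteq> (0, \<i>)"
proof
  assume "stereo x = (0, \<i>)"
  moreover have "1 + (norm x)\<^sup>2 > 0" by (smt (verit) zero_le_power2)
  ultimately show False using Im_stereo[of x] by simp
qed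

lemma continuous_on_stereo: "continuous_on UNIV stereo"
proof -
  have N: "1 + (cmod (fst x))\<^sup>2 + (snd x)\<^sup>2 \<noteq> 0" for x :: "complex \<times> real"
    by (smt (verit) zero_le_power2)
  show ?thesis
    unfolding stereo_def Let_def case_prod_beta Complex_eq
    using N by (intro continuous_intros) auto
qed

lemma continuous_on_unstereo: "continuous_on {x. Im (snd x) < 1} unstereo"
  unfolding unstereo_def by (intro continuous_intros) auto

lemma homeomorphism_sphere_id:
  "\<exists>\<rho>'. homeomorphism (sphere 0 1) (sphere 0 1) (\<lambda>z::complex. z) \<rho>'"
  by (auto simp: homeomorphism_def)

text \<open>
  The isotopy is conjugated by \<open>stereo\<close>.  Continuity at the pole holds because the conjugate is the identity
  outside the image of a ball, and under \<open>stereo\<close> the distance from the origin becomes a condition on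
  \<open>Im (snd x)\<close>, so that two closed pieces of the sphere can be glued.  Every stage is a homeomorphism since
  the sphere is compact.
\<close>

lemma ambient_isotopic_of_compact_isotopy:
  fixes F :: "real \<times> complex \<times> real \<Rightarrow> complex \<times> real"
  assumes cont: "continuous_on ({0..1} \<times> UNIV) F"
    and bij: "\<And>t. t \<in> {0..1} \<Longrightarrow> bij (\<lambda>x. F (t, x))"
    and F0: "\<And>x. F (0, x) = x"
    and supp: "\<And>t x. t \<in> {0..1} \<Longrightarrow> R \<le> norm x \<Longrightarrow> F (t, x) = x"
    and F1: "\<And>s. s \<in> circles k \<Longrightarrow> F (1, e s) = e' s"
  shows "ambient_isotopic \<lparr>ncomponents = k, embedding = (\<lambda>s. stereo (e s))\<rparr>
                          \<lparr>ncomponents = k, embedding = (\<lambda>s. stereo (e' s))\<rparr>"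
proof -
  define r where "r = max R 0"
  have r: "r \<ge> 0" "\<And>t x. t \<in> {0..1} \<Longrightarrow> r \<le> norm x \<Longrightarrow> F (t, x) = x"
    using supp by (auto simp: r_def)
  define \<kappa> where "\<kappa> = 1 - 2 / (1 + r\<^sup>2)"
  have r1: "1 + r\<^sup>2 > 0" by (smt (verit) zero_le_power2)
  have \<kappa>: "\<kappa> < 1" using r1 by (simp add: \<kappa>_def)
  have le_iff: "\<kappa> \<le> Im (snd (stereo x)) \<longleftrightarrow> r \<le> norm x" for x
  proof -
    have "1 + (norm x)\<^sup>2 > 0" by (smt (verit) zero_le_power2)
    then have "\<kappa> \<le> Im (snd (stereo x)) \<longleftrightarrow> 2 / (1 + (norm x)\<^sup>2) \<le> 2 / (1 + r\<^sup>2)"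
      by (simp add: \<kappa>_def Im_stereo)
    also have "\<dots> \<longleftrightarrow> r\<^sup>2 \<le> (norm x)\<^sup>2"
      using r1 \<open>1 + (norm x)\<^sup>2 > 0\<close> by (simp add: field_simps)
    also have "\<dots> \<longleftrightarrow> r \<le> norm x" using r(1) by (simp add: power_mono_iff)
    finally show ?thesis .
  qed
  define H where "H = (\<lambda>(t, x). if Im (snd x) \<le> \<kappa> then stereo (F (t, unstereo x)) else x)"
  have H_conj: "H (t, stereo y) = stereo (F (t, y))" if "t \<in> {0..1}" for t y
    using le_iff[of y] r(2)[OF that, of y] by (auto simp: H_def unstereo_stereo)
  have H_pole: "H (t, (0, \<i>)) = (0, \<i>)" for t using \<kappa> by (simp add: H_def)
  have S3_cases: "x = (0, \<i>) \<or> (\<exists>y. x = stereo y)" if "x \<in> S3" for x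
    using stereo_unstereo[OF that] by metis
  have contH: "continuous_on ({0..1} \<times> S3) H"
    unfolding H_def case_prod_beta
  proof (rule continuous_on_cases_le)
    let ?A = "{p \<in> {0..1::real} \<times> S3. Im (snd (snd p)) \<le> \<kappa>}"
    have "continuous_on ?A (\<lambda>p. unstereo (snd p))"
      by (rule continuous_on_compose2[OF continuous_on_unstereo])
         (use \<kappa> in \<open>auto intro!: continuous_intros\<close>)
    then have "continuous_on ?A (\<lambda>p. (fst p, unstereo (snd p)))"
      by (intro continuous_intros)
    then have "continuous_on ?A (\<lambda>p. F (fst p, unstereo (snd p)))"
      by (rule continuous_on_compose2[OF cont]) auto
    then show "continuous_on ?A (\<lambda>p. stereo (F (fst p, unstereo (snd p))))"
      by (rule continuous_on_compose2[OF continuous_on_stereo]) auto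
    show "continuous_on {p \<in> {0..1} \<times> S3. \<kappa> \<le> Im (snd (snd p))} snd"
         "continuous_on ({0..1::real} \<times> S3) (\<lambda>p. Im (snd (snd p)))"
      by (intro continuous_intros)+
    fix p :: "real \<times> complex \<times> complex"
    assume p: "p \<in> {0..1} \<times> S3" "Im (snd (snd p)) = \<kappa>"
    then have "snd p \<in> S3" "snd p \<noteq> (0, \<i>)" using \<kappa> by auto
    then obtain y where y: "snd p = stereo y" using S3_cases by blast
    then show "stereo (F (fst p, unstereo (snd p))) = snd p"
      using p le_iff[of y] r(2)[of "fst p" y] by (auto simp: unstereo_stereo)
  qed
  have hom: "\<exists>G. homeomorphism S3 S3 (\<lambda>x. H (t, x)) G" if t: "t \<in> {0..1}" for t
  proof (rule homeomorphism_compact)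
    show "compact S3" by simp
    show "continuous_on S3 (\<lambda>x. H (t, x))"
      by (rule continuous_on_compose2[OF contH]) (use t in \<open>auto intro!: continuous_intros\<close>)
    have inS: "H (t, x) \<in> S3" if "x \<in> S3" for x
      using S3_cases[OF that] that H_conj[OF t] H_pole stereo_in_S3 by metis
    have sur: "\<exists>x'\<in>S3. H (t, x') = x" if "x \<in> S3" for x
    proof (cases "x = (0, \<i>)")
      case False
      then obtain y where y: "x = stereo y" using S3_cases \<open>x \<in> S3\<close> by blast
      obtain y' where "F (t, y') = y" using bij[OF t] by (metis bij_pointE)
      then show ?thesis using y H_conj[OF t] stereo_in_S3 by metis
    qed (use H_pole that in blast)
    show "(\<lambda>x. H (t, x)) ` S3 = S3" using inS sur by blast
    show "inj_on (\<lambda>x. H (t, x)) S3"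
    proof (rule inj_onI)
      fix x x' assume xx: "x \<in> S3" "x' \<in> S3" "H (t, x) = H (t, x')"
      have inj: "y = y'" if "stereo (F (t, y)) = stereo (F (t, y'))" for y y'
        using that unstereo_stereo bij[OF t] by (metis bij_pointE)
      show "x = x'"
        using S3_cases[OF xx(1)] S3_cases[OF xx(2)] xx(3) H_conj[OF t] H_pole[of t]
          stereo_neq_pole inj by metis
    qed
  qed
  show ?thesis
    unfolding ambient_isotopic_def
  proof (intro conjI exI[of _ H] exI[of _ id] exI[of _ "\<lambda>_ x. x"])
    show "\<forall>x\<in>S3. H (0, x) = x"
    proof
      fix x assume "x \<in> S3"
      then show "H (0, x) = x" using S3_cases H_conj[of 0] H_pole[of 0] F0 by fastforce
    qed
    show "\<forall>t\<in>{0..1}. \<exists>G. homeomorphism S3 S3 (\<lambda>x. H (t, x)) G" using hom by blast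
    show "id permutes {..<ncomponents \<lparr>ncomponents = k, embedding = \<lambda>s. stereo (e s)\<rparr>}"
      by (rule permutes_id)
    show "\<forall>i<ncomponents \<lparr>ncomponents = k, embedding = \<lambda>s. stereo (e s)\<rparr>.
       (\<exists>\<rho>'. homeomorphism (sphere 0 1) (sphere 0 1) (\<lambda>x::complex. x) \<rho>') \<and>
       homotopic_with_canon (\<lambda>_. True) (sphere 0 1) (sphere 0 1) (\<lambda>x::complex. x) id \<and>
       (\<forall>z\<in>sphere 0 1.
           H (1, embedding \<lparr>ncomponents = k, embedding = \<lambda>s. stereo (e s)\<rparr> (i, z)) =
           embedding \<lparr>ncomponents = k, embedding = \<lambda>s. stereo (e' s)\<rparr> (id i, z))"
    proof (intro allI impI conjI ballI)
      fix i and z :: complex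
      assume "i < ncomponents \<lparr>ncomponents = k, embedding = \<lambda>s. stereo (e s)\<rparr>" "z \<in> sphere 0 1"
      then have "(i, z) \<in> circles k" by (simp add: circles_def)
      then show "H (1, embedding \<lparr>ncomponents = k, embedding = \<lambda>s. stereo (e s)\<rparr> (i, z)) =
           embedding \<lparr>ncomponents = k, embedding = \<lambda>s. stereo (e' s)\<rparr> (id i, z)"
        using H_conj[of 1] F1 by simp
    qed (rule homeomorphism_sphere_id, simp add: id_def)
  qed (use contH in auto)
qed

section \<open>The link type does not depend on the heights\<close>

lemma compact_source: "compact (circles k)"
  by (simp add: circles_def compact_Times finite_imp_compact)

lemma Tietze_real:
  fixes f :: "'a::{metric_space,second_countable_topology} \<Rightarrow> real"
  assumes "continuous_on S f" "closedin (top_of_set U) S" "\<And>x. x \<in> S \<Longrightarrow> \<bar>f x\<bar> \<le> B" "0 \<le> B"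
  obtains g where "continuous_on U g" "\<And>x. x \<in> S \<Longrightarrow> g x = f x" "\<And>x. x \<in> U \<Longrightarrow> \<bar>g x\<bar> \<le> B"
  using Tietze[OF assms(1,2,4)] assms(3) by (metis real_norm_def)

text \<open>
  The type \<^typ>\<open>nat\<close> carries no metric, so the extension is made in \<open>\<real> \<times> \<complex>\<close>, which contains a copy
  of the source of a diagram.
\<close>

lemma Tietze_source:
  fixes f :: "nat \<times> complex \<Rightarrow> real"
  assumes S: "compact S" and f: "continuous_on S f" and B: "\<And>s. s \<in> S \<Longrightarrow> \<bar>f s\<bar> \<le> B" "0 \<le> B"
  obtains g where "continuous_on UNIV g" "\<And>s. s \<in> S \<Longrightarrow> g s = f s" "\<And>s. \<bar>g s\<bar> \<le> B"
proof -
  define j :: "nat \<times> complex \<Rightarrow> real \<times> complex" where "j = (\<lambda>s. (real (fst s), snd s))"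
  have "continuous_on X (\<lambda>s :: nat \<times> complex. real (fst s))" for X
    by (intro continuous_intros)
  then have contj: "continuous_on X j" for X
    unfolding j_def by (intro continuous_intros)
  have "inj_on j S" by (auto simp: inj_on_def j_def prod_eq_iff)
  then obtain k where k: "homeomorphism S (j ` S) j k"
    using homeomorphism_compact[OF S contj] by blast
  have cl: "closedin (top_of_set UNIV) (j ` S)"
    using compact_continuous_image[OF contj S] by (simp add: compact_imp_closed)
  have kj: "k (j s) = s" if "s \<in> S" for s using k that by (simp add: homeomorphism_def)
  have "continuous_on (j ` S) (\<lambda>y. f (k y))"
    by (rule continuous_on_compose2[OF f]) (use k in \<open>auto simp: homeomorphism_def\<close>)
  moreover have "\<bar>f (k y)\<bar> \<le> B" if "y \<in> j ` S" for y using that B(1) kj by auto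
  ultimately obtain g where g: "continuous_on UNIV g" "\<And>y. y \<in> j ` S \<Longrightarrow> g y = f (k y)" "\<And>y. \<bar>g y\<bar> \<le> B"
    using Tietze_real[OF _ cl _ B(2), of "\<lambda>y. f (k y)"] by (metis UNIV_I)
  show ?thesis
  proof (rule that[of "\<lambda>s. g (j s)"])
    show "continuous_on UNIV (\<lambda>s. g (j s))"
      by (rule continuous_on_compose2[OF g(1) contj]) auto
  qed (use g kj in auto)
qed

lemma link_diagramD:
  assumes "link_diagram L"
  shows "continuous_on (source L) (curve L)" "finite (crossings L)"
    "\<And>p. p \<in> crossings L \<Longrightarrow> transverse_crossing L p"
  using assms unfolding link_diagram_def by blast+

lemma over_iff_not_over:
  assumes "link_diagram L" "s \<in> source L" "t \<in> source L" "s \<noteq> t" "curve L s = curve L t"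
  shows "s \<in> over L \<longleftrightarrow> t \<notin> over L"
proof -
  have "\<forall>s\<in>source L. \<forall>t\<in>source L. s \<noteq> t \<and> curve L s = curve L t \<longrightarrow> (s \<in> over L \<longleftrightarrow> t \<notin> over L)"
    using assms(1) unfolding link_diagram_def by (elim conjE)
  then show ?thesis using assms(2-) by blast
qed

lemma at_most_two_preimages:
  assumes "link_diagram L" "s \<in> source L" "t \<in> source L" "r \<in> source L"
    "curve L s = curve L t" "curve L r = curve L t" "s \<noteq> t"
  shows "r = s \<or> r = t"
  using over_iff_not_over[OF assms(1)] assms(2-) by metis

lemma finite_crossing_points:
  assumes "link_diagram L"
  shows "finite {s \<in> source L. curve L s \<in> crossings L}"
proof -
  have fib: "finite {s \<in> source L. curve L s = p}" for p
  proof (cases "\<exists>s t. s \<in> source L \<and> t \<in> source L \<and> s \<noteq> t \<and> curve L s = p \<and> curve L t = p")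
    case True
    then obtain s t where "s \<in> source L" "t \<in> source L" "s \<noteq> t" "curve L s = p" "curve L t = p"
      by blast
    then have "{s \<in> source L. curve L s = p} \<subseteq> {s, t}"
      using at_most_two_preimages[OF assms] by blast
    then show ?thesis by (rule finite_subset) simp
  next
    case False
    then have "s = t" if "s \<in> {s \<in> source L. curve L s = p}" "t \<in> {s \<in> source L. curve L s = p}" for s t
      using that by blast
    then have "is_singleton {s \<in> source L. curve L s = p} \<or> {s \<in> source L. curve L s = p} = {}"
      by (metis (no_types, lifting) equals0I is_singletonI')
    then show ?thesis by (elim disjE is_singletonE) (simp_all only: finite.emptyI finite_insert)
  qed
  have "{s \<in> source L. curve L s \<in> crossings L} = (\<Union>p\<in>crossings L. {s \<in> source L. curve L s = p})"
    by auto
  then show ?thesis using assms fib by (simp add: link_diagram_def)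
qed

lemma heights_exist:
  assumes L: "link_diagram L"
  shows "\<exists>h. heights L h"
proof -
  let ?X = "{s \<in> source L. curve L s \<in> crossings L}" and ?f = "\<lambda>s. of_bool (s \<in> over L) :: real"
  have "compact ?X" "continuous_on ?X ?f"
    using finite_crossing_points[OF L] by (auto intro: finite_imp_compact continuous_on_finite)
  then obtain h where "continuous_on UNIV h" and h1: "\<And>s. s \<in> ?X \<Longrightarrow> h s = ?f s"
    by (rule Tietze_source[where B = 1]) auto
  then have h: "continuous_on (source L) h" by (auto intro: continuous_on_subset)
  have "heights L h"
    unfolding heights_def
  proof (intro conjI h ballI impI)
    fix s t assume st: "s \<in> source L" "t \<in> source L" "s \<noteq> t \<and> curve L s = curve L t \<and> s \<in> over L"
    then have "curve L s \<in> crossings L" by (auto simp: crossings_def)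
    moreover have "t \<notin> over L" using over_iff_not_over[OF L, of s t] st by simp
    ultimately
    show "h t < h s" using st h1[of s] h1[of t] by auto
  qed
  then show ?thesis by blast
qed

text \<open>
  The piecewise linear map of the line that has \<open>-R \<mapsto> -R\<close>, \<open>l \<mapsto> l'\<close>, \<open>u \<mapsto> u'\<close>, \<open>R \<mapsto> R\<close> and is the
  identity beyond.  Written with \<open>max\<close> and \<open>min\<close> it is visibly continuous in all its parameters.
\<close>

definition two_point_map :: "real \<Rightarrow> real \<Rightarrow> real \<Rightarrow> real \<Rightarrow> real \<Rightarrow> real \<Rightarrow> real" where
  "two_point_map R l u l' u' z =
     l' + (l' + R) / (l + R) * (max (- R) (min z l) - l)
        + (u' - l') / (u - l) * (max l (min z u) - l)
        + (R - u') / (R - u) * (max u (min z R) - u)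
        + (z - max (- R) (min z R))"

context
  fixes R l u l' u' :: real
  assumes ord: "- R < l" "l < u" "u < R" and ord': "- R < l'" "l' < u'" "u' < R"
begin

lemma two_point_map_l: "two_point_map R l u l' u' l = l'"
proof -
  have m: "max (- R) l = l" "min l u = l" "min l R = l" "max u l = u"
    using ord by auto
  show ?thesis unfolding two_point_map_def by (simp add: m)
qed

lemma two_point_map_u: "two_point_map R l u l' u' u = u'"
proof -
  have m: "min u l = l" "max (- R) l = l" "max l u = u" "min u R = u" "max (- R) u = u"
    using ord by auto
  have "(u' - l') / (u - l) * (u - l) = u' - l'" using ord by simp
  then show ?thesis unfolding two_point_map_def by (simp add: m)
qed

lemma two_point_map_outside:
  assumes "R \<le> \<bar>z\<bar>"
  shows "two_point_map R l u l' u' z = z"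
proof (cases "z \<le> 0")
  case True
  then have m: "min z l = z" "max (- R) z = - R" "min z u = z" "max l z = l" "min z R = z" "max u z = u"
    using assms ord by auto
  have "(l' + R) / (l + R) * (- R - l) = - (l' + R)" using ord by (simp add: field_simps)
  then show ?thesis unfolding two_point_map_def m by simp
next
  case False
  then have m: "min z l = l" "max (- R) l = l" "min z u = u" "max l u = u" "min z R = R"
      "max u R = R" "max (- R) R = R"
    using assms ord by auto
  have "(u' - l') / (u - l) * (u - l) = u' - l'" "(R - u') / (R - u) * (R - u) = R - u'"
    using ord by simp_all
  then show ?thesis unfolding two_point_map_def m by simp
qed

lemma two_point_map_strict_mono: "y < z \<Longrightarrow> two_point_map R l u l' u' y < two_point_map R l u l' u' z"
proof -
  assume yz: "y < z"
  define a b c where "a = (l' + R) / (l + R)" "b = (u' - l') / (u - l)" "c = (R - u') / (R - u)"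
  have abc: "a > 0" "b > 0" "c > 0" using ord ord' by (auto simp: a_b_c_def)
  define A B C D where "A = max (- R) (min z l) - max (- R) (min y l)"
    "B = max l (min z u) - max l (min y u)" "C = max u (min z R) - max u (min y R)"
    "D = (z - max (- R) (min z R)) - (y - max (- R) (min y R))"
  have ge: "A \<ge> 0" "B \<ge> 0" "C \<ge> 0" "D \<ge> 0"
    using ord yz unfolding A_B_C_D_def max_def min_def by (simp_all split: if_split)
  have "max (- R) (min x l) + max l (min x u) + max u (min x R) = max (- R) (min x R) + l + u" for x
    using ord unfolding max_def min_def by (smt (verit))
  from this[of y] this[of z] have sum: "A + B + C + D = z - y"
    unfolding A_B_C_D_def by linarith
  have "two_point_map R l u l' u' z - two_point_map R l u l' u' y = a * A + b * B + c * C + D"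
    unfolding two_point_map_def a_b_c_def[symmetric] A_B_C_D_def by (simp add: algebra_simps)
  moreover have "a * A + b * B + c * C + D > 0"
  proof -
    have nn: "a * A \<ge> 0" "b * B \<ge> 0" "c * C \<ge> 0" using abc ge by auto
    consider "A > 0" | "B > 0" | "C > 0" | "D > 0" using ge sum yz by linarith
    then show ?thesis
      using nn ge abc by cases (smt (verit) mult_pos_pos)+
  qed
  ultimately show ?thesis by linarith
qed

end

text \<open>
  Where the curve is injective, a function on the source is a function on the image of the curve; it
  is continuous there because a map from a compact space is closed.
\<close>

lemma extend_along_curve:
  fixes c :: "nat \<times> complex \<Rightarrow> complex" and h :: "nat \<times> complex \<Rightarrow> real"
  assumes S: "compact S" and c: "continuous_on S c" and h: "continuous_on S h"
    and inj: "inj_on c {s \<in> S. c s \<in> W}" and B: "\<And>s. s \<in> S \<Longrightarrow> \<bar>h s\<bar> \<le> B" "0 \<le> B"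
  obtains f where "continuous_on W f" "\<And>s. s \<in> S \<Longrightarrow> c s \<in> W \<Longrightarrow> f (c s) = h s"
    "\<And>w. w \<in> W \<Longrightarrow> \<bar>f w\<bar> \<le> B"
proof -
  let ?S = "{s \<in> S. c s \<in> W}" and ?T = "c ` S \<inter> W"
  define g where "g = the_inv_into ?S c"
  have gc: "g (c s) = s" if "s \<in> ?S" for s
    unfolding g_def using the_inv_into_f_f[OF inj that] .
  have "continuous_on ?T g"
  proof (rule continuous_on_inverse_closed_map)
    show "\<And>s. s \<in> ?S \<Longrightarrow> g (c s) = s" by (rule gc)
    show "continuous_on ?S c" using c by (rule continuous_on_subset) auto
    show "c ` ?S = ?T" by auto
    fix U assume "closedin (top_of_set ?S) U"
    then obtain C where C: "closed C" "U = ?S \<inter> C" by (auto simp: closedin_closed)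
    have "compact (c ` (S \<inter> C))"
      using S c C by (intro compact_continuous_image) (auto intro: continuous_on_subset compact_Int_closed)
    then have "closed (c ` (S \<inter> C))" by (rule compact_imp_closed)
    moreover have "c ` U = ?T \<inter> c ` (S \<inter> C)" using C inj by (auto simp: inj_on_def)
    ultimately show "closedin (top_of_set ?T) (c ` U)" by (auto simp: closedin_closed)
  qed
  then have hg: "continuous_on ?T (h \<circ> g)"
    by (rule continuous_on_compose) (use gc in \<open>auto intro: continuous_on_subset[OF h]\<close>)
  have cl: "closedin (top_of_set W) ?T"
    using compact_imp_closed[OF compact_continuous_image[OF c S]]
    by (auto simp: closedin_closed)
  have "\<bar>(h \<circ> g) w\<bar> \<le> B" if "w \<in> ?T" for w
    using that gc B by auto
  then obtain f where
    "continuous_on W f" "\<And>w. w \<in> ?T \<Longrightarrow> f w = (h \<circ> g) w" "\<And>w. w \<in> W \<Longrightarrow> \<bar>f w\<bar> \<le> B"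
    using Tietze_real[OF hg cl _ B(2)] by metis
  then show ?thesis using gc by (intro that[of f]) auto
qed

text \<open>
  \<open>\<phi>\<close> describes, over the region \<open>W\<close> of the plane, a map \<open>(w, z) \<mapsto> (w, \<phi> (w, z))\<close> of the space that
  carries the link with heights \<open>h\<close> to the one with heights \<open>h'\<close>.
\<close>

definition shear_on :: "diagram \<Rightarrow> (nat \<times> complex \<Rightarrow> real) \<Rightarrow> (nat \<times> complex \<Rightarrow> real) \<Rightarrow> real \<Rightarrow>
    complex set \<Rightarrow> (complex \<times> real \<Rightarrow> real) \<Rightarrow> bool" where
  "shear_on L h h' R W \<phi> \<longleftrightarrow>
     continuous_on (W \<times> UNIV) \<phi> \<and>
     (\<forall>w\<in>W. strict_mono (\<lambda>z. \<phi> (w, z))) \<and>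
     (\<forall>w\<in>W. \<forall>z. R \<le> \<bar>z\<bar> \<longrightarrow> \<phi> (w, z) = z) \<and>
     (\<forall>s\<in>source L. curve L s \<in> W \<longrightarrow> \<phi> (curve L s, h s) = h' s)"

lemma shear_on_subset: "shear_on L h h' R W \<phi> \<Longrightarrow> V \<subseteq> W \<Longrightarrow> shear_on L h h' R V \<phi>"
  unfolding shear_on_def by (auto 0 3 intro: continuous_on_subset)

lemma shear_on_two_point_map:
  fixes l u l' u' :: "complex \<Rightarrow> real"
  assumes cont: "continuous_on W l" "continuous_on W u" "continuous_on W l'" "continuous_on W u'"
    and ord: "\<And>w. w \<in> W \<Longrightarrow> - R < l w \<and> l w < u w \<and> u w < R"
    and ord': "\<And>w. w \<in> W \<Longrightarrow> - R < l' w \<and> l' w < u' w \<and> u' w < R"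
    and match: "\<And>s. s \<in> source L \<Longrightarrow> curve L s \<in> W \<Longrightarrow>
        h s = l (curve L s) \<and> h' s = l' (curve L s) \<or> h s = u (curve L s) \<and> h' s = u' (curve L s)"
  shows "shear_on L h h' R W (\<lambda>(w, z). two_point_map R (l w) (u w) (l' w) (u' w) z)"
  unfolding shear_on_def
proof (intro conjI ballI impI allI)
  have fst: "continuous_on (W \<times> (UNIV :: real set)) (\<lambda>x. f (fst x))" if "continuous_on W f"
    for f :: "complex \<Rightarrow> real"
    by (rule continuous_on_compose2[OF that]) (auto intro!: continuous_intros)
  have ne: "l w + R \<noteq> 0" "u w - l w \<noteq> 0" "R - u w \<noteq> 0" if "w \<in> W" for w
    using ord[OF that] by auto
  show "continuous_on (W \<times> UNIV) (\<lambda>(w, z). two_point_map R (l w) (u w) (l' w) (u' w) z)"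
    unfolding two_point_map_def case_prod_beta
    by (intro continuous_intros fst cont) (use ne in auto)
next
  fix w assume "w \<in> W"
  then show "strict_mono (\<lambda>z. case (w, z) of (w, z) \<Rightarrow> two_point_map R (l w) (u w) (l' w) (u' w) z)"
    using two_point_map_strict_mono ord ord' by (simp add: strict_mono_def)
next
  fix w z assume "w \<in> W" "R \<le> \<bar>z\<bar>"
  then show "(case (w, z) of (w, z) \<Rightarrow> two_point_map R (l w) (u w) (l' w) (u' w) z) = z"
    using two_point_map_outside ord ord' by simp
next
  fix s assume s: "s \<in> source L" "curve L s \<in> W"
  let ?w = "curve L s"
  have "two_point_map R (l ?w) (u ?w) (l' ?w) (u' ?w) (l ?w) = l' ?w" "two_point_map R (l ?w) (u ?w) (l' ?w) (u' ?w) (u ?w) = u' ?w"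
    using two_point_map_l two_point_map_u ord[OF s(2)] ord'[OF s(2)] by auto
  then show "(case (curve L s, h s) of (w, z) \<Rightarrow> two_point_map R (l w) (u w) (l' w) (u' w) z) = h' s"
    using match[OF s] by auto
qed

lemma strict_mono_convex_comb:
  fixes f g :: "real \<Rightarrow> real"
  assumes "strict_mono f" "strict_mono g" "0 \<le> c" "c \<le> 1"
  shows "strict_mono (\<lambda>z. (1 - c) * f z + c * g z)"
proof (rule strict_monoI)
  fix x y :: real assume "x < y"
  then have "f x < f y" "g x < g y" using assms by (auto simp: strict_mono_def)
  then show "(1 - c) * f x + c * g x < (1 - c) * f y + c * g y"
    using assms(3,4)
    by (cases "c = 0") (auto intro!: add_le_less_mono mult_left_mono mult_strict_left_mono)
qed

text \<open>
  All conditions in \<open>shear_on\<close> survive convex combinations, so two local solutions can be interpolated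
  with a cut-off function around \<open>p\<close>.
\<close>

lemma shear_on_glue:
  assumes 1: "shear_on L h h' R (- insert p Y) \<phi>1" and 2: "shear_on L h h' R (ball p e) \<phi>2"
    and Y: "finite Y" "Y \<inter> ball p e = {}" and e: "e > 0"
  shows "\<exists>\<phi>. shear_on L h h' R (- Y) \<phi>"
proof -
  define c where "c = (\<lambda>w. max 0 (min 1 (2 - 3 * dist p w / e)))"
  define \<phi> where "\<phi> = (\<lambda>x. (1 - c (fst x)) * \<phi>1 x + c (fst x) * \<phi>2 x)"
  have c01: "0 \<le> c w" "c w \<le> 1" for w by (auto simp: c_def)
  have c0: "c w = 0" if "2 * e / 3 \<le> dist p w" for w
    using that e by (auto simp: c_def max_def min_def field_simps)
  have c1: "c w = 1" if "dist p w \<le> e / 3" for w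
    using that e by (auto simp: c_def max_def min_def field_simps)
  have cc: "continuous_on X (\<lambda>x. c (fst x))" for X :: "(complex \<times> real) set"
    unfolding c_def using e by (intro continuous_intros) auto
  have w1: "w \<in> - insert p Y" if "w \<notin> Y" "c w \<noteq> 1" for w
    using that c1[of w] e by auto
  have w2: "w \<in> ball p e" if "c w \<noteq> 0" for w
    using that c0[of w] e by force
  define O1 O2 O3 where "O1 = (- Y) \<inter> - cball p (2 * e / 3)" "O2 = ball p e - {p}" "O3 = ball p (e / 3)"
  have op: "open O1" "open O2" "open O3"
    using Y(1) by (auto simp: O1_O2_O3_def finite_imp_closed open_Compl)
  have un: "- Y = O1 \<union> O2 \<union> O3"
    using Y(2) e by (auto simp: O1_O2_O3_def)
  have sub: "O1 \<subseteq> - insert p Y" "O2 \<subseteq> - insert p Y" "O2 \<subseteq> ball p e" "O3 \<subseteq> ball p e"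
    using Y(2) e by (auto simp: O1_O2_O3_def)
  have cont: "continuous_on (X \<times> UNIV) \<phi>1" if "X \<subseteq> - insert p Y" for X
    using 1 that unfolding shear_on_def by (meson continuous_on_subset Sigma_mono subset_refl)
  have cont': "continuous_on (X \<times> UNIV) \<phi>2" if "X \<subseteq> ball p e" for X
    using 2 that unfolding shear_on_def by (meson continuous_on_subset Sigma_mono subset_refl)
  have "continuous_on (O1 \<times> UNIV) \<phi>"
    by (rule continuous_on_eq[OF cont[OF sub(1)]]) (auto simp: \<phi>_def O1_O2_O3_def c0)
  moreover have "continuous_on (O2 \<times> UNIV) \<phi>"
    unfolding \<phi>_def by (intro continuous_intros cc cont cont' sub)
  moreover have "continuous_on (O3 \<times> UNIV) \<phi>"
    by (rule continuous_on_eq[OF cont'[OF sub(4)]]) (auto simp: \<phi>_def O1_O2_O3_def c1)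
  ultimately have "continuous_on (O1 \<times> UNIV \<union> O2 \<times> UNIV \<union> O3 \<times> UNIV) \<phi>"
    using op by (intro continuous_on_open_Un open_Un open_Times) auto
  then have contphi: "continuous_on ((- Y) \<times> UNIV) \<phi>"
    by (simp add: un Sigma_Un_distrib1)
  have cases: "c w = 0 \<and> w \<in> - insert p Y \<or> c w = 1 \<and> w \<in> ball p e \<or> w \<in> - insert p Y \<and> w \<in> ball p e"
    if "w \<in> - Y" for w
    using that w1[of w] w2[of w] by force
  have "shear_on L h h' R (- Y) \<phi>"
    unfolding shear_on_def
  proof (intro conjI ballI impI allI contphi)
    fix w assume w: "w \<in> - Y"
    have sm: "w \<in> - insert p Y \<Longrightarrow> strict_mono (\<lambda>z. \<phi>1 (w, z))" "w \<in> ball p e \<Longrightarrow> strict_mono (\<lambda>z. \<phi>2 (w, z))"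
      using 1 2 unfolding shear_on_def by blast+
    show "strict_mono (\<lambda>z. \<phi> (w, z))"
      using cases[OF w]
    proof (elim disjE conjE)
      assume "w \<in> - insert p Y" "w \<in> ball p e"
      then show ?thesis
        unfolding \<phi>_def fst_conv by (intro strict_mono_convex_comb sm c01)
    qed (simp_all add: \<phi>_def sm)
    show "\<phi> (w, z) = z" if "R \<le> \<bar>z\<bar>" for z
      using cases[OF w] 1 2 that by (auto simp: shear_on_def \<phi>_def algebra_simps)
  next
    fix s assume s: "s \<in> source L" "curve L s \<in> - Y"
    show "\<phi> (curve L s, h s) = h' s"
      using cases[OF s(2)] 1 2 s(1) by (auto simp: shear_on_def \<phi>_def algebra_simps)
  qed
  then show ?thesis by blast
qed

text \<open>
  Near a crossing the link consists of a lower and an upper strand.  \<open>SA\<close> and \<open>SB\<close> are compact sets that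
  cover the source and separate the two preimages of the crossing; near the crossing the curve is
  injective on each of them, hence the heights on \<open>SA\<close> and on \<open>SB\<close> extend to functions \<open>l\<close> and \<open>u\<close> on
  the plane, with \<open>l < u\<close> close to the crossing.
\<close>

lemma shear_near_crossing:
  assumes L: "link_diagram L" and h: "heights L h" and h': "heights L h'"
    and B: "\<And>s. s \<in> source L \<Longrightarrow> \<bar>h s\<bar> \<le> B" "\<And>s. s \<in> source L \<Longrightarrow> \<bar>h' s\<bar> \<le> B" "0 \<le> B" "B < R"
    and p: "p \<in> crossings L"
  shows "\<exists>e>0. \<exists>\<phi>. shear_on L h h' R (ball p e) \<phi>"
proof -
  let ?c = "curve L"
  have contc: "continuous_on (source L) ?c" and conth: "continuous_on (source L) h" "continuous_on (source L) h'"
    using L h h' by (auto simp: link_diagram_def heights_def)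
  obtain s t where st: "s \<in> source L" "t \<in> source L" "?c s = p" "?c t = p" "s \<noteq> t" "t \<in> over L"
    using p over_iff_not_over[OF L] unfolding crossings_def by blast
  have less: "h s < h t" "h' s < h' t"
    using h h' st unfolding heights_def by metis+
  define m m' where "m = (h s + h t) / 2" and "m' = (h' s + h' t) / 2"
  have m: "h s < m" "m < h t" "h' s < m'" "m' < h' t" using less by (simp_all add: m_def m'_def)
  define SA where "SA = {x \<in> source L. h x \<le> m} \<union> {x \<in> source L. h' x \<le> m'}"
  define SB where "SB = {x \<in> source L. m \<le> h x} \<inter> {x \<in> source L. m' \<le> h' x}"
  have cl: "closedin (top_of_set (source L)) {x \<in> source L. f x \<le> a}"
    "closedin (top_of_set (source L)) {x \<in> source L. a \<le> f x}"
    if "continuous_on (source L) f" for f and a :: real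
  proof -
    have "{x \<in> source L. f x \<le> a} = source L \<inter> f -` {..a}" "{x \<in> source L. a \<le> f x} = source L \<inter> f -` {a..}"
      by auto
    then show "closedin (top_of_set (source L)) {x \<in> source L. f x \<le> a}"
        "closedin (top_of_set (source L)) {x \<in> source L. a \<le> f x}"
      using continuous_closedin_preimage[OF that] by auto
  qed
  have SAB: "compact SA" "compact SB"
    unfolding SA_def SB_def
    using closedin_compact[OF compact_source[of "ncomp L"]]
    by (simp_all add: closedin_Un closedin_Int cl conth)
  have sub: "SA \<subseteq> source L" "SB \<subseteq> source L" "source L = SA \<union> SB" by (auto simp: SA_def SB_def)
  have mem: "s \<in> SA" "t \<notin> SA" "t \<in> SB" "s \<notin> SB" using st m by (auto simp: SA_def SB_def)
  obtain d where d: "d > 0" "\<And>q. q \<in> crossings L \<Longrightarrow> q \<noteq> p \<Longrightarrow> d \<le> dist p q"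
    using finite_set_avoid[of "crossings L" p] L by (auto simp: link_diagram_def)
  have inj: "inj_on ?c {x \<in> X. ?c x \<in> ball p d}"
    if X: "X \<subseteq> source L" "\<not> (s \<in> X \<and> t \<in> X)" for X
  proof (rule inj_onI, rule ccontr)
    fix x y assume xy: "x \<in> {x \<in> X. ?c x \<in> ball p d}" "y \<in> {x \<in> X. ?c x \<in> ball p d}" "?c x = ?c y" "x \<noteq> y"
    then have "?c x \<in> crossings L" using X by (auto simp: crossings_def)
    then have cx: "?c x = p" using d(2)[of "?c x"] xy(1) by auto
    have "r = s \<or> r = t" if "r \<in> {x, y}" for r
      using at_most_two_preimages[OF L st(1,2), of r] st that cx xy X by auto
    then have "{x, y} = {s, t}" using xy(4) by blast
    then show False using xy(1,2) X(2) by auto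
  qed
  have ext: "\<exists>f. continuous_on (ball p d) f \<and> (\<forall>s\<in>X. ?c s \<in> ball p d \<longrightarrow> f (?c s) = g s) \<and>
      (\<forall>w\<in>ball p d. \<bar>f w\<bar> \<le> B)"
    if X: "compact X" "X \<subseteq> source L" "\<not> (s \<in> X \<and> t \<in> X)"
      and g: "continuous_on (source L) g" "\<And>s. s \<in> source L \<Longrightarrow> \<bar>g s\<bar> \<le> B" for X and g :: "nat \<times> complex \<Rightarrow> real"
  proof -
    have "continuous_on X ?c" "continuous_on X g" using contc g X continuous_on_subset by blast+
    then obtain f where "continuous_on (ball p d) f" "\<And>s. s \<in> X \<Longrightarrow> ?c s \<in> ball p d \<Longrightarrow> f (?c s) = g s"
      "\<And>w. w \<in> ball p d \<Longrightarrow> \<bar>f w\<bar> \<le> B"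
      by (rule extend_along_curve[OF X(1) _ _ inj[OF X(2,3)]]) (use g(2) X B in blast)+
    then show ?thesis by blast
  qed
  obtain l where l: "continuous_on (ball p d) l" "\<And>s. s \<in> SA \<Longrightarrow> ?c s \<in> ball p d \<Longrightarrow> l (?c s) = h s"
    "\<And>w. w \<in> ball p d \<Longrightarrow> \<bar>l w\<bar> \<le> B"
    using ext[OF SAB(1) sub(1) _ conth(1) B(1)] mem by blast
  obtain l' where l': "continuous_on (ball p d) l'" "\<And>s. s \<in> SA \<Longrightarrow> ?c s \<in> ball p d \<Longrightarrow> l' (?c s) = h' s"
    "\<And>w. w \<in> ball p d \<Longrightarrow> \<bar>l' w\<bar> \<le> B"
    using ext[OF SAB(1) sub(1) _ conth(2) B(2)] mem by blast
  obtain u where u: "continuous_on (ball p d) u" "\<And>s. s \<in> SB \<Longrightarrow> ?c s \<in> ball p d \<Longrightarrow> u (?c s) = h s"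
    "\<And>w. w \<in> ball p d \<Longrightarrow> \<bar>u w\<bar> \<le> B"
    using ext[OF SAB(2) sub(2) _ conth(1) B(1)] mem by blast
  obtain u' where u': "continuous_on (ball p d) u'" "\<And>s. s \<in> SB \<Longrightarrow> ?c s \<in> ball p d \<Longrightarrow> u' (?c s) = h' s"
    "\<And>w. w \<in> ball p d \<Longrightarrow> \<bar>u' w\<bar> \<le> B"
    using ext[OF SAB(2) sub(2) _ conth(2) B(2)] mem by blast
  define V where "V = {w \<in> ball p d. 0 < u w - l w} \<inter> {w \<in> ball p d. 0 < u' w - l' w}"
  have op: "open {w \<in> ball p d. 0 < f w}" if "continuous_on (ball p d) f" for f :: "complex \<Rightarrow> real"
  proof -
    have "{w \<in> ball p d. 0 < f w} = ball p d \<inter> f -` {0<..}" by auto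
    then show ?thesis using continuous_open_preimage[OF that] by auto
  qed
  have "open V"
    unfolding V_def by (intro open_Int op continuous_intros l(1) l'(1) u(1) u'(1))
  moreover have "p \<in> V"
    using l(2)[of s] l'(2)[of s] u(2)[of t] u'(2)[of t] mem st less d(1) by (simp add: V_def)
  ultimately obtain e where e: "e > 0" "ball p e \<subseteq> V" using open_contains_ball by blast
  have eV: "w \<in> ball p d" "l w < u w" "l' w < u' w" if "w \<in> ball p e" for w
    using that e(2) by (auto simp: V_def)
  have "shear_on L h h' R (ball p e) (\<lambda>(w, z). two_point_map R (l w) (u w) (l' w) (u' w) z)"
  proof (rule shear_on_two_point_map)
    have "ball p e \<subseteq> ball p d" using eV(1) by blast
    then show "continuous_on (ball p e) l" "continuous_on (ball p e) u"
      "continuous_on (ball p e) l'" "continuous_on (ball p e) u'"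
      using l(1) u(1) l'(1) u'(1) continuous_on_subset by blast+
    fix w assume w: "w \<in> ball p e"
    show "- R < l w \<and> l w < u w \<and> u w < R" "- R < l' w \<and> l' w < u' w \<and> u' w < R"
      using eV[OF w] l(3)[OF eV(1)[OF w]] u(3)[OF eV(1)[OF w]] l'(3)[OF eV(1)[OF w]] u'(3)[OF eV(1)[OF w]] B(4)
      by auto
  next
    fix x assume x: "x \<in> source L" "?c x \<in> ball p e"
    then show "h x = l (?c x) \<and> h' x = l' (?c x) \<or> h x = u (?c x) \<and> h' x = u' (?c x)"
      using sub(3) l(2)[of x] l'(2)[of x] u(2)[of x] u'(2)[of x] eV(1)[OF x(2)] by auto
  qed
  then show ?thesis using e(1) by blast
qed

text \<open>
  Off the crossings there is one strand to control; the second node of \<open>two_point_map\<close> is put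
  halfway between this strand and \<open>R\<close>.
\<close>

lemma shear_off_crossings:
  assumes L: "link_diagram L" and h: "heights L h" and h': "heights L h'"
    and B: "\<And>s. s \<in> source L \<Longrightarrow> \<bar>h s\<bar> \<le> B" "\<And>s. s \<in> source L \<Longrightarrow> \<bar>h' s\<bar> \<le> B" "0 \<le> B" "B < R"
  shows "\<exists>\<phi>. shear_on L h h' R (- crossings L) \<phi>"
proof -
  let ?c = "curve L"
  have contc: "continuous_on (source L) ?c" and conth: "continuous_on (source L) h" "continuous_on (source L) h'"
    using L h h' by (auto simp: link_diagram_def heights_def)
  have inj: "inj_on ?c {x \<in> source L. ?c x \<in> - crossings L}"
    unfolding inj_on_def crossings_def by blast
  obtain l where l: "continuous_on (- crossings L) l"
    "\<And>s. s \<in> source L \<Longrightarrow> ?c s \<in> - crossings L \<Longrightarrow> l (?c s) = h s"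
    "\<And>w. w \<in> - crossings L \<Longrightarrow> \<bar>l w\<bar> \<le> B"
    by (rule extend_along_curve[OF compact_source contc conth(1) inj]) (use B in blast)+
  obtain l' where l': "continuous_on (- crossings L) l'"
    "\<And>s. s \<in> source L \<Longrightarrow> ?c s \<in> - crossings L \<Longrightarrow> l' (?c s) = h' s"
    "\<And>w. w \<in> - crossings L \<Longrightarrow> \<bar>l' w\<bar> \<le> B"
    by (rule extend_along_curve[OF compact_source contc conth(2) inj]) (use B in blast)+
  have "shear_on L h h' R (- crossings L)
      (\<lambda>(w, z). two_point_map R (l w) ((\<lambda>w. (l w + R) / 2) w) (l' w) ((\<lambda>w. (l' w + R) / 2) w) z)"
  proof (rule shear_on_two_point_map)
    show "continuous_on (- crossings L) l" "continuous_on (- crossings L) (\<lambda>w. (l w + R) / 2)"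
      "continuous_on (- crossings L) l'" "continuous_on (- crossings L) (\<lambda>w. (l' w + R) / 2)"
      by (intro continuous_intros l(1) l'(1); simp)+
    fix w assume w: "w \<in> - crossings L"
    show "- R < l w \<and> l w < (l w + R) / 2 \<and> (l w + R) / 2 < R"
      "- R < l' w \<and> l' w < (l' w + R) / 2 \<and> (l' w + R) / 2 < R"
      using l(3)[OF w] l'(3)[OF w] B(4) by auto
  qed (use l(2) l'(2) in simp)
  then show ?thesis by blast
qed

lemma shear_everywhere:
  assumes L: "link_diagram L" and h: "heights L h" and h': "heights L h'"
    and B: "\<And>s. s \<in> source L \<Longrightarrow> \<bar>h s\<bar> \<le> B" "\<And>s. s \<in> source L \<Longrightarrow> \<bar>h' s\<bar> \<le> B" "0 \<le> B" "B < R"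
  shows "\<exists>\<phi>. shear_on L h h' R UNIV \<phi>"
proof -
  have fin: "finite (crossings L)" using L by (simp add: link_diagram_def)
  have "\<exists>\<phi>. shear_on L h h' R (- (crossings L - X)) \<phi>" if "X \<subseteq> crossings L" for X
    using finite_subset[OF that fin] that
  proof (induction X rule: finite_induct)
    case empty
    then show ?case using shear_off_crossings[OF assms] by simp
  next
    case (insert p X)
    define Y where "Y = crossings L - insert p X"
    have Y: "finite Y" "crossings L - X = insert p Y" using fin insert by (auto simp: Y_def)
    obtain \<phi>1 where 1: "shear_on L h h' R (- insert p Y) \<phi>1"
      using insert Y by auto
    obtain e \<phi>2 where 2: "e > 0" "shear_on L h h' R (ball p e) \<phi>2"
      using shear_near_crossing[OF assms, of p] insert by blast
    obtain d where d: "d > 0" "\<And>q. q \<in> Y \<Longrightarrow> q \<noteq> p \<Longrightarrow> d \<le> dist p q"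
      using finite_set_avoid[OF Y(1)] by metis
    have "shear_on L h h' R (ball p (min d e)) \<phi>2"
      by (rule shear_on_subset[OF 2(2)]) auto
    moreover have "Y \<inter> ball p (min d e) = {}"
      using d(2) by (force simp: Y_def)
    ultimately have "\<exists>\<phi>. shear_on L h h' R (- Y) \<phi>"
      using shear_on_glue[OF 1] Y(1) d(1) 2(1) by force
    then show ?case by (simp add: Y_def)
  qed
  from this[of "crossings L"] show ?thesis by simp
qed

lemma strict_mono_bij:
  fixes f :: "real \<Rightarrow> real"
  assumes mono: "strict_mono f" and cont: "continuous_on UNIV f" and R: "\<And>z. R \<le> \<bar>z\<bar> \<Longrightarrow> f z = z"
  shows "bij f"
proof (rule bijI)
  show "inj f" using mono by (rule strict_mono_imp_inj_on)
  have "\<exists>z. f z = y" for y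
  proof -
    define r where "r = max \<bar>R\<bar> \<bar>y\<bar>"
    have "f r = r" "f (- r) = - r" using R[of r] R[of "- r"] by (auto simp: r_def)
    moreover have "\<bar>y\<bar> \<le> r" by (simp add: r_def)
    ultimately have "f (- r) \<le> y" "y \<le> f r" by linarith+
    moreover have "- r \<le> r" by (auto simp: r_def)
    ultimately obtain z where "f z = y"
      using IVT'[of f "- r" y r] cont continuous_on_subset by blast
    then show ?thesis by blast
  qed
  then show "surj f" by (metis surjI)
qed

lemma lift_heights_isotopic:
  assumes L: "link_diagram L" and h: "heights L h" and h': "heights L h'"
  shows "ambient_isotopic (lift L h) (lift L h')"
proof -
  have conth: "continuous_on (source L) h" "continuous_on (source L) h'" and contc: "continuous_on (source L) (curve L)"
    using L h h' by (auto simp: heights_def link_diagram_def)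
  have bd: "\<exists>b. \<forall>s\<in>source L. norm (f s) \<le> b" if "continuous_on (source L) f" for f :: "nat \<times> complex \<Rightarrow> 'a::real_normed_vector"
    using compact_imp_bounded[OF compact_continuous_image[OF that compact_source]]
    unfolding bounded_iff by blast
  obtain b1 b2 b3 where b: "\<And>s. s \<in> source L \<Longrightarrow> \<bar>h s\<bar> \<le> b1" "\<And>s. s \<in> source L \<Longrightarrow> \<bar>h' s\<bar> \<le> b2"
    "\<And>s. s \<in> source L \<Longrightarrow> norm (curve L s) \<le> b3"
    using bd[OF conth(1)] bd[OF conth(2)] bd[OF contc] by (metis real_norm_def)
  define R where "R = max 0 (max b1 b2) + 1"
  have "\<bar>h s\<bar> \<le> max 0 (max b1 b2)" "\<bar>h' s\<bar> \<le> max 0 (max b1 b2)" if "s \<in> source L" for s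
    using b(1)[OF that] b(2)[OF that] by auto
  then have "\<exists>\<phi>. shear_on L h h' R UNIV \<phi>"
    by (rule shear_everywhere[OF assms, where B = "max 0 (max b1 b2)"]) (auto simp: R_def)
  then obtain \<phi> where "shear_on L h h' R UNIV \<phi>" by blast
  then have \<phi>: "continuous_on UNIV \<phi>" "\<And>w. strict_mono (\<lambda>z. \<phi> (w, z))" "\<And>w z. R \<le> \<bar>z\<bar> \<Longrightarrow> \<phi> (w, z) = z"
    "\<And>s. s \<in> source L \<Longrightarrow> \<phi> (curve L s, h s) = h' s"
    by (simp_all add: shear_on_def)
  define c where "c = (\<lambda>w::complex. max 0 (min 1 (b3 + 1 - norm w)))"
  have c01: "0 \<le> c w" "c w \<le> 1" for w by (auto simp: c_def)
  define g where "g = (\<lambda>t w z. (1 - t * c w) * z + (t * c w) * \<phi> (w, z))"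
  have tc: "0 \<le> t * c w" "t * c w \<le> 1" if "t \<in> {0..1}" for t w
    using c01[of w] that by (auto intro: mult_le_one)
  define F where "F = (\<lambda>(t, x). (fst x, g t (fst x) (snd x)))"
  have contg: "continuous_on UNIV (\<lambda>x :: real \<times> complex \<times> real. g (fst x) (fst (snd x)) (snd (snd x)))"
    unfolding g_def c_def
    by (intro continuous_intros continuous_on_compose2[OF \<phi>(1)]) auto
  have gmono: "strict_mono (g t w)" if "t \<in> {0..1}" for t w
    unfolding g_def by (rule strict_mono_convex_comb[OF _ \<phi>(2) tc[OF that]]) (simp add: strict_mono_def)
  have gR: "g t w z = z" if "R \<le> \<bar>z\<bar> \<or> b3 + 1 \<le> norm w" for t w z
    using that \<phi>(3) by (auto simp: g_def c_def algebra_simps)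
  have gbij: "bij (g t w)" if "t \<in> {0..1}" for t w
  proof (rule strict_mono_bij[OF gmono[OF that]])
    show "continuous_on UNIV (g t w)"
    proof -
      have "continuous_on UNIV (\<lambda>z::real. (t, w, z))" by (intro continuous_intros)
      from continuous_on_compose2[OF contg this] show ?thesis by simp
    qed
  qed (use gR in blast)
  have "ambient_isotopic \<lparr>ncomponents = ncomp L, embedding = (\<lambda>s. stereo ((\<lambda>s. (curve L s, h s)) s))\<rparr>
      \<lparr>ncomponents = ncomp L, embedding = (\<lambda>s. stereo ((\<lambda>s. (curve L s, h' s)) s))\<rparr>"
  proof (rule ambient_isotopic_of_compact_isotopy[where F = F and R = "\<bar>b3\<bar> + 1 + \<bar>R\<bar>"])
    show "continuous_on ({0..1} \<times> UNIV) F"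
      unfolding F_def case_prod_beta
      by (intro continuous_intros continuous_on_subset[OF contg]) auto
    show "bij (\<lambda>x. F (t, x))" if "t \<in> {0..1}" for t
    proof (rule bijI)
      show "inj (\<lambda>x. F (t, x))"
        using gbij[OF that] by (auto simp: inj_def F_def bij_def)
      have "\<exists>x. F (t, x) = y" for y
      proof -
        obtain z where "g t (fst y) z = snd y" using gbij[OF \<open>t \<in> {0..1}\<close>] by (metis bij_pointE)
        then show ?thesis by (intro exI[of _ "(fst y, z)"]) (simp add: F_def)
      qed
      then show "surj (\<lambda>x. F (t, x))" by (metis surjI)
    qed
    show "F (0, x) = x" for x by (simp add: F_def g_def)
    show "F (t, x) = x" if "\<bar>b3\<bar> + 1 + \<bar>R\<bar> \<le> norm x" for t x
    proof -
      have "norm x \<le> norm (fst x) + norm (snd x)" by (metis norm_Pair_le prod.collapse)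
      then have "R \<le> \<bar>snd x\<bar> \<or> b3 + 1 \<le> norm (fst x)" using that by auto
      then show ?thesis using gR by (simp add: F_def)
    qed
    fix s assume s: "s \<in> source L"
    have "c (curve L s) = 1" using b(3)[OF s] by (simp add: c_def)
    then show "F (1, (curve L s, h s)) = (curve L s, h' s)"
      using \<phi>(4)[OF s] by (simp add: F_def g_def)
  qed
  then show ?thesis by (simp add: lift_def)
qed

lemma embedded_lift:
  assumes L: "link_diagram L" and h: "heights L h"
  shows "embedded_link (lift L h)"
proof -
  have "continuous_on (source L) (\<lambda>s. (curve L s, h s))"
    using L h by (auto simp: link_diagram_def heights_def intro!: continuous_on_Pair)
  then have "continuous_on (source L) (\<lambda>s. stereo (curve L s, h s))"
    by (rule continuous_on_compose2[OF continuous_on_stereo]) auto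
  moreover have "inj_on (\<lambda>s. stereo (curve L s, h s)) (source L)"
  proof (rule inj_onI, rule ccontr)
    fix s t assume st: "s \<in> source L" "t \<in> source L" "stereo (curve L s, h s) = stereo (curve L t, h t)" "s \<noteq> t"
    then have "(curve L s, h s) = (curve L t, h t)" by (metis unstereo_stereo)
    then show False
      using over_iff_not_over[OF L st(1,2,4)] h st unfolding heights_def by (metis less_irrefl prod.inject)
  qed
  ultimately show ?thesis using stereo_in_S3 by (auto simp: embedded_link_def lift_def)
qed

lemma diagram_type_eqI:
  assumes L: "link_diagram L" "heights L h" and M: "link_diagram M" "heights M k"
    and iso: "ambient_isotopic (lift L h) (lift M k)"
  shows "diagram_type L = diagram_type M"
proof -
  define h' k' where "h' = (SOME h. heights L h)" and "k' = (SOME h. heights M h)"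
  have h': "heights L h'" and k': "heights M k'"
    unfolding h'_def k'_def using someI_ex[OF heights_exist] L M by auto
  have "ambient_isotopic (lift L h') (lift M k)"
    using ambient_isotopic_trans[OF lift_heights_isotopic[OF L(1) h' L(2)] iso] embedded_lift[OF L(1) h'] by simp
  then have "ambient_isotopic (lift L h') (lift M k')"
    using ambient_isotopic_trans[OF _ lift_heights_isotopic[OF M k']] embedded_lift[OF L(1) h'] by blast
  moreover have "tame_link (lift L h')" "tame_link (lift M k')"
    unfolding tame_link_def using embedded_lift ambient_isotopic_refl L(1) M(1) h' k' by blast+
  ultimately have "(lift L h', lift M k') \<in> isotopy_rel" by (simp add: isotopy_rel_def)
  then have "isotopy_rel `` {lift L h'} = isotopy_rel `` {lift M k'}"
    by (rule equiv_class_eq[OF equiv_isotopy_rel])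
  then show ?thesis
    by (simp add: diagram_type_def link_type_of_def h'_def k'_def)
qed

section \<open>Pushing an arc through a disk\<close>

text \<open>
  Each point of the unit disk lies on a segment from \<open>p\<close> to the unit circle; the segment is mapped linearly to
  the one from \<open>q\<close> to the same boundary point.  The relation is closed, and so continuity in all arguments
  will follow from compactness, without a formula for the cone coordinates.
\<close>

definition push_rel :: "complex \<Rightarrow> complex \<Rightarrow> complex \<Rightarrow> complex \<Rightarrow> bool" where
  "push_rel p q w w' \<longleftrightarrow> (\<exists>s\<in>{0..1}. \<exists>x\<in>sphere 0 1.
     w = (1 - s) *\<^sub>R p + s *\<^sub>R x \<and> w' = (1 - s) *\<^sub>R q + s *\<^sub>R x)"

text \<open>
  The pairs of points that can be pushed.  The case \<open>p = q\<close> on the boundary is included since the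
  end points of an arc do not move; there \<open>push\<close> is the identity, as the limit of maps \<open>push p q\<close> for \<open>p\<close>
  and \<open>q\<close> tending to the same boundary point.
\<close>

definition pushable :: "complex \<Rightarrow> complex \<Rightarrow> bool" where
  "pushable p q \<longleftrightarrow> p \<in> ball 0 1 \<and> q \<in> ball 0 1 \<or> p = q \<and> p \<in> cball 0 1"

lemma pushable_sym: "pushable p q \<Longrightarrow> pushable q p"
  by (auto simp: pushable_def)

lemma push_rel_sym: "push_rel p q w w' \<Longrightarrow> push_rel q p w' w"
  by (auto simp: push_rel_def)

lemma push_rel_same: "push_rel p p w w' \<Longrightarrow> w' = w"
  by (auto simp: push_rel_def)

lemma push_rel_unique:
  assumes "pushable p q" "push_rel p q w w1" "push_rel p q w w2"
  shows "w1 = w2"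
proof (cases "p = q")
  case True
  then show ?thesis using assms push_rel_same by metis
next
  case False
  then have p: "norm p < 1" using assms(1) by (auto simp: pushable_def)
  have main: "s *\<^sub>R x = s' *\<^sub>R x' \<and> s = s'"
    if s: "0 \<le> s" "s \<le> s'" "s' \<le> 1" and x: "norm x = 1" "norm x' = 1"
      and eq: "(1 - s) *\<^sub>R p + s *\<^sub>R x = (1 - s') *\<^sub>R p + s' *\<^sub>R x'" for s s' and x x' :: complex
  proof -
    have e: "s' *\<^sub>R x' = (s' - s) *\<^sub>R p + s *\<^sub>R x" using eq by (simp add: algebra_simps)
    have "s' = norm (s' *\<^sub>R x')" using s x by simp
    also have "\<dots> \<le> (s' - s) * norm p + s"
      unfolding e using s x by (intro norm_triangle_le) simp
    finally have "(s' - s) * (1 - norm p) \<le> 0" by (simp add: algebra_simps)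
    then have "s' - s \<le> 0" using p by (simp add: mult_le_0_iff)
    then have "s = s'" using s by simp
    then show ?thesis using e by (cases "s' = 0") auto
  qed
  obtain s x where 1: "s \<in> {0..1}" "norm x = 1" "w = (1 - s) *\<^sub>R p + s *\<^sub>R x" "w1 = (1 - s) *\<^sub>R q + s *\<^sub>R x"
    using assms(2) by (auto simp: push_rel_def)
  obtain s' x' where 2: "s' \<in> {0..1}" "norm x' = 1" "w = (1 - s') *\<^sub>R p + s' *\<^sub>R x'"
      "w2 = (1 - s') *\<^sub>R q + s' *\<^sub>R x'"
    using assms(3) by (auto simp: push_rel_def)
  have "s *\<^sub>R x = s' *\<^sub>R x' \<and> s = s'"
  proof (cases "s \<le> s'")
    case True
    then show ?thesis using main[of s s' x x'] 1 2 by auto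
  next
    case False
    then have "s' *\<^sub>R x' = s *\<^sub>R x \<and> s' = s" using main[of s' s x' x] 1 2 by auto
    then show ?thesis by metis
  qed
  then show ?thesis using 1(4) 2(4) by metis
qed

lemma push_rel_exists:
  assumes "pushable p q" "w \<in> cball 0 1"
  shows "\<exists>w'. push_rel p q w w'"
proof -
  have "\<exists>s\<in>{0..1}. \<exists>x\<in>sphere 0 1. w = (1 - s) *\<^sub>R p + s *\<^sub>R x"
  proof (cases "w \<in> sphere 0 1 \<or> w = p")
    case True
    then show ?thesis
    proof
      assume "w \<in> sphere 0 1"
      then show ?thesis by (intro bexI[of _ "1::real"] bexI[of _ w]) auto
    next
      assume "w = p"
      then show ?thesis by (intro bexI[of _ "0::real"] bexI[of _ "1::complex"]) auto
    qed
  next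
    case False
    then have w: "w \<in> interior (cball 0 1)" "w \<noteq> p" using assms(2) by auto
    then obtain d where d: "0 < d" "w + d *\<^sub>R (w - p) \<in> frontier (cball 0 1)"
      by (metis bounded_cball ray_to_frontier right_minus_eq)
    define s where "s = 1 / (1 + d)"
    have "s \<in> {0..1}" "(1 - s) *\<^sub>R p + s *\<^sub>R (w + d *\<^sub>R (w - p)) = w"
    proof -
      show "s \<in> {0..1}" using d by (simp add: s_def)
      have "(1 - s) *\<^sub>R p + s *\<^sub>R (w + d *\<^sub>R (w - p)) = (1 - s * (1 + d)) *\<^sub>R p + (s * (1 + d)) *\<^sub>R w"
        by (simp add: algebra_simps)
      also have "s * (1 + d) = 1" using d by (simp add: s_def)
      finally show "(1 - s) *\<^sub>R p + s *\<^sub>R (w + d *\<^sub>R (w - p)) = w" by simp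
    qed
    then show ?thesis using d(2) by (intro bexI[of _ s] bexI[of _ "w + d *\<^sub>R (w - p)"]) auto
  qed
  then show ?thesis unfolding push_rel_def by metis
qed

definition push :: "complex \<Rightarrow> complex \<Rightarrow> complex \<Rightarrow> complex" where
  "push p q w = (THE w'. push_rel p q w w')"

lemma push_rel_push:
  assumes "pushable p q" "w \<in> cball 0 1"
  shows "push_rel p q w (push p q w)"
proof -
  have "\<exists>!w'. push_rel p q w w'"
    using push_rel_exists[OF assms] push_rel_unique[OF assms(1)] by (rule ex_ex1I)
  then show ?thesis unfolding push_def by (rule theI')
qed

lemma push_eqI: "pushable p q \<Longrightarrow> push_rel p q w w' \<Longrightarrow> push p q w = w'"
  unfolding push_def by (rule the_equality) (auto intro: push_rel_unique)

lemma push_rel_in_cball: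
  assumes "pushable p q" "push_rel p q w w'"
  shows "w' \<in> cball 0 1"
proof -
  obtain s x where s: "s \<in> {0..1}" "x \<in> sphere 0 1" "w' = (1 - s) *\<^sub>R q + s *\<^sub>R x"
    using assms(2) by (auto simp: push_rel_def)
  have "q \<in> cball 0 1" "x \<in> cball 0 1" using assms(1) s by (auto simp: pushable_def)
  then show ?thesis
    unfolding s(3) using s(1) convexD_alt[OF convex_cball, of q 0 1 x s] by auto
qed

lemma push_in_cball:
  "pushable p q \<Longrightarrow> w \<in> cball 0 1 \<Longrightarrow> push p q w \<in> cball 0 1"
  using push_rel_push push_rel_in_cball by blast

lemma push_push:
  "pushable p q \<Longrightarrow> w \<in> cball 0 1 \<Longrightarrow> push q p (push p q w) = w"
  by (rule push_eqI[OF pushable_sym push_rel_sym[OF push_rel_push]])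

lemma push_same: "p \<in> cball 0 1 \<Longrightarrow> w \<in> cball 0 1 \<Longrightarrow> push p p w = w"
  using push_rel_same[OF push_rel_push] by (simp add: pushable_def)

lemma push_sphere: "pushable p q \<Longrightarrow> w \<in> sphere 0 1 \<Longrightarrow> push p q w = w"
  by (rule push_eqI) (auto simp: push_rel_def intro!: bexI[of _ "1::real"] bexI[of _ w])

lemma push_source: "pushable p q \<Longrightarrow> push p q p = q"
  by (rule push_eqI) (auto simp: push_rel_def intro!: bexI[of _ "0::real"] bexI[of _ "1::complex"])

text \<open>The graph is the image of a compact set of cone coordinates \<open>(y, s, x)\<close>.\<close>

lemma continuous_on_push:
  fixes S :: "'a::euclidean_space set"
  assumes S: "compact S" and cont: "continuous_on S p" "continuous_on S q" "continuous_on S w"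
    and pq: "\<And>y. y \<in> S \<Longrightarrow> pushable (p y) (q y)" and w: "\<And>y. y \<in> S \<Longrightarrow> w y \<in> cball 0 1"
  shows "continuous_on S (\<lambda>y. push (p y) (q y) (w y))"
proof (rule continuous_from_closed_graph)
  show "compact (cball (0::complex) 1)" by simp
  show "(\<lambda>y. push (p y) (q y) (w y)) \<in> S \<rightarrow> cball 0 1"
    using push_in_cball pq w by blast
  define Z where "Z = S \<times> ({0..1::real} \<times> sphere (0::complex) 1)"
  define Z' where "Z' = {z \<in> Z. w (fst z) = (1 - fst (snd z)) *\<^sub>R p (fst z) + fst (snd z) *\<^sub>R snd (snd z)}"
  have contZ: "continuous_on Z (\<lambda>z. f (fst z))" if "continuous_on S f" for f :: "'a \<Rightarrow> complex"
    by (rule continuous_on_compose2[OF that]) (auto simp: Z_def intro!: continuous_intros)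
  have "compact Z" unfolding Z_def by (intro compact_Times S) auto
  moreover have "closedin (top_of_set Z) Z'"
  proof -
    have "Z' = {z \<in> Z. w (fst z) - ((1 - fst (snd z)) *\<^sub>R p (fst z) + fst (snd z) *\<^sub>R snd (snd z)) = 0}"
      unfolding Z'_def by simp
    then show ?thesis
      by (simp only:) (intro continuous_closedin_preimage_constant continuous_intros contZ cont)
  qed
  ultimately have "compact Z'" by (rule closedin_compact)
  moreover have "continuous_on Z' (\<lambda>z. (fst z, (1 - fst (snd z)) *\<^sub>R q (fst z) + fst (snd z) *\<^sub>R snd (snd z)))"
    by (rule continuous_on_subset[of Z]) (intro continuous_intros contZ cont, auto simp: Z'_def)
  ultimately have "compact ((\<lambda>z. (fst z, (1 - fst (snd z)) *\<^sub>R q (fst z) + fst (snd z) *\<^sub>R snd (snd z))) ` Z')"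
    by (rule compact_continuous_image[rotated])
  moreover have "(\<lambda>z. (fst z, (1 - fst (snd z)) *\<^sub>R q (fst z) + fst (snd z) *\<^sub>R snd (snd z))) ` Z'
      = (\<lambda>y. (y, push (p y) (q y) (w y))) ` S" (is "?f ` Z' = ?g ` S")
  proof (intro equalityI subsetI)
    fix a assume "a \<in> ?f ` Z'"
    then obtain y s x where y: "y \<in> S" "s \<in> {0..1}" "x \<in> sphere 0 1" "w y = (1 - s) *\<^sub>R p y + s *\<^sub>R x"
      "a = (y, (1 - s) *\<^sub>R q y + s *\<^sub>R x)"
      by (auto simp: Z'_def Z_def)
    then have "push_rel (p y) (q y) (w y) ((1 - s) *\<^sub>R q y + s *\<^sub>R x)"
      unfolding push_rel_def by blast
    then show "a \<in> ?g ` S" using push_eqI[OF pq] y by auto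
  next
    fix a assume "a \<in> ?g ` S"
    then obtain y where y: "y \<in> S" "a = (y, push (p y) (q y) (w y))" by blast
    obtain s x where "s \<in> {0..1}" "x \<in> sphere 0 1" "w y = (1 - s) *\<^sub>R p y + s *\<^sub>R x"
      "push (p y) (q y) (w y) = (1 - s) *\<^sub>R q y + s *\<^sub>R x"
      using push_rel_push[OF pq w, OF y(1) y(1)] unfolding push_rel_def by blast
    then show "a \<in> ?f ` Z'"
      using y by (intro image_eqI[of _ _ "(y, s, x)"]) (auto simp: Z'_def Z_def)
  qed
  ultimately show "closed (?g ` S)" by (simp add: compact_imp_closed)
qed

text \<open>By invariance of domain, the frontier of a topological disk is its boundary circle.\<close>

lemma disk_interior:
  fixes D :: "complex set"
  assumes g: "homeomorphism D (cball (0::complex) 1) g g'"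
  shows "g ` interior D = ball 0 1" "g ` frontier D = sphere 0 1" "frontier D \<subseteq> D"
proof -
  have g': "continuous_on D g" "continuous_on (cball 0 1) g'" "g ` D = cball 0 1" "g' ` cball 0 1 = D"
    "\<And>x. x \<in> D \<Longrightarrow> g' (g x) = x" "\<And>y. y \<in> cball 0 1 \<Longrightarrow> g (g' y) = y"
    using g by (auto simp: homeomorphism_def)
  have injg: "inj_on g D" "inj_on g' (cball 0 1)" using g' by (metis inj_onI)+
  have ball_sub: "ball 0 1 \<subseteq> (cball 0 1 :: complex set)" by auto
  have "open (g ` interior D)"
    using continuous_on_subset[OF g'(1) interior_subset] inj_on_subset[OF injg(1) interior_subset]
    by (rule invariance_of_domain[OF _ open_interior])
  then have "g ` interior D \<subseteq> interior (cball 0 1)"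
    using g'(3) interior_subset by (intro interior_maximal) blast+
  then have 1: "g ` interior D \<subseteq> ball 0 1" by simp
  have "open (g' ` ball 0 1)"
    using continuous_on_subset[OF g'(2) ball_sub] inj_on_subset[OF injg(2) ball_sub]
    by (rule invariance_of_domain[OF _ open_ball])
  then have 2: "g' ` ball 0 1 \<subseteq> interior D"
    using g'(4) ball_sub by (intro interior_maximal) blast+
  show int: "g ` interior D = ball 0 1"
  proof
    show "ball 0 1 \<subseteq> g ` interior D"
    proof
      fix y :: complex assume y: "y \<in> ball 0 1"
      then have "g' y \<in> interior D" using 2 by blast
      moreover have "g (g' y) = y" using g'(6) y by auto
      ultimately show "y \<in> g ` interior D" by (metis imageI)
    qed
  qed (rule 1)
  have "compact D" using g'(2,4) compact_continuous_image[of "cball 0 1" g'] by simp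
  then have cl: "closure D = D" by (simp add: compact_imp_closed)
  then show "frontier D \<subseteq> D" by (simp add: frontier_def)
  have "g ` frontier D = g ` D - g ` interior D"
    unfolding frontier_def cl using inj_on_image_set_diff[OF injg(1), of D "interior D"] interior_subset by auto
  also have "\<dots> = sphere 0 1" unfolding g'(3) int by auto
  finally show "g ` frontier D = sphere 0 1" .
qed

text \<open>
  The arcs \<open>p\<close> and \<open>p'\<close> are lifted by their own parameter, so that at height \<open>u\<close> only the point \<open>p u\<close>
  has to be moved to \<open>p' u\<close>.  In the coordinates of the round disk it moves along the straight segment \<open>q t u\<close>,
  which stays in the open disk by convexity.  At the ends the point lies on the frontier
  and does not move; hence the isotopy is the identity on the whole boundary of the cylinder over \<open>D\<close>
  and extends by the identity.
\<close>

lemma arc_push_isotopy: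
  fixes D :: "complex set" and p p' :: "real \<Rightarrow> complex"
  assumes D: "D homeomorphic cball (0::complex) 1"
    and p: "continuous_on {0..1} p" "\<And>u. u \<in> {0<..<1} \<Longrightarrow> p u \<in> interior D"
    and p': "continuous_on {0..1} p'" "\<And>u. u \<in> {0<..<1} \<Longrightarrow> p' u \<in> interior D"
    and ends: "p 0 = p' 0" "p 1 = p' 1" "p 0 \<in> frontier D" "p 1 \<in> frontier D"
  shows "\<exists>F :: real \<times> complex \<times> real \<Rightarrow> complex \<times> real.
    continuous_on ({0..1} \<times> UNIV) F \<and> (\<forall>t\<in>{0..1}. bij (\<lambda>x. F (t, x))) \<and> (\<forall>x. F (0, x) = x) \<and>
    (\<forall>t w z. w \<notin> D \<or> z < 0 \<or> 1 < z \<longrightarrow> F (t, w, z) = (w, z)) \<and>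
    (\<forall>u\<in>{0..1}. F (1, p u, u) = (p' u, u))"
proof -
  obtain g g' where g: "homeomorphism D (cball (0::complex) 1) g g'" using D by (auto simp: homeomorphic_def)
  note int = disk_interior[OF g]
  have g': "continuous_on D g" "continuous_on (cball 0 1) g'" "g ` D = cball 0 1" "g' ` cball 0 1 = D"
    "\<And>x. x \<in> D \<Longrightarrow> g' (g x) = x" "\<And>y. y \<in> cball 0 1 \<Longrightarrow> g (g' y) = y"
    using g by (auto simp: homeomorphism_def)
  have cD: "compact D" using g'(2,4) compact_continuous_image[of "cball 0 1" g'] by simp
  define a a' where "a = (\<lambda>u. g (p u))" and "a' = (\<lambda>u. g (p' u))"
  define q where "q = (\<lambda>t u. (1 - t) *\<^sub>R a u + t *\<^sub>R a' u)"
  have inD: "p u \<in> D \<and> p' u \<in> D" if "u \<in> {0..1}" for u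
  proof (cases "u \<in> {0<..<1}")
    case True
    then show ?thesis using p(2) p'(2) interior_subset by blast
  next
    case False
    then have "u = 0 \<or> u = 1" using that by auto
    then show ?thesis using ends int(3) by auto
  qed
  have push_ok: "pushable (a u) (q t u)" if tu: "t \<in> {0..1}" "u \<in> {0..1}" for t u
  proof (cases "u \<in> {0<..<1}")
    case True
    then have au: "a u \<in> ball 0 1" "a' u \<in> ball 0 1"
      unfolding a_def a'_def int(1)[symmetric] using p(2) p'(2) by blast+
    then have "q t u \<in> ball 0 1"
      unfolding q_def using tu(1) convexD_alt[OF convex_ball, of "a u" 0 1 "a' u" t] by auto
    then show ?thesis using au(1) by (simp add: pushable_def)
  next
    case False
    then have "u = 0 \<or> u = 1" using tu by auto
    then have "a u = a' u" using ends by (auto simp: a_def a'_def)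
    then have "q t u = a u" by (simp add: q_def algebra_simps flip: scaleR_add_left)
    moreover have "a u \<in> cball 0 1" using inD[OF tu(2)] g'(3) unfolding a_def by blast
    ultimately show ?thesis by (simp add: pushable_def)
  qed
  define P where "P = {0..1::real} \<times> D \<times> {0..1::real}"
  define Q where "Q = {0..1::real} \<times> (((- interior D) \<times> UNIV) \<union> (UNIV \<times> {..0::real}) \<union> (UNIV \<times> {1..}))"
  define f where "f = (\<lambda>x. (g' (push (a (snd (snd x))) (q (fst x) (snd (snd x))) (g (fst (snd x)))), snd (snd x)))"
  define F where "F = (\<lambda>x. if x \<in> {0..1} \<times> D \<times> {0..1} then f x else snd x)"
  have ca: "continuous_on {0..1} a" "continuous_on {0..1} a'"
    unfolding a_def a'_def using inD
    by (intro continuous_on_compose2[OF g'(1)] p(1) p'(1); force)+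
  have caP: "continuous_on P (\<lambda>x. a (snd (snd x)))" "continuous_on P (\<lambda>x. a' (snd (snd x)))"
    "continuous_on P (\<lambda>x. g (fst (snd x)))"
    by (rule continuous_on_compose2[OF ca(1)] continuous_on_compose2[OF ca(2)] continuous_on_compose2[OF g'(1)];
        auto simp: P_def intro!: continuous_intros)+
  have cpush: "continuous_on P (\<lambda>x. push (a (snd (snd x))) (q (fst x) (snd (snd x))) (g (fst (snd x))))"
  proof (rule continuous_on_push)
    show "compact P" unfolding P_def by (intro compact_Times cD compact_Icc)
    show "continuous_on P (\<lambda>x. q (fst x) (snd (snd x)))"
      unfolding q_def by (intro continuous_intros caP)
  qed (use caP push_ok g'(3) in \<open>auto simp: P_def\<close>)
  have pushD: "push (a z) (q t z) (g w) \<in> cball 0 1" "g w \<in> cball 0 1"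
    if "t \<in> {0..1}" "w \<in> D" "z \<in> {0..1}" for t w z
  proof -
    show gw: "g w \<in> cball 0 1" using that g'(3) by blast
    show "push (a z) (q t z) (g w) \<in> cball 0 1"
      using push_in_cball[OF push_ok[OF that(1,3)] gw] .
  qed
  have contf: "continuous_on P f"
    unfolding f_def
    by (intro continuous_on_Pair continuous_on_compose2[OF g'(2) cpush] continuous_intros)
       (use pushD in \<open>auto simp: P_def\<close>)
  have agree: "f x = snd x" if "x \<in> P" "x \<in> Q" for x
  proof -
    obtain t w z where x: "x = (t, w, z)" by (cases x)
    have tw: "t \<in> {0..1}" "w \<in> D" "z \<in> {0..1}" using that by (auto simp: x P_def)
    have "push (a z) (q t z) (g w) = g w"
    proof (cases "w \<in> interior D")
      case False
      then have "w \<in> frontier D" using tw closure_subset by (auto simp: frontier_def)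
      then have "g w \<in> sphere 0 1" using int(2) by blast
      then show ?thesis using push_sphere push_ok tw by blast
    next
      case True
      then have "z = 0 \<or> z = 1" using that tw by (auto simp: x Q_def)
      then have "a z = a' z" using ends by (auto simp: a_def a'_def)
      then have "q t z = a z" by (simp add: q_def algebra_simps flip: scaleR_add_left)
      moreover have "a z \<in> cball 0 1" using inD[OF tw(3)] g'(3) unfolding a_def by blast
      ultimately show ?thesis using push_same pushD tw by metis
    qed
    then show ?thesis using tw g'(5) by (simp add: f_def x)
  qed
  have contF: "continuous_on ({0..1} \<times> UNIV) F"
  proof -
    have "closed P" unfolding P_def by (intro closed_Times compact_imp_closed[OF cD]) auto
    moreover have "closed Q" unfolding Q_def
      by (intro closed_Times closed_Un) (auto simp: closed_Compl)
    ultimately have "continuous_on (P \<union> Q) (\<lambda>x. if x \<in> P then f x else snd x)"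
      using agree by (intro continuous_on_cases contf continuous_intros) auto
    moreover have "P \<union> Q = {0..1} \<times> UNIV"
      using interior_subset by (auto simp: P_def Q_def)
    ultimately show ?thesis by (simp add: F_def P_def)
  qed
  have Fbij: "bij (\<lambda>x. F (t, x))" if t: "t \<in> {0..1}" for t
  proof -
    define G where "G = (\<lambda>x. if x \<in> D \<times> {0..1} then
        (g' (push (q t (snd x)) (a (snd x)) (g (fst x))), snd x) else x)"
    have ok': "pushable (q t z) (a z)" if "z \<in> {0..1}" for z
      using push_ok[OF t that] by (rule pushable_sym)
    have "G (F (t, x)) = x \<and> F (t, G x) = x" for x
    proof (cases "x \<in> D \<times> {0..1}")
      case False
      then show ?thesis using t by (auto simp: F_def G_def)
    next
      case True
      then obtain w z where x: "x = (w, z)" "w \<in> D" "z \<in> {0..1}" by auto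
      have gw: "g w \<in> cball 0 1" using x g'(3) by blast
      have 1: "push (a z) (q t z) (g w) \<in> cball 0 1" "push (q t z) (a z) (g w) \<in> cball 0 1"
        using push_in_cball push_ok ok' t x gw by auto
      then have "g' (push (a z) (q t z) (g w)) \<in> D" "g' (push (q t z) (a z) (g w)) \<in> D"
        using g'(4) by blast+
      then show ?thesis
        using x t 1 gw g'(5,6) push_push[OF push_ok[OF t x(3)] gw] push_push[OF ok'[OF x(3)] gw]
        by (auto simp: F_def G_def f_def)
    qed
    then show ?thesis by (metis bij_betw_byWitness[of UNIV G "\<lambda>x. F (t, x)" UNIV] subset_UNIV)
  qed
  show ?thesis
  proof (intro exI[of _ F] conjI contF ballI allI impI Fbij)
    show "F (0, x) = x" for x
    proof (cases "x \<in> D \<times> {0..1}")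
      case True
      then obtain w z where x: "x = (w, z)" "w \<in> D" "z \<in> {0..1}" by auto
      have "a z \<in> cball 0 1" "g w \<in> cball 0 1" using inD[OF x(3)] x(2) g'(3) unfolding a_def by blast+
      then show ?thesis using x g'(5) by (simp add: F_def f_def q_def push_same)
    qed (auto simp: F_def)
    show "F (t, w, z) = (w, z)" if "w \<notin> D \<or> z < 0 \<or> 1 < z" for t w z
      using that by (auto simp: F_def)
    show "F (1, p u, u) = (p' u, u)" if "u \<in> {0..1}" for u
    proof -
      have "push (a u) (q 1 u) (a u) = q 1 u" using push_source push_ok that by simp
      then show ?thesis using inD[OF that] that g'(5) by (simp add: F_def f_def q_def a_def a'_def)
    qed
  qed
qed

section \<open>Changing a diagram inside disks\<close>

text \<open>
  A chart around \<open>p\<close> is restricted to the preimage of a small disk around the origin, rescaled to the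
  unit disk; this preserves the coordinate axes.
\<close>

lemma transverse_crossing_cong_local:
  assumes tc: "transverse_crossing L p" and contL: "continuous_on (source L) (curve L)"
    and W: "open W" "p \<in> W" and nc: "ncomp M = ncomp L"
    and agree: "\<And>s. s \<in> source L \<Longrightarrow> curve L s \<in> W \<or> curve M s \<in> W \<Longrightarrow> curve M s = curve L s"
  shows "transverse_crossing M p"
proof -
  obtain A B U \<phi> \<psi> where U: "open U" "p \<in> U" and hom: "homeomorphism U (ball (0::complex) 1) \<phi> \<psi>"
    and p0: "\<phi> p = 0" and AB: "{s \<in> source L. curve L s \<in> U} = A \<union> B" "A \<inter> B = {}"
    and op: "openin (top_of_set (source L)) A" "openin (top_of_set (source L)) B"
    and bA: "bij_betw (\<phi> \<circ> curve L) A {z \<in> ball 0 1. Im z = 0}"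
    and bB: "bij_betw (\<phi> \<circ> curve L) B {z \<in> ball 0 1. Re z = 0}"
    using tc unfolding transverse_crossing_def by blast
  have open_pre: "open (U \<inter> \<phi> -` V)" if "open V" for V
    using hom U(1) that continuous_open_preimage unfolding homeomorphism_def by blast
  have "open (\<phi> ` (U \<inter> W))"
  proof -
    have "openin (top_of_set (ball 0 1)) (\<phi> ` (U \<inter> W))"
      using homeomorphism_imp_open_map[OF hom, of "U \<inter> W"] W(1) by (simp add: openin_open_Int)
    then show ?thesis using openin_open_trans open_ball by blast
  qed
  moreover have "0 \<in> \<phi> ` (U \<inter> W)" using p0 U(2) W(2) by (metis IntI imageI)
  ultimately obtain r where r: "r > 0" "ball 0 r \<subseteq> \<phi> ` (U \<inter> W)"
    using open_contains_ball by blast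
  define V where "V = U \<inter> \<phi> -` ball 0 r"
  have \<phi>U: "\<phi> ` U = ball 0 1" "\<psi> ` ball 0 1 = U" "\<And>x. x \<in> U \<Longrightarrow> \<psi> (\<phi> x) = x" "\<And>y. y \<in> ball 0 1 \<Longrightarrow> \<phi> (\<psi> y) = y"
    "continuous_on U \<phi>" "continuous_on (ball 0 1) \<psi>"
    using hom unfolding homeomorphism_def by auto
  have r1: "ball 0 r \<subseteq> ball (0::complex) 1" using r(2) \<phi>U(1) by blast
  have VW: "V \<subseteq> W"
  proof
    fix x assume x: "x \<in> V"
    then obtain y where "y \<in> U" "y \<in> W" "\<phi> x = \<phi> y" using r(2) unfolding V_def by blast
    then show "x \<in> W" using x \<phi>U(3) unfolding V_def by (metis IntD1)
  qed
  have VU: "V \<subseteq> U" by (auto simp: V_def)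
  have openV: "open V" unfolding V_def by (rule open_pre) simp
  have \<phi>V: "x \<in> V \<longleftrightarrow> x \<in> U \<and> norm (\<phi> x) < r" for x by (auto simp: V_def)
  have resc: "norm (z /\<^sub>R r) < 1 \<longleftrightarrow> norm z < r" for z :: complex
    using r(1) by (simp add: field_simps)
  have homV: "homeomorphism V (ball 0 1) (\<lambda>x. \<phi> x /\<^sub>R r) (\<lambda>y. \<psi> (r *\<^sub>R y))"
  proof (rule homeomorphismI)
    show "continuous_on V (\<lambda>x. \<phi> x /\<^sub>R r)"
      using \<phi>U(5) VU by (intro continuous_intros) (auto intro: continuous_on_subset)
    have in1: "r *\<^sub>R y \<in> ball 0 r" if "y \<in> ball 0 1" for y :: complex
      using that r(1) by simp
    show "continuous_on (ball 0 1) (\<lambda>y. \<psi> (r *\<^sub>R y))"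
      by (rule continuous_on_compose2[OF \<phi>U(6)]) (use in1 r1 in \<open>auto intro!: continuous_intros\<close>)
    show "(\<lambda>x. \<phi> x /\<^sub>R r) ` V \<subseteq> ball 0 1" using \<phi>V resc by auto
    show "(\<lambda>y. \<psi> (r *\<^sub>R y)) ` ball 0 1 \<subseteq> V"
    proof safe
      fix y :: complex assume "y \<in> ball 0 1"
      then have "r *\<^sub>R y \<in> ball 0 r" "r *\<^sub>R y \<in> ball 0 1" using in1 r1 by blast+
      then show "\<psi> (r *\<^sub>R y) \<in> V" using \<phi>U(2,4) by (auto simp: V_def)
    qed
    show "\<psi> (r *\<^sub>R (\<phi> x /\<^sub>R r)) = x" if "x \<in> V" for x
      using that \<phi>U(3) VU r(1) by auto
    show "\<phi> (\<psi> (r *\<^sub>R y)) /\<^sub>R r = y" if "y \<in> ball 0 1" for y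
    proof -
      have "r *\<^sub>R y \<in> ball 0 1" using in1[OF that] r1 by blast
      then show ?thesis using \<phi>U(4) r(1) by simp
    qed
  qed
  define A' B' where "A' = {s \<in> A. curve L s \<in> V}" "B' = {s \<in> B. curve L s \<in> V}"
  have openVL: "openin (top_of_set (source L)) {s \<in> source L. curve L s \<in> V}"
    using continuous_openin_preimage_gen[OF contL openV] by (simp add: vimage_def Int_def)
  have AsL: "A \<subseteq> source L" "B \<subseteq> source L" using op openin_imp_subset by blast+
  have "A' = A \<inter> {s \<in> source L. curve L s \<in> V}" "B' = B \<inter> {s \<in> source L. curve L s \<in> V}"
    using AsL by (auto simp: A'_B'_def)
  then have op': "openin (top_of_set (source L)) A'" "openin (top_of_set (source L)) B'"
    using op openVL by (auto intro: openin_Int)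
  have same: "curve M s = curve L s" if "s \<in> A' \<union> B'" for s
    using that agree[of s] AsL VW by (auto simp: A'_B'_def)
  have sets: "{s \<in> source M. curve M s \<in> V} = A' \<union> B'"
  proof -
    have "{s \<in> source M. curve M s \<in> V} = {s \<in> source L. curve L s \<in> V}"
      using agree VW nc by auto (metis subsetD)+
    also have "\<dots> = A' \<union> B'"
      using AB(1) VU AsL by (auto simp: A'_B'_def)
    finally show ?thesis .
  qed
  have bij: "bij_betw ((\<lambda>x. \<phi> x /\<^sub>R r) \<circ> curve M) C' {z \<in> ball 0 1. f z = 0}"
    if b: "bij_betw (\<phi> \<circ> curve L) C {z \<in> ball 0 1. f z = 0}"
      and C': "C' = {s \<in> C. curve L s \<in> V}" "C \<subseteq> source L" "\<And>s. s \<in> C \<Longrightarrow> curve L s \<in> U"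
      and f: "\<And>z c. f (c *\<^sub>R z) = c * f z" for C C' and f :: "complex \<Rightarrow> real"
  proof -
    have C'_iff: "s \<in> C' \<longleftrightarrow> s \<in> C \<and> norm (\<phi> (curve L s)) < r" for s
      using C'(1) C'(3)[of s] \<phi>V by auto
    have "bij_betw (\<phi> \<circ> curve L) C' {z \<in> ball 0 r. f z = 0}"
    proof (rule bij_betw_subset[OF b])
      show "C' \<subseteq> C" using C'(1) by auto
      have img: "(\<phi> \<circ> curve L) ` C = {z \<in> ball 0 1. f z = 0}" using b by (simp add: bij_betw_def)
      show "(\<phi> \<circ> curve L) ` C' = {z \<in> ball 0 r. f z = 0}"
      proof (intro equalityI subsetI)
        fix z assume "z \<in> (\<phi> \<circ> curve L) ` C'"
        then show "z \<in> {z \<in> ball 0 r. f z = 0}" using img C'_iff by auto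
      next
        fix z assume z: "z \<in> {z \<in> ball 0 r. f z = 0}"
        then have "z \<in> (\<phi> \<circ> curve L) ` C" using img r1 by blast
        then show "z \<in> (\<phi> \<circ> curve L) ` C'" using z C'_iff by auto
      qed
    qed
    moreover have "bij_betw (\<lambda>z. z /\<^sub>R r) {z \<in> ball 0 r. f z = 0} {z \<in> ball 0 1. f z = 0}"
      by (rule bij_betw_byWitness[where f' = "\<lambda>z. r *\<^sub>R z"]) (use r(1) f in \<open>auto simp: field_simps\<close>)
    ultimately have "bij_betw ((\<lambda>z. z /\<^sub>R r) \<circ> (\<phi> \<circ> curve L)) C' {z \<in> ball 0 1. f z = 0}"
      by (rule bij_betw_trans)
    moreover have "curve M s = curve L s" if "s \<in> C'" for s
      using that C' agree VW by blast
    ultimately show ?thesis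
      by (subst bij_betw_cong[where g = "(\<lambda>z. z /\<^sub>R r) \<circ> (\<phi> \<circ> curve L)"]) auto
  qed
  show ?thesis
    unfolding transverse_crossing_def
  proof (intro exI conjI)
    show "open V" "homeomorphism V (ball 0 1) (\<lambda>x. \<phi> x /\<^sub>R r) (\<lambda>y. \<psi> (r *\<^sub>R y))"
      "{s \<in> source M. curve M s \<in> V} = A' \<union> B'" by fact+
    show "p \<in> V" using U p0 r by (simp add: V_def)
    show "\<phi> p /\<^sub>R r = 0" using p0 by simp
    show "A' \<inter> B' = {}" using AB(2) by (auto simp: A'_B'_def)
    show "openin (top_of_set (source M)) A'" "openin (top_of_set (source M)) B'" using op' nc by simp_all
    show "bij_betw ((\<lambda>x. \<phi> x /\<^sub>R r) \<circ> curve M) A' {z \<in> ball 0 1. Im z = 0}"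
      by (rule bij[OF bA]) (use AsL AB in \<open>auto simp: A'_B'_def\<close>)
    show "bij_betw ((\<lambda>x. \<phi> x /\<^sub>R r) \<circ> curve M) B' {z \<in> ball 0 1. Re z = 0}"
      by (rule bij[OF bB]) (use AsL AB in \<open>auto simp: A'_B'_def\<close>)
  qed
qed

lemma curve_change_crossings [simp]: "curve (change_crossings X L) = curve L"
  and ncomp_change_crossings [simp]: "ncomp (change_crossings X L) = ncomp L"
  by (simp_all add: change_crossings_def)

lemma over_change_crossings: "s \<in> over (change_crossings X L) \<longleftrightarrow> (s \<in> over L) \<noteq> (curve L s \<in> X)"
  by (simp add: change_crossings_def)

lemma change_crossings_empty [simp]: "change_crossings {} L = L"
  by (simp add: change_crossings_def)

lemma link_diagram_change_crossings:
  assumes "link_diagram L"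
  shows "link_diagram (change_crossings X L)"
proof -
  have "crossings (change_crossings X L) = crossings L"
    "transverse_crossing (change_crossings X L) p = transverse_crossing L p" for p
    by (simp_all add: crossings_def transverse_crossing_def)
  then have cr: "finite (crossings (change_crossings X L))"
    "\<forall>p\<in>crossings (change_crossings X L). transverse_crossing (change_crossings X L) p"
    "continuous_on (source (change_crossings X L)) (curve (change_crossings X L))"
    using assms by (simp_all add: link_diagram_def)
  have "s \<in> over (change_crossings X L) \<longleftrightarrow> t \<notin> over (change_crossings X L)"
    if "s \<in> source L" "t \<in> source L" "s \<noteq> t" "curve L s = curve L t" for s t
    using over_iff_not_over[OF assms that] that(4) by (auto simp: over_change_crossings)
  then show ?thesis
    using cr unfolding link_diagram_def by (intro conjI ballI impI) simp_all
qed

lemma proper_arc_inj: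
  assumes "proper_arc D L a" "s \<in> path_image a" "t \<in> path_image a" "curve L s = curve L t"
  shows "s = t"
proof -
  obtain u u' where u: "u \<in> {0..1}" "u' \<in> {0..1}" "s = a u" "t = a u'"
    using assms(2,3) unfolding path_image_def by blast
  moreover have "inj_on (curve L \<circ> a) {0..1}" using assms(1) by (simp add: proper_arc_def arc_def)
  ultimately have "u = u'" using assms(4) inj_onD[of "curve L \<circ> a" "{0..1}" u u'] by simp
  then show ?thesis using u by simp
qed

definition over_only_at ::
    "diagram \<Rightarrow> (real \<Rightarrow> nat \<times> complex) \<Rightarrow> (real \<Rightarrow> nat \<times> complex) \<Rightarrow> complex \<Rightarrow> bool" where
  "over_only_at L a b x \<longleftrightarrow> (\<forall>s\<in>path_image a. \<forall>t\<in>path_image b. curve L s = curve L t \<longrightarrow>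
     curve L s = x \<and> s \<in> over L \<and> t \<notin> over L)"

lemma over_only_atD:
  assumes "over_only_at L a b x" "s \<in> path_image a" "t \<in> path_image b" "curve L s = curve L t"
  shows "curve L s = x" "curve L t = x" "s \<in> over L" "t \<notin> over L"
  using assms unfolding over_only_at_def by metis+

lemma crosses_once_overE:
  assumes "proper_arc D L a" "proper_arc D L b" "crosses_once_over D L a b"
  obtains x where "x \<in> interior D" "\<exists>s\<in>path_image a. \<exists>t\<in>path_image b. curve L s = x \<and> curve L t = x"
    "over_only_at L a b x"
proof -
  obtain u w where uw: "u \<in> path_image a" "w \<in> path_image b"
    "curve L ` path_image a \<inter> curve L ` path_image b = {curve L u}"
    "curve L u = curve L w" "curve L u \<in> interior D" "u \<in> over L" "w \<notin> over L"
    using assms(3) unfolding crosses_once_over_def by blast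
  show ?thesis
  proof (rule that[of "curve L u"])
    show "\<exists>s\<in>path_image a. \<exists>t\<in>path_image b. curve L s = curve L u \<and> curve L t = curve L u"
      using uw by metis
    show "over_only_at L a b (curve L u)"
      unfolding over_only_at_def
    proof (intro ballI impI)
      fix s t assume st: "s \<in> path_image a" "t \<in> path_image b" "curve L s = curve L t"
      then have x: "curve L s = curve L u" using uw(3) by (metis IntI image_eqI singletonD)
      then have "s = u" "t = w"
        using proper_arc_inj[OF assms(1) st(1) uw(1)] proper_arc_inj[OF assms(2) st(2) uw(2)] st uw by metis+
      then show "curve L s = curve L u \<and> s \<in> over L \<and> t \<notin> over L" using uw by simp
    qed
  qed (rule uw)
qed

lemma delta_triangle_arcs:
  assumes "delta_triangle D L a b c"
  shows "{s \<in> source L. curve L s \<in> D} = path_image a \<union> path_image b \<union> path_image c"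
    "path_image a \<inter> path_image b = {}" "path_image b \<inter> path_image c = {}" "path_image c \<inter> path_image a = {}"
    "proper_arc D L a" "proper_arc D L b" "proper_arc D L c"
    "crosses_once_over D L a b" "crosses_once_over D L b c" "crosses_once_over D L c a"
  using assms unfolding delta_triangle_def by blast+

lemma delta_triangleE:
  assumes L: "link_diagram L" and T: "delta_triangle D L a b c"
  obtains x y z where "{x, y, z} \<subseteq> crossings L \<inter> interior D" "x \<noteq> y" "x \<noteq> z" "y \<noteq> z"
    "over_only_at L a b x"
    "over_only_at L c a y"
    "over_only_at L b c z"
    "\<exists>s\<in>path_image b. \<exists>t\<in>path_image c. curve L s = z \<and> curve L t = z"
proof -
  note A = delta_triangle_arcs[OF T]
  have sub: "path_image a \<subseteq> source L" "path_image b \<subseteq> source L" "path_image c \<subseteq> source L"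
    using A(1) by blast+
  obtain x where x: "x \<in> interior D" "\<exists>s\<in>path_image a. \<exists>t\<in>path_image b. curve L s = x \<and> curve L t = x"
    "over_only_at L a b x"
    by (rule crosses_once_overE[OF A(5,6,8)])
  obtain z where z: "z \<in> interior D" "\<exists>s\<in>path_image b. \<exists>t\<in>path_image c. curve L s = z \<and> curve L t = z"
    "over_only_at L b c z"
    by (rule crosses_once_overE[OF A(6,7,9)])
  obtain y where y: "y \<in> interior D" "\<exists>s\<in>path_image c. \<exists>t\<in>path_image a. curve L s = y \<and> curve L t = y"
    "over_only_at L c a y"
    by (rule crosses_once_overE[OF A(7,5,10)])
  have three: False if "r \<in> path_image a" "s \<in> path_image b" "t \<in> path_image c"
    "curve L r = p" "curve L s = p" "curve L t = p" for r s t p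
  proof -
    have "r \<in> source L" "s \<in> source L" "t \<in> source L" using that sub by blast+
    moreover have "r \<noteq> s" "t \<noteq> r" "t \<noteq> s" using that A(2-4) by blast+
    ultimately show False using at_most_two_preimages[OF L, of r s t] that by simp
  qed
  have cr: "p \<in> crossings L" if "s \<in> X" "t \<in> Y" "X \<inter> Y = {}" "X \<subseteq> source L" "Y \<subseteq> source L"
    "curve L s = p" "curve L t = p" for s t X Y p
  proof -
    have "s \<in> source L" "t \<in> source L" "s \<noteq> t" using that(1-5) by blast+
    then show ?thesis using that(6,7) by (auto simp: crossings_def)
  qed
  obtain r1 s1 where 1: "r1 \<in> path_image a" "s1 \<in> path_image b" "curve L r1 = x" "curve L s1 = x"
    using x(2) by blast
  obtain s2 t2 where 2: "s2 \<in> path_image b" "t2 \<in> path_image c" "curve L s2 = z" "curve L t2 = z"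
    using z(2) by blast
  obtain t3 r3 where 3: "t3 \<in> path_image c" "r3 \<in> path_image a" "curve L t3 = y" "curve L r3 = y"
    using y(2) by blast
  show ?thesis
  proof (rule that[of x y z])
    show "x \<noteq> y" using three[OF 1(1,2) 3(1) 1(3,4)] 3(3) by blast
    show "x \<noteq> z" using three[OF 1(1,2) 2(2) 1(3,4)] 2(4) by blast
    show "y \<noteq> z" using three[OF 3(2) 2(1,2) 3(4)] 2(3,4) by blast
    have "x \<in> crossings L" "y \<in> crossings L" "z \<in> crossings L"
      by (rule cr[OF 1(1,2) A(2) sub(1,2) 1(3,4)] cr[OF 2(1,2) A(3) sub(2,3) 2(3,4)]
            cr[OF 3(1,2) A(4) sub(3,1) 3(3,4)])+
    then show "{x, y, z} \<subseteq> crossings L \<inter> interior D" using x(1) y(1) z(1) by blast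
  qed (fact x(3) y(3) z(3) z(2))+
qed

lemma delta_triangle_crossing_interior:
  assumes L: "link_diagram L" and T: "delta_triangle D L a b c"
    and p: "p \<in> crossings L" "p \<in> D"
  shows "p \<in> interior D"
proof -
  note A = delta_triangle_arcs[OF T]
  obtain x y z where xyz: "{x, y, z} \<subseteq> crossings L \<inter> interior D" "x \<noteq> y" "x \<noteq> z" "y \<noteq> z"
    "over_only_at L a b x"
    "over_only_at L c a y"
    "over_only_at L b c z"
    "\<exists>s\<in>path_image b. \<exists>t\<in>path_image c. curve L s = z \<and> curve L t = z"
    by (rule delta_triangleE[OF L T])
  obtain s t where st: "s \<in> source L" "t \<in> source L" "s \<noteq> t" "curve L s = p" "curve L t = p"
    using p by (auto simp: crossings_def)
  have eq: "curve L s = curve L t" "curve L t = curve L s" using st by simp_all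
  have "s \<in> path_image a \<union> path_image b \<union> path_image c" "t \<in> path_image a \<union> path_image b \<union> path_image c"
    unfolding A(1)[symmetric] using st p(2) by simp_all
  moreover have "\<not> (s \<in> path_image x \<and> t \<in> path_image x)" if "proper_arc D L x" for x
    using proper_arc_inj[OF that _ _ eq(1)] st(3) by blast
  ultimately consider "s \<in> path_image a" "t \<in> path_image b" | "s \<in> path_image b" "t \<in> path_image a"
    | "s \<in> path_image b" "t \<in> path_image c" | "s \<in> path_image c" "t \<in> path_image b"
    | "s \<in> path_image c" "t \<in> path_image a" | "s \<in> path_image a" "t \<in> path_image c"
    using A(5-7) by blast
  then have "p \<in> {x, y, z}"
    using xyz(5-7)[THEN over_only_atD(1), OF _ _ eq(1)] xyz(5-7)[THEN over_only_atD(1), OF _ _ eq(2)]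
      st(4,5) by cases simp_all
  then show ?thesis using xyz(1) by blast
qed

lemma proper_arc_frontier:
  assumes "proper_arc D L a" "s \<in> path_image a" "curve L s \<in> frontier D"
  shows "s = pathstart a \<or> s = pathfinish a"
proof -
  obtain u where u: "u \<in> {0..1}" "s = a u" using assms(2) by (auto simp: path_image_def)
  have "u \<notin> {0<..<1}" using assms(1,3) u by (auto simp: proper_arc_def frontier_def)
  then have "u = 0 \<or> u = 1" using u(1) by auto
  then show ?thesis using u(2) by (auto simp: pathstart_def pathfinish_def)
qed

lemma delta_move_inE:
  assumes "delta_move_in D L L'"
  obtains a b c where "compact D" "ncomp L' = ncomp L" "D homeomorphic cball (0::complex) 1"
    "delta_triangle D L a b c" "delta_triangle D L' a b c"
    "curve L' (pathstart a) = curve L (pathstart a)" "curve L' (pathfinish a) = curve L (pathfinish a)"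
    "\<forall>s\<in>path_image b \<union> path_image c. curve L' s = curve L s"
proof -
  have "compact D" using assms homeomorphic_compactness[of D "cball (0::complex) 1"] by (simp add: delta_move_in_def)
  then show ?thesis
    using assms that unfolding delta_move_in_def by blast
qed

lemma delta_move_in_source:
  assumes "delta_move_in D L L'" "s \<in> source L"
  shows "curve L' s \<in> D \<longleftrightarrow> curve L s \<in> D"
    "curve L s \<in> frontier D \<Longrightarrow> curve L' s = curve L s"
proof -
  obtain a b c where D: "compact D" "ncomp L' = ncomp L"
    "delta_triangle D L a b c" "delta_triangle D L' a b c"
    "curve L' (pathstart a) = curve L (pathstart a)" "curve L' (pathfinish a) = curve L (pathfinish a)"
    "\<forall>s\<in>path_image b \<union> path_image c. curve L' s = curve L s"
    by (rule delta_move_inE[OF assms(1)])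
  note A = delta_triangle_arcs[OF D(3)] and A' = delta_triangle_arcs[OF D(4)]
  show "curve L' s \<in> D \<longleftrightarrow> curve L s \<in> D" using A(1) A'(1) assms(2) D(2) by auto
  assume fr: "curve L s \<in> frontier D"
  then have "curve L s \<in> D" using D(1) by (simp add: frontier_def compact_imp_closed)
  then have "s \<in> path_image a \<or> s \<in> path_image b \<union> path_image c" using A(1) assms(2) by blast
  then show "curve L' s = curve L s"
    using proper_arc_frontier[OF A(5) _ fr] D(5-7) by metis
qed

lemma delta_movesD:
  assumes "delta_moves \<D> L L'"
  shows "link_diagram L" "link_diagram L'" "ncomp L' = ncomp L" "pairwise disjnt \<D>"
    "\<And>D. D \<in> \<D> \<Longrightarrow> delta_move_in D L L'"
  using assms by (simp_all add: delta_moves_def)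

text \<open>Disjoint disks contain different crossings of the diagram.\<close>

lemma delta_moves_finite:
  assumes "delta_moves \<D> L L'"
  shows "finite \<D>"
proof -
  note M = delta_movesD[OF assms]
  have "\<exists>p. p \<in> crossings L \<inter> D" if "D \<in> \<D>" for D
  proof -
    obtain a b c where T: "delta_triangle D L a b c" by (rule delta_move_inE[OF M(5)[OF \<open>D \<in> \<D>\<close>]])
    obtain x y z where "{x, y, z} \<subseteq> crossings L \<inter> interior D"
      by (rule delta_triangleE[OF M(1) T])
    then show ?thesis using interior_subset by blast
  qed
  then obtain f where f: "\<And>D. D \<in> \<D> \<Longrightarrow> f D \<in> crossings L \<inter> D" by metis
  have "inj_on f \<D>"
    using f M(4) unfolding inj_on_def pairwise_def disjnt_def by (metis IntD2 disjoint_iff)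
  moreover have "finite (crossings L)" by (rule link_diagramD(2)[OF M(1)])
  ultimately show ?thesis using f by (meson IntD1 finite_imageD finite_subset image_subsetI)
qed

lemma curve_replace_inside:
  "curve (replace_inside U L' L) s = (if curve L s \<in> U then curve L' s else curve L s)"
  and over_replace_inside:
  "s \<in> over (replace_inside U L' L) \<longleftrightarrow> (if curve L s \<in> U then s \<in> over L' else s \<in> over L)"
  and ncomp_replace_inside [simp]: "ncomp (replace_inside U L' L) = ncomp L"
  by (simp_all add: replace_inside_def)

text \<open>
  On the frontier of a disk the two diagrams agree, and no crossing lies there.  Hence the curves can be
  glued along the frontiers, and near each of its crossings the result coincides with \<open>L\<close> or with \<open>L'\<close>.
\<close>

lemma link_diagram_replace_inside:
  assumes \<D>: "delta_moves \<D> L L'" and E: "E \<subseteq> \<D>"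
  shows "link_diagram (replace_inside (\<Union>E) L' L)" (is "link_diagram ?M")
proof -
  note M = delta_movesD[OF \<D>]
  let ?U = "\<Union>E"
  have contL: "continuous_on (source L) (curve L)" and contL': "continuous_on (source L) (curve L')"
    using link_diagramD(1)[OF M(1)] link_diagramD(1)[OF M(2)] M(3) by simp_all
  have finE: "finite E" using delta_moves_finite[OF \<D>] E by (rule finite_subset[rotated])
  have cD: "closed D" if "D \<in> E" for D
    using delta_move_inE[OF M(5)] that E compact_imp_closed by (metis subsetD)
  have cU: "closed ?U" using finE cD by blast
  have inU: "curve L' s \<in> ?U \<longleftrightarrow> curve L s \<in> ?U" if "s \<in> source L" for s
    using delta_move_in_source(1)[OF M(5) that] E by blast
  then have inU': "curve ?M s \<in> ?U \<longleftrightarrow> curve L s \<in> ?U" if "s \<in> source L" for s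
    using that by (simp add: curve_replace_inside)
  define P where "P = source L \<inter> curve L -` ?U"
  define Q where "Q = source L \<inter> curve L -` (\<Inter>D\<in>E. - interior D)"
  have PQ: "P \<union> Q = source L" 
  proof -
    have "curve L s \<in> ?U \<or> (\<forall>D\<in>E. curve L s \<notin> interior D)" for s
      using interior_subset by blast
    then show ?thesis unfolding P_def Q_def by blast
  qed
  have "continuous_on (P \<union> Q) (\<lambda>s. if curve L s \<in> ?U then curve L' s else curve L s)"
  proof (rule continuous_on_cases_local)
    show "closedin (top_of_set (P \<union> Q)) P"
      unfolding PQ unfolding P_def by (rule continuous_closedin_preimage[OF contL cU])
    have "closed (\<Inter>D\<in>E. - interior D)" by (intro closed_INT ballI) (simp add: closed_Compl)
    then show "closedin (top_of_set (P \<union> Q)) Q"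
      unfolding PQ unfolding Q_def by (rule continuous_closedin_preimage[OF contL])
    show "continuous_on P (curve L')" "continuous_on Q (curve L)"
      using contL contL' by (auto simp: P_def Q_def intro: continuous_on_subset)
    fix s assume s: "s \<in> P \<and> curve L s \<notin> ?U \<or> s \<in> Q \<and> curve L s \<in> ?U"
    then obtain D where D: "D \<in> E" "curve L s \<in> D" "curve L s \<notin> interior D" "s \<in> source L"
      by (auto simp: P_def Q_def)
    then have "curve L s \<in> frontier D" using cD by (simp add: frontier_def)
    then show "curve L' s = curve L s"
      using delta_move_in_source(2)[OF M(5) D(4)] D(1) E by blast
  qed
  then have cont: "continuous_on (source ?M) (curve ?M)"
    unfolding PQ by (simp add: curve_replace_inside)
  have cr: "p \<in> crossings L' \<and> p \<in> ?U \<or> p \<in> crossings L \<and> p \<notin> ?U" if "p \<in> crossings ?M" for p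
  proof -
    obtain s t where st: "s \<in> source L" "t \<in> source L" "s \<noteq> t" "curve ?M s = p" "curve ?M t = p"
      using \<open>p \<in> crossings ?M\<close> by (auto simp: crossings_def)
    then have iff: "curve L s \<in> ?U \<longleftrightarrow> p \<in> ?U" "curve L t \<in> ?U \<longleftrightarrow> p \<in> ?U"
      using inU'[of s] inU'[of t] by simp_all
    show ?thesis
    proof (cases "p \<in> ?U")
      case True
      then have "curve L' s = p" "curve L' t = p" using iff st(4,5) by (simp_all add: curve_replace_inside)
      then show ?thesis using True st(1-3) M(3) by (auto simp: crossings_def)
    next
      case False
      then have "curve L s = p" "curve L t = p" using iff st(4,5) by (simp_all add: curve_replace_inside)
      then show ?thesis using False st(1-3) by (auto simp: crossings_def)
    qed
  qed
  have "crossings ?M \<subseteq> crossings L \<union> crossings L'" using cr by blast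
  then have fin: "finite (crossings ?M)"
    by (rule finite_subset) (simp add: link_diagramD(2) M(1,2))
  have tr: "transverse_crossing ?M p" if p: "p \<in> crossings ?M" for p
    using cr[OF p]
  proof (elim disjE conjE)
    assume p': "p \<in> crossings L'" "p \<in> ?U"
    then obtain D where D: "D \<in> E" "p \<in> D" by blast
    obtain a b c where T: "delta_triangle D L' a b c" using delta_move_inE[OF M(5)] D(1) E by (metis subsetD)
    have int: "p \<in> interior D" by (rule delta_triangle_crossing_interior[OF M(2) T p'(1) D(2)])
    have WU: "interior D \<subseteq> ?U" using D(1) interior_subset by blast
    show ?thesis
    proof (rule transverse_crossing_cong_local[OF _ _ open_interior int])
      show "transverse_crossing L' p" by (rule link_diagramD(3)[OF M(2) p'(1)])
      show "continuous_on (source L') (curve L')" using contL' M(3) by simp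
      show "ncomp ?M = ncomp L'" using M(3) by simp
      fix s assume s: "s \<in> source L'" "curve L' s \<in> interior D \<or> curve ?M s \<in> interior D"
      then have "s \<in> source L" "curve L' s \<in> ?U \<or> curve ?M s \<in> ?U" using WU M(3) by auto
      then have "curve L s \<in> ?U" using inU inU' by blast
      then show "curve ?M s = curve L' s" by (simp add: curve_replace_inside)
    qed
  next
    assume p': "p \<in> crossings L" "p \<notin> ?U"
    show ?thesis
    proof (rule transverse_crossing_cong_local[where W = "- ?U" and L = L])
      show "transverse_crossing L p" by (rule link_diagramD(3)[OF M(1) p'(1)])
      show "open (- ?U)" using cU by (simp add: open_Compl)
      fix s assume "s \<in> source L" "curve L s \<in> - ?U \<or> curve ?M s \<in> - ?U"
      then have "curve L s \<notin> ?U" using inU' by blast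
      then show "curve ?M s = curve L s" by (simp add: curve_replace_inside)
    qed (use contL p'(2) in auto)
  qed
  have ov: "s \<in> over ?M \<longleftrightarrow> t \<notin> over ?M"
    if st: "s \<in> source L" "t \<in> source L" "s \<noteq> t" "curve ?M s = curve ?M t" for s t
  proof -
    have iff: "curve L s \<in> ?U \<longleftrightarrow> curve L t \<in> ?U" using inU'[OF st(1)] inU'[OF st(2)] st(4) by simp
    have st': "s \<in> source L'" "t \<in> source L'" using st M(3) by simp_all
    show ?thesis
    proof (cases "curve L s \<in> ?U")
      case True
      then have "curve L' s = curve L' t" using st(4) iff by (simp add: curve_replace_inside)
      then have "s \<in> over L' \<longleftrightarrow> t \<notin> over L'" using over_iff_not_over[OF M(2) st' st(3)] by simp
      then show ?thesis using True iff by (simp add: over_replace_inside)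
    next
      case False
      then have "curve L s = curve L t" using st(4) iff by (simp add: curve_replace_inside)
      then have "s \<in> over L \<longleftrightarrow> t \<notin> over L" using over_iff_not_over[OF M(1) st(1-3)] by simp
      then show ?thesis using False iff by (simp add: over_replace_inside)
    qed
  qed
  show ?thesis
    unfolding link_diagram_def
    using cont fin tr ov by (intro conjI ballI impI) simp_all
qed

section \<open>A delta move as an alternating sum of crossing changes\<close>

text \<open>
  Let \<open>V1\<close> and \<open>V2\<close> be the parts of the diagram in \<open>D\<close> that lie above and below the arc \<open>a\<close>.
  There is one height function that serves both diagrams and takes the values \<open>u\<close> at \<open>a u\<close>, at least \<open>2\<close>
  on \<open>V1\<close> and at most \<open>-1\<close> on \<open>V2\<close>; the isotopy of \<open>arc_push_isotopy\<close> then moves nothing but \<open>a\<close>.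
\<close>

lemma diagram_type_push_arc:
  assumes M: "link_diagram M" and M': "link_diagram M'" and nc: "ncomp M' = ncomp M"
    and D: "D homeomorphic cball (0::complex) 1"
    and a: "arc a" "proper_arc D M a" "proper_arc D M' a"
    and ends: "curve M' (pathstart a) = curve M (pathstart a)" "curve M' (pathfinish a) = curve M (pathfinish a)"
    and V: "compact V1" "compact V2" "V1 \<inter> V2 = {}" "path_image a \<inter> (V1 \<union> V2) = {}"
    and inD: "{s \<in> source M. curve M s \<in> D} = path_image a \<union> (V1 \<union> V2)"
      "{s \<in> source M. curve M' s \<in> D} = path_image a \<union> (V1 \<union> V2)"
    and off: "\<And>s. s \<in> source M \<Longrightarrow> s \<notin> path_image a \<Longrightarrow> curve M' s = curve M s"
    and over_off: "\<And>s t. s \<in> source M \<Longrightarrow> t \<in> source M \<Longrightarrow> s \<notin> path_image a \<Longrightarrow> t \<notin> path_image a \<Longrightarrow>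
        s \<noteq> t \<Longrightarrow> curve M s = curve M t \<Longrightarrow> s \<in> over M' \<longleftrightarrow> s \<in> over M"
    and above: "\<And>N s t. N = M \<or> N = M' \<Longrightarrow> s \<in> path_image a \<Longrightarrow> t \<in> V1 \<Longrightarrow> curve N s = curve N t \<Longrightarrow> t \<in> over N"
    and below: "\<And>N s t. N = M \<or> N = M' \<Longrightarrow> s \<in> path_image a \<Longrightarrow> t \<in> V2 \<Longrightarrow> curve N s = curve N t \<Longrightarrow> t \<notin> over N"
    and above_below: "\<And>s t. s \<in> V1 \<Longrightarrow> t \<in> V2 \<Longrightarrow> curve M s = curve M t \<Longrightarrow> s \<in> over M"
  shows "diagram_type M = diagram_type M'"
proof -
  define X where "X = {s \<in> source M. curve M s \<in> crossings M}"
  have finX: "finite X" unfolding X_def by (rule finite_crossing_points[OF M])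
  have sub: "path_image a \<subseteq> source M" "V1 \<subseteq> source M" "V2 \<subseteq> source M" "X \<subseteq> source M"
    using inD(1) by (auto simp: X_def)
  \<comment> \<open>The function \<open>k\<close> orders the strands at crossings apart from \<open>a\<close>; it is shifted above or below the arc \<open>a\<close>.\<close>
  define k0 where "k0 = (\<lambda>s. of_bool (s \<in> over M) :: real)"
  have "continuous_on X k0" using finX by (rule continuous_on_finite)
  then obtain k where k: "continuous_on UNIV k" "\<And>s. s \<in> X \<Longrightarrow> k s = k0 s" "\<And>s. \<bar>k s\<bar> \<le> 1"
    by (rule Tietze_source[OF finite_imp_compact[OF finX], where B = 1]) (simp_all add: k0_def)
  have k': "continuous_on A (\<lambda>s. k s)" for A using k(1) by (rule continuous_on_subset) simp
  obtain ai where ai: "homeomorphism {0..1} (path_image a) a ai"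
    using homeomorphism_compact[of "{0..1}" a "path_image a"] a(1)
    by (auto simp: arc_def path_def path_image_def)
  have ai': "continuous_on (path_image a) ai" "\<And>u. u \<in> {0..1} \<Longrightarrow> ai (a u) = u"
    "\<And>s. s \<in> path_image a \<Longrightarrow> a (ai s) = s" "\<And>s. s \<in> path_image a \<Longrightarrow> ai s \<in> {0..1}"
    using ai by (auto simp: homeomorphism_def)
  define X' where "X' = X - (path_image a \<union> (V1 \<union> V2))"
  define g where "g = (\<lambda>s. if s \<in> path_image a then ai s else if s \<in> V1 then 3 + k s
      else if s \<in> V2 then k s - 2 else k s)"
  let ?Z = "path_image a \<union> (V1 \<union> (V2 \<union> X'))"
  have comp: "compact (path_image a)" "compact X'"
    using compact_arc_image[OF a(1)] finX by (auto simp: X'_def intro: finite_imp_compact)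
  have g_a: "g s = ai s" if "s \<in> path_image a" for s using that by (simp add: g_def)
  have g_1: "g s = 3 + k s" if "s \<in> V1" for s using that V(4) by (auto simp: g_def)
  have g_2: "g s = k s - 2" if "s \<in> V2" for s using that V(3,4) by (auto simp: g_def)
  have g_X: "g s = k s" if "s \<in> X'" for s using that by (auto simp: g_def X'_def)
  have contg: "continuous_on ?Z g"
  proof (intro continuous_on_closed_Un closed_Un compact_imp_closed comp V)
    show "continuous_on (path_image a) g" by (rule continuous_on_eq[OF ai'(1)]) (simp add: g_a)
    have c1: "continuous_on V1 (\<lambda>s. 3 + k s)" and c2: "continuous_on V2 (\<lambda>s. k s - 2)"
      by (intro continuous_intros k')+
    show "continuous_on V1 g" by (rule continuous_on_eq[OF c1]) (simp add: g_1)
    show "continuous_on V2 g" by (rule continuous_on_eq[OF c2]) (simp add: g_2)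
    show "continuous_on X' g" by (rule continuous_on_eq[OF k']) (simp add: g_X)
  qed
  have compZ: "compact ?Z" by (intro compact_Un comp V)
  have bg: "\<bar>g s\<bar> \<le> 4" for s
  proof (cases "s \<in> path_image a")
    case True
    then show ?thesis using ai'(4)[OF True] by (simp add: g_def)
  qed (use k(3)[of s] in \<open>auto simp: g_def\<close>)
  obtain h where h: "continuous_on UNIV h" "\<And>s. s \<in> ?Z \<Longrightarrow> h s = g s"
    by (rule Tietze_source[OF compZ contg bg]) auto
  have ha: "h s = ai s" "0 \<le> h s" "h s \<le> 1" if "s \<in> path_image a" for s
    using h(2)[of s] that g_a[OF that] ai'(4)[OF that] by auto
  have h1: "h s = 3 + k s" "2 \<le> h s" if "s \<in> V1" for s
    using h(2)[of s] that g_1[OF that] k(3)[of s] by auto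
  have h2: "h s = k s - 2" "h s \<le> - 1" if "s \<in> V2" for s
    using h(2)[of s] that g_2[OF that] k(3)[of s] by auto
  have heights: "heights N h" if N: "N = M \<or> N = M'" for N
  proof -
    have LN: "link_diagram N" and ncN: "ncomp N = ncomp M" using N M M' nc by auto
    have inDN: "{s \<in> source M. curve N s \<in> D} = path_image a \<union> (V1 \<union> V2)" using N inD by auto
    have aN: "proper_arc D N a" using N a by auto
    have offN: "curve N s = curve M s" if "s \<in> source M" "s \<notin> path_image a" for s
      using N off[OF that] by auto
    show ?thesis
      unfolding heights_def
    proof (intro conjI ballI impI)
      show "continuous_on (source N) h" using h(1) by (rule continuous_on_subset) simp
      fix s t assume "s \<in> source N" "t \<in> source N" and st: "s \<noteq> t \<and> curve N s = curve N t \<and> s \<in> over N"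
      then have src: "s \<in> source M" "t \<in> source M" by (simp_all add: ncN)
      have eq: "curve N s = curve N t" "curve N t = curve N s" and ne: "s \<noteq> t" and s_over: "s \<in> over N" using st by simp_all
      have t_over: "t \<notin> over N"
        using over_iff_not_over[OF LN _ _ ne eq(1)] src s_over by (simp add: ncN)
      have not_both: "\<not> (s \<in> path_image a \<and> t \<in> path_image a)"
        using proper_arc_inj[OF aN _ _ eq(1)] ne by blast
      have mem: "s \<in> path_image a \<union> (V1 \<union> V2) \<longleftrightarrow> t \<in> path_image a \<union> (V1 \<union> V2)"
        unfolding inDN[symmetric] using src eq(1) by simp
      consider "s \<in> path_image a" | "t \<in> path_image a" | "s \<notin> path_image a" "t \<notin> path_image a" by blast
      then show "h t < h s"
      proof cases
        case 1
        then have "t \<in> V1 \<or> t \<in> V2" using mem not_both by blast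
        then have "t \<in> V2" using above[OF N 1 _ eq(1)] t_over by blast
        then show ?thesis using ha(2)[OF 1] h2(2) by fastforce
      next
        case 2
        then have "s \<in> V1 \<or> s \<in> V2" using mem not_both by blast
        then have sV: "s \<in> V1" using below[OF N 2 _ eq(2)] s_over by blast
        then show ?thesis using ha(3)[OF 2] h1(2)[OF sV] by linarith
      next
        case 3
        have eqM: "curve M s = curve M t" "curve M t = curve M s"
          using eq offN src 3 by simp_all
        have cr: "curve M s \<in> crossings M" "curve M t \<in> crossings M"
          using src ne eqM by (auto simp: crossings_def)
        then have X: "s \<in> X" "t \<in> X" using src by (simp_all add: X_def)
        have s_M: "s \<in> over M" using N s_over over_off[OF src 3 ne eqM(1)] by auto
        then have t_M: "t \<notin> over M" using over_iff_not_over[OF M src ne eqM(1)] by simp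
        have ks: "k s = 1" "k t = 0" using k(2) X s_M t_M by (simp_all add: k0_def)
        show ?thesis
        proof (cases "s \<in> V1 \<union> V2")
          case True
          then have "t \<in> V1 \<union> V2" using mem 3 by blast
          moreover have "\<not> (s \<in> V2 \<and> t \<in> V1)" using above_below[OF _ _ eqM(2)] t_M by blast
          ultimately show ?thesis using True h1(1)[of s] h1(1)[of t] h2(1)[of s] h2(1)[of t] ks by auto
        next
          case False
          then have "s \<in> X'" "t \<in> X'" using mem 3 X by (auto simp: X'_def)
          then have "h s = k s" "h t = k t" using h(2) g_X by auto
          then show ?thesis using ks by simp
        qed
      qed
    qed
  qed
  define p p' where "p = curve M \<circ> a" and "p' = curve M' \<circ> a"
  have arcs: "continuous_on {0..1} p" "continuous_on {0..1} p'"
    "\<And>u. u \<in> {0<..<1} \<Longrightarrow> p u \<in> interior D" "\<And>u. u \<in> {0<..<1} \<Longrightarrow> p' u \<in> interior D"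
    "p 0 \<in> frontier D" "p 1 \<in> frontier D" "p 0 = p' 0" "p 1 = p' 1"
    using a(2,3) ends
    by (auto simp: proper_arc_def arc_def path_def p_def p'_def pathstart_def pathfinish_def)
  obtain F :: "real \<times> complex \<times> real \<Rightarrow> complex \<times> real" where
    F: "continuous_on ({0..1} \<times> UNIV) F \<and> (\<forall>t\<in>{0..1}. bij (\<lambda>x. F (t, x))) \<and> (\<forall>x. F (0, x) = x) \<and>
      (\<forall>t w z. w \<notin> D \<or> z < 0 \<or> 1 < z \<longrightarrow> F (t, w, z) = (w, z)) \<and>
      (\<forall>u\<in>{0..1}. F (1, p u, u) = (p' u, u))"
    by (atomize_elim, rule arc_push_isotopy[OF D arcs(1) _ arcs(2) _ arcs(7,8,5,6)]) (erule arcs)+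
  then have contF: "continuous_on ({0..1} \<times> UNIV) F" and bijF: "\<And>t. t \<in> {0..1} \<Longrightarrow> bij (\<lambda>x. F (t, x))"
    and F0: "\<And>x. F (0, x) = x" and F_id: "\<And>t w z. w \<notin> D \<or> z < 0 \<or> 1 < z \<Longrightarrow> F (t, w, z) = (w, z)"
    and F1: "\<And>u. u \<in> {0..1} \<Longrightarrow> F (1, p u, u) = (p' u, u)"
    by blast+
  have "bounded D"
    using D homeomorphic_compactness[of D "cball (0::complex) 1"] by (simp add: compact_imp_bounded)
  then obtain d where d: "\<And>w. w \<in> D \<Longrightarrow> norm w \<le> d" by (auto simp: bounded_iff)
  have "ambient_isotopic \<lparr>ncomponents = ncomp M, embedding = (\<lambda>s. stereo ((\<lambda>s. (curve M s, h s)) s))\<rparr>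
      \<lparr>ncomponents = ncomp M, embedding = (\<lambda>s. stereo ((\<lambda>s. (curve M' s, h s)) s))\<rparr>"
  proof (rule ambient_isotopic_of_compact_isotopy[where F = F and R = "d + 2", OF contF bijF F0])
    show "F (t, x) = x" if "d + 2 \<le> norm x" for t x
    proof -
      obtain w z where x: "x = (w, z)" by (cases x)
      have "norm x \<le> norm w + \<bar>z\<bar>" unfolding x by (metis norm_Pair_le real_norm_def)
      then have "w \<notin> D \<or> z < 0 \<or> 1 < z" using d[of w] that by fastforce
      then show ?thesis unfolding x by (rule F_id)
    qed
    fix s assume s: "s \<in> source M"
    show "F (1, (curve M s, h s)) = (curve M' s, h s)"
    proof (cases "s \<in> path_image a")
      case True
      then have "a (ai s) = s" "h s = ai s" "ai s \<in> {0..1}" using ai' ha by auto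
      then show ?thesis using F1[of "ai s"] by (simp add: p_def p'_def)
    next
      case False
      have "curve M s \<notin> D \<or> h s < 0 \<or> 1 < h s"
      proof (cases "curve M s \<in> D")
        case True
        then have "s \<in> path_image a \<union> (V1 \<union> V2)" unfolding inD(1)[symmetric] using s by simp
        then show ?thesis using False h1(2)[of s] h2(2)[of s] by auto
      qed simp
      then have "F (1, curve M s, h s) = (curve M s, h s)" by (rule F_id)
      then show ?thesis using off[OF s False] by simp
    qed
  qed
  then have "ambient_isotopic (lift M h) (lift M' h)" by (simp add: lift_def nc)
  then show ?thesis
    using diagram_type_eqI[OF M heights M' heights] by blast
qed

definition delta_result :: "diagram \<Rightarrow> diagram \<Rightarrow> complex set set \<Rightarrow> complex set \<Rightarrow> diagram" where
  "delta_result L L' E Y = change_crossings Y (replace_inside (\<Union>E) L' L)"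

lemma delta_result_simps:
  "ncomp (delta_result L L' E Y) = ncomp L"
  "curve (delta_result L L' E Y) s = (if curve L s \<in> \<Union>E then curve L' s else curve L s)"
  "s \<in> over (delta_result L L' E Y) \<longleftrightarrow>
     (if curve L s \<in> \<Union>E then s \<in> over L' else s \<in> over L) \<noteq> (curve (delta_result L L' E Y) s \<in> Y)"
  by (simp_all add: delta_result_def over_change_crossings curve_replace_inside over_replace_inside del: Union_iff)

text \<open>
  \<open>x\<close>, \<open>y\<close> are crossings of \<open>L\<close> in \<open>D\<close> and \<open>x'\<close>, \<open>y'\<close> the corresponding ones of \<open>L'\<close>.  As soon as one
  of them is changed, the order of the three arcs is no longer cyclic and the delta move in \<open>D\<close> is an
  isotopy.  The disks \<open>E\<close> in which the move has already been made, and the changes at other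
  crossings, are arbitrary, so that terms of a sum over all disks can be cancelled one disk at a time.
\<close>

definition cancelling_crossings ::
    "complex set set \<Rightarrow> diagram \<Rightarrow> diagram \<Rightarrow> complex set \<Rightarrow> complex \<Rightarrow> complex \<Rightarrow> complex \<Rightarrow> complex \<Rightarrow> bool" where
  "cancelling_crossings \<D> L L' D x y x' y' \<longleftrightarrow>
     x \<noteq> y \<and> x' \<noteq> y' \<and> {x, y} \<subseteq> crossings L \<inter> D \<and> {x', y'} \<subseteq> crossings L' \<inter> D \<and>
     (\<forall>E Y Y'. E \<subseteq> \<D> - {D} \<and> Y \<inter> D \<subseteq> {x, y} \<and> Y' \<inter> D \<subseteq> {x', y'} \<and> Y - D = Y' - D \<and>
        (x \<in> Y \<longleftrightarrow> x' \<in> Y') \<and> (y \<in> Y \<longleftrightarrow> y' \<in> Y') \<and> (x \<in> Y \<or> y \<in> Y) \<longrightarrow>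
        diagram_type (delta_result L L' E Y) = diagram_type (delta_result L L' (insert D E) Y'))"

text \<open>
  The crossings are those of the pushed arc \<open>a\<close> with \<open>b\<close> and with \<open>c\<close>.  Originally \<open>a\<close> is over \<open>b\<close>, \<open>b\<close> is over
  \<open>c\<close> and \<open>c\<close> is over \<open>a\<close>.  If only the first crossing is changed, \<open>b\<close> and \<open>c\<close> are above \<open>a\<close>; if only the
  second, both are below \<open>a\<close>; if both are changed, \<open>b\<close> is above \<open>a\<close> and \<open>c\<close> is below, which agrees with
  the crossing \<open>z\<close> of \<open>b\<close> and \<open>c\<close>.
\<close>

lemma ex_cancelling_crossings:
  assumes \<D>: "delta_moves \<D> L L'" and D: "D \<in> \<D>"
  shows "\<exists>x y x' y'. cancelling_crossings \<D> L L' D x y x' y'"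
proof -
  note DM = delta_movesD[OF \<D>]
  obtain a b c where m: "compact D" "ncomp L' = ncomp L" "D homeomorphic cball (0::complex) 1"
    "delta_triangle D L a b c" "delta_triangle D L' a b c"
    "curve L' (pathstart a) = curve L (pathstart a)" "curve L' (pathfinish a) = curve L (pathfinish a)"
    "\<forall>s\<in>path_image b \<union> path_image c. curve L' s = curve L s"
    by (rule delta_move_inE[OF DM(5)[OF D]])
  note A = delta_triangle_arcs[OF m(4)] and A' = delta_triangle_arcs[OF m(5)]
  obtain x y z where xyz: "{x, y, z} \<subseteq> crossings L \<inter> interior D" "x \<noteq> y" "x \<noteq> z" "y \<noteq> z"
    "over_only_at L a b x" "over_only_at L c a y" "over_only_at L b c z"
    "\<exists>s\<in>path_image b. \<exists>t\<in>path_image c. curve L s = z \<and> curve L t = z"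
    by (rule delta_triangleE[OF DM(1) m(4)])
  obtain x' y' z' where xyz': "{x', y', z'} \<subseteq> crossings L' \<inter> interior D" "x' \<noteq> y'" "x' \<noteq> z'" "y' \<noteq> z'"
    "over_only_at L' a b x'" "over_only_at L' c a y'" "over_only_at L' b c z'"
    "\<exists>s\<in>path_image b. \<exists>t\<in>path_image c. curve L' s = z' \<and> curve L' t = z'"
    by (rule delta_triangleE[OF DM(2) m(5)])
  have intD: "interior D \<subseteq> D" by (rule interior_subset)
  have main: "diagram_type (delta_result L L' E Y) = diagram_type (delta_result L L' (insert D E) Y')"
    if E: "E \<subseteq> \<D> - {D}" and Y: "Y \<inter> D \<subseteq> {x, y}" "Y' \<inter> D \<subseteq> {x', y'}" "Y - D = Y' - D"
      and iff: "x \<in> Y \<longleftrightarrow> x' \<in> Y'" "y \<in> Y \<longleftrightarrow> y' \<in> Y'" and some: "x \<in> Y \<or> y \<in> Y" for E Y Y'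
  proof -
    define M M' where "M = delta_result L L' E Y" and "M' = delta_result L L' (insert D E) Y'"
    have LM: "link_diagram M" "link_diagram M'"
      unfolding M_def M'_def delta_result_def
      by (intro link_diagram_change_crossings link_diagram_replace_inside[OF \<D>]; use E D in blast)+
    have nc: "ncomp M = ncomp L" "ncomp M' = ncomp L" by (simp_all add: M_def M'_def delta_result_simps)
    have zY: "z \<notin> Y" "z' \<notin> Y'" using xyz(1,3,4) xyz'(1,3,4) Y intD by blast+
    have disj: "w \<notin> \<Union>E" if "w \<in> D" for w
      using that E D DM(4) unfolding pairwise_def disjnt_def by blast
    have cM: "curve M s = (if curve L s \<in> \<Union>E then curve L' s else curve L s)" for s
      by (simp only: M_def delta_result_simps)
    have cM': "curve M' s = (if curve L s \<in> \<Union>(insert D E) then curve L' s else curve L s)" for s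
      by (simp only: M'_def delta_result_simps)
    have oM: "s \<in> over M \<longleftrightarrow> (if curve L s \<in> \<Union>E then s \<in> over L' else s \<in> over L) \<noteq> (curve M s \<in> Y)" for s
      unfolding M_def by (rule delta_result_simps)
    have oM': "s \<in> over M' \<longleftrightarrow> (if curve L s \<in> \<Union>(insert D E) then s \<in> over L' else s \<in> over L) \<noteq> (curve M' s \<in> Y')" for s
      unfolding M'_def by (rule delta_result_simps)
    have inM: "curve M s = curve L s" "s \<in> over M \<longleftrightarrow> (s \<in> over L) \<noteq> (curve L s \<in> Y)"
        "curve M' s = curve L' s" "s \<in> over M' \<longleftrightarrow> (s \<in> over L') \<noteq> (curve L' s \<in> Y')"
      if "curve L s \<in> D" for s
    proof -
      have "curve L s \<notin> \<Union>E" "curve L s \<in> \<Union>(insert D E)" using disj[OF that] that by blast+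
      then show "curve M s = curve L s" "s \<in> over M \<longleftrightarrow> (s \<in> over L) \<noteq> (curve L s \<in> Y)"
        "curve M' s = curve L' s" "s \<in> over M' \<longleftrightarrow> (s \<in> over L') \<noteq> (curve L' s \<in> Y')"
        unfolding oM oM' cM cM' by (simp_all only: if_True if_False)
    qed
    have iffD: "curve L' s \<in> D' \<longleftrightarrow> curve L s \<in> D'" if "s \<in> source L" "D' \<in> \<D>" for s D'
      using delta_move_in_source(1)[OF DM(5)[OF that(2)] that(1)] .
    have out: "curve M s \<notin> D" "curve M' s = curve M s" "s \<in> over M' \<longleftrightarrow> s \<in> over M"
      if s: "s \<in> source L" "curve L s \<notin> D" for s
    proof -
      show 1: "curve M s \<notin> D"
        unfolding cM using iffD[OF s(1) D] s(2) by simp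
      have U: "curve L s \<in> \<Union>(insert D E) \<longleftrightarrow> curve L s \<in> \<Union>E" using s(2) by blast
      show 2: "curve M' s = curve M s" unfolding cM cM' U ..
      have "curve M s \<in> Y' \<longleftrightarrow> curve M s \<in> Y" using 1 Y(3) by blast
      then show "s \<in> over M' \<longleftrightarrow> s \<in> over M" unfolding oM oM' U 2 by simp
    qed
    let ?a = "path_image a" and ?b = "path_image b" and ?c = "path_image c"
    have abcD: "curve L s \<in> D" "s \<in> source L" if "s \<in> ?a \<union> ?b \<union> ?c" for s
      using that unfolding A(1)[symmetric] by simp_all
    have inD: "{s \<in> source M. curve M s \<in> D} = ?a \<union> ?b \<union> ?c" "{s \<in> source M. curve M' s \<in> D} = ?a \<union> ?b \<union> ?c"
    proof -
      have "curve M s \<in> D \<longleftrightarrow> curve L s \<in> D" "curve M' s \<in> D \<longleftrightarrow> curve L s \<in> D" if "s \<in> source L" for s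
        using out(1,2)[OF that] inM(1,3)[of s] iffD[OF that D] by metis+
      then show "{s \<in> source M. curve M s \<in> D} = ?a \<union> ?b \<union> ?c" "{s \<in> source M. curve M' s \<in> D} = ?a \<union> ?b \<union> ?c"
        unfolding A(1)[symmetric] nc by blast+
    qed
    have proper: "proper_arc D M a" "proper_arc D M' a" "arc a"
    proof -
      have ca: "curve M (a u) = curve L (a u)" "curve M' (a u) = curve L' (a u)" if "u \<in> {0..1}" for u
        using inM(1,3)[OF abcD(1)[of "a u"]] that by (auto simp: path_image_def)
      have arc_eq: "arc g \<longleftrightarrow> arc h" if "\<And>u. u \<in> {0..1} \<Longrightarrow> g u = h u" for g h :: "real \<Rightarrow> complex"
        using that unfolding arc_def path_def
        by (intro conj_cong continuous_on_cong inj_on_cong refl)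
      have "arc (curve M \<circ> a) \<longleftrightarrow> arc (curve L \<circ> a)" "arc (curve M' \<circ> a) \<longleftrightarrow> arc (curve L' \<circ> a)"
        by (rule arc_eq; simp add: ca)+
      then show "proper_arc D M a" "proper_arc D M' a" "arc a"
        using A(5) A'(5) ca m(2) unfolding proper_arc_def nc
        by (auto simp: pathstart_def pathfinish_def)
    qed
    define V1 where "V1 = (if x \<in> Y then ?b else {}) \<union> (if y \<in> Y then {} else ?c)"
    define V2 where "V2 = (if x \<in> Y then {} else ?b) \<union> (if y \<in> Y then ?c else {})"
    have V: "V1 \<union> V2 = ?b \<union> ?c" "V1 \<inter> V2 = {}" "compact V1" "compact V2"
      using A(3) compact_arc_image[of b] compact_arc_image[of c] A(6,7)
      by (auto simp: V1_def V2_def proper_arc_def)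
    have eqL: "curve L s = curve L t"
      if "curve M s = curve M t" "s \<in> ?a \<union> ?b \<union> ?c" "t \<in> ?a \<union> ?b \<union> ?c" for s t
      using that inM(1)[OF abcD(1)] by metis
    have abL: "t \<notin> over L \<and> curve L t = x" if "s \<in> ?a" "t \<in> ?b" "curve L s = curve L t" for s t
      using over_only_atD[OF xyz(5) that] by simp
    have acL: "t \<in> over L \<and> curve L t = y" if "s \<in> ?a" "t \<in> ?c" "curve L s = curve L t" for s t
      using over_only_atD[OF xyz(6) that(2,1)] that(3) by simp
    have abL': "t \<notin> over L' \<and> curve L' t = x'" if "s \<in> ?a" "t \<in> ?b" "curve L' s = curve L' t" for s t
      using over_only_atD[OF xyz'(5) that] by simp
    have acL': "t \<in> over L' \<and> curve L' t = y'" if "s \<in> ?a" "t \<in> ?c" "curve L' s = curve L' t" for s t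
      using over_only_atD[OF xyz'(6) that(2,1)] that(3) by simp
    have bc: "s \<in> over M \<and> s \<in> over M' \<and> t \<notin> over M \<and> t \<notin> over M'"
      if st: "s \<in> ?b" "t \<in> ?c" "curve L s = curve L t" for s t
    proof -
      have "curve L' s = curve L' t" using m(8) st by simp
      note 1 = over_only_atD[OF xyz(7) st] and 2 = over_only_atD[OF xyz'(7) st(1,2) this]
      show ?thesis
        using 1 2 zY inM(2,4)[OF abcD(1)[of s]] inM(2,4)[OF abcD(1)[of t]] st(1,2) by simp
    qed
    have "diagram_type M = diagram_type M'"
    proof (rule diagram_type_push_arc[OF LM _ m(3) proper(3,1,2) _ _ V(3,4,2)])
      show "ncomp M' = ncomp M" by (simp add: nc)
      show "curve M' (pathstart a) = curve M (pathstart a)" "curve M' (pathfinish a) = curve M (pathfinish a)"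
        using inM(1,3)[OF abcD(1)[of "pathstart a"]] inM(1,3)[OF abcD(1)[of "pathfinish a"]] m(6,7)
        by (simp_all add: pathstart_in_path_image pathfinish_in_path_image)
      show "?a \<inter> (V1 \<union> V2) = {}" unfolding V(1) using A(2,4) by blast
      show "{s \<in> source M. curve M s \<in> D} = ?a \<union> (V1 \<union> V2)" "{s \<in> source M. curve M' s \<in> D} = ?a \<union> (V1 \<union> V2)"
        unfolding V(1) inD by blast+
    next
      fix s assume s: "s \<in> source M" "s \<notin> ?a"
      show "curve M' s = curve M s"
      proof (cases "curve L s \<in> D")
        case True
        then have "s \<in> ?a \<union> ?b \<union> ?c" unfolding A(1)[symmetric] using s(1) nc by simp
        then show ?thesis using s(2) inM(1,3)[OF True] m(8) by simp
      qed (use out(2) s(1) nc in simp)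
    next
      fix s t assume st: "s \<in> source M" "t \<in> source M" "s \<notin> ?a" "t \<notin> ?a" "s \<noteq> t" "curve M s = curve M t"
      show "s \<in> over M' \<longleftrightarrow> s \<in> over M"
      proof (cases "curve L s \<in> D")
        case True
        have s: "s \<in> ?a \<union> ?b \<union> ?c" unfolding A(1)[symmetric] using st(1) nc True by simp
        have "t \<in> ?a \<union> ?b \<union> ?c"
          unfolding inD(1)[symmetric] using st(2,6) inM(1)[OF True] True by simp
        then have eq: "curve L s = curve L t" "curve L t = curve L s" and t: "t \<in> ?b \<union> ?c"
          using eqL[OF st(6) s] st(4) by auto
        have "\<not> (s \<in> ?b \<and> t \<in> ?b)" "\<not> (s \<in> ?c \<and> t \<in> ?c)"
          using proper_arc_inj[OF A(6) _ _ eq(1)] proper_arc_inj[OF A(7) _ _ eq(1)] st(5) by blast+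
        then consider "s \<in> ?b" "t \<in> ?c" | "t \<in> ?b" "s \<in> ?c" using s st(3) t by blast
        then show ?thesis
        proof cases
          case 1
          then show ?thesis using bc[OF _ _ eq(1)] by blast
        next
          case 2
          then show ?thesis using bc[OF _ _ eq(2)] by blast
        qed
      qed (use out(3) st(1) nc in simp)
    next
      fix N s t assume N: "N = M \<or> N = M'" and st: "s \<in> ?a" "curve N s = curve N t"
      have L1: "N = M \<Longrightarrow> t \<in> ?b \<union> ?c \<Longrightarrow> curve L s = curve L t \<and> (t \<in> over N \<longleftrightarrow> (t \<in> over L) \<noteq> (curve L t \<in> Y))"
        using st inM(1)[OF abcD(1)[of s]] inM(1,2)[OF abcD(1)[of t]] by auto
      have L2: "N = M' \<Longrightarrow> t \<in> ?b \<union> ?c \<Longrightarrow> curve L' s = curve L' t \<and> (t \<in> over N \<longleftrightarrow> (t \<in> over L') \<noteq> (curve L' t \<in> Y'))"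
        using st inM(3)[OF abcD(1)[of s]] inM(3,4)[OF abcD(1)[of t]] by auto
      have b: "t \<in> over N \<longleftrightarrow> x \<in> Y" if "t \<in> ?b"
        using N L1 L2 abL[OF st(1) that] abL'[OF st(1) that] that iff by auto
      have c: "t \<in> over N \<longleftrightarrow> y \<notin> Y" if "t \<in> ?c"
        using N L1 L2 acL[OF st(1) that] acL'[OF st(1) that] that iff by auto
      show "t \<in> over N" if "t \<in> V1" using that b c by (auto simp: V1_def split: if_splits)
      show "t \<notin> over N" if "t \<in> V2" using that b c by (auto simp: V2_def split: if_splits)
    next
      fix s t assume st: "s \<in> V1" "t \<in> V2" "curve M s = curve M t"
      then have mem: "s \<in> ?b \<union> ?c" "t \<in> ?b \<union> ?c" using V(1) by blast+
      then have "curve L s = curve L t" using eqL[OF st(3)] by blast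
      moreover have "s \<in> ?b" "t \<in> ?c" using st some by (auto simp: V1_def V2_def split: if_splits)
      ultimately show "s \<in> over M" using bc by blast
    qed
    then show ?thesis by (simp add: M_def M'_def)
  qed
  show ?thesis
    unfolding cancelling_crossings_def
  proof (rule exI[of _ x], rule exI[of _ y], rule exI[of _ x'], rule exI[of _ y'], intro conjI allI impI)
    fix E Y Y'
    assume *: "E \<subseteq> \<D> - {D} \<and> Y \<inter> D \<subseteq> {x, y} \<and> Y' \<inter> D \<subseteq> {x', y'} \<and> Y - D = Y' - D \<and>
       (x \<in> Y \<longleftrightarrow> x' \<in> Y') \<and> (y \<in> Y \<longleftrightarrow> y' \<in> Y') \<and> (x \<in> Y \<or> y \<in> Y)"
    from * show "diagram_type (delta_result L L' E Y) = diagram_type (delta_result L L' (insert D E) Y')"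
      by (elim conjE) (rule main)
  qed (use xyz(1,2) xyz'(1,2) intD in blast)+
qed

section \<open>Finite-type invariants on the delta filtration\<close>

text \<open>
  For each set \<open>\<sigma>\<close> of disks in which the move is made there are \<open>2n\<close> crossings \<open>c \<sigma> k\<close>, two in
  every disk, and the alternating sum over their changes vanishes.  In the alternating sum over \<open>\<sigma>\<close> of these
  sums, a nonempty set \<open>U\<close> of changed crossings meets some disk \<open>i\<close>, and the terms for \<open>\<sigma>\<close> and \<open>insert i \<sigma>\<close>
  cancel.  Only \<open>U = {}\<close> remains, which is the asserted sum.
\<close>

lemma altsum_single_disks:
  assumes FT: "finite_type_less (2 * n) v" and \<D>: "delta_moves \<D> L L'"
    and d: "inj_on d {..<n}" "B \<inter> d ` {..<n} = {}" "B \<union> d ` {..<n} \<subseteq> \<D>"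
  shows "altsum {..<n} (\<lambda>T. v (diagram_type (replace_inside (\<Union>(B \<union> d ` T)) L' L))) = 0"
proof -
  note DM = delta_movesD[OF \<D>]
  let ?I = "{..<n}" and ?J = "{..<2 * n}"
  have "\<forall>i. \<exists>x y x' y'. i < n \<longrightarrow> cancelling_crossings \<D> L L' (d i) x y x' y'"
    using ex_cancelling_crossings[OF \<D>] d(3) by (meson UnCI imageI lessThan_iff subsetD)
  then obtain x y x' y' where
    cc: "\<And>i. i < n \<Longrightarrow> cancelling_crossings \<D> L L' (d i) (x i) (y i) (x' i) (y' i)"
    by metis
  then have xy: "\<And>i. i < n \<Longrightarrow> x i \<noteq> y i" "\<And>i. i < n \<Longrightarrow> x' i \<noteq> y' i"
    "\<And>i. i < n \<Longrightarrow> {x i, y i} \<subseteq> crossings L \<inter> d i" "\<And>i. i < n \<Longrightarrow> {x' i, y' i} \<subseteq> crossings L' \<inter> d i"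
    unfolding cancelling_crossings_def by blast+
  have iso: "diagram_type (delta_result L L' E Y) = diagram_type (delta_result L L' (insert (d i) E) Y')"
    if "i < n" "E \<subseteq> \<D> - {d i}" "Y \<inter> d i \<subseteq> {x i, y i}" "Y' \<inter> d i \<subseteq> {x' i, y' i}"
      "Y - d i = Y' - d i" "x i \<in> Y \<longleftrightarrow> x' i \<in> Y'" "y i \<in> Y \<longleftrightarrow> y' i \<in> Y'" "x i \<in> Y \<or> y i \<in> Y"
    for i E Y Y'
    using cc[OF that(1)] that(2-) unfolding cancelling_crossings_def by blast
  \<comment> \<open>The crossings in disk \<open>i\<close> have the indices \<open>2 * i\<close> and \<open>2 * i + 1\<close>.\<close>
  define c where "c = (\<lambda>\<sigma> k. let i = k div 2 in
     if i \<in> \<sigma> then (if even k then x' i else y' i) else (if even k then x i else y i))"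
  define E where "E = (\<lambda>\<sigma>. B \<union> d ` \<sigma>)"
  have disjD: "w \<notin> d i" if "w \<in> D" "D \<in> \<D>" "i < n" "D \<noteq> d i" for w D i
    using that DM(4) d(3) unfolding pairwise_def disjnt_def by blast
  have d_ne: "d i \<noteq> d j" if "i < n" "j < n" "i \<noteq> j" for i j
    using d(1) that by (auto simp: inj_on_def)
  have cD: "c \<sigma> k \<in> d (k div 2)" if "k < 2 * n" for \<sigma> k
    using xy(3)[of "k div 2"] xy(4)[of "k div 2"] that by (auto simp: c_def Let_def)
  have cD': "c \<sigma> k \<in> d i \<longleftrightarrow> k div 2 = i" if "k < 2 * n" "i < n" for \<sigma> k i
  proof -
    have k: "k div 2 < n" using that by simp
    then have "d (k div 2) \<in> \<D>" using d(3) by blast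
    then show ?thesis
      using cD[OF that(1)] disjD[OF cD[OF that(1)] _ that(2)] d_ne[OF k that(2)] by metis
  qed
  have c_inj: "inj_on (c \<sigma>) ?J" for \<sigma>
  proof (rule inj_onI)
    fix k l assume kl: "k \<in> ?J" "l \<in> ?J" "c \<sigma> k = c \<sigma> l"
    define i where "i = k div 2"
    have i: "i < n" using kl(1) by (auto simp: i_def)
    have "c \<sigma> l \<in> d i" using cD'[of k i \<sigma>] kl i by (simp add: i_def)
    then have l: "l div 2 = i" using cD'[of l i \<sigma>] kl(2) i by simp
    have "even k \<longleftrightarrow> even l"
      using kl(3) xy(1,2)[OF i] l unfolding c_def Let_def i_def[symmetric] l by (auto split: if_splits)
    then show "k = l" using l i_def by presburger
  qed
  have c_cr: "c \<sigma> ` ?J \<subseteq> crossings (replace_inside (\<Union>(E \<sigma>)) L' L)" if \<sigma>: "\<sigma> \<subseteq> ?I" for \<sigma>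
  proof (rule image_subsetI)
    fix k assume "k \<in> {..<2 * n}"
    define i where "i = k div 2"
    have i: "i < n" using \<open>k \<in> _\<close> by (auto simp: i_def)
    have di: "d i \<in> \<D>" using i d(3) by blast
    show "c \<sigma> k \<in> crossings (replace_inside (\<Union>(E \<sigma>)) L' L)"
    proof (cases "i \<in> \<sigma>")
      case True
      then have ck: "c \<sigma> k \<in> crossings L' \<inter> d i" and U: "d i \<subseteq> \<Union>(E \<sigma>)"
        using xy(4)[OF i] by (auto simp: c_def Let_def i_def E_def)
      then obtain s t where st: "s \<in> source L" "t \<in> source L" "s \<noteq> t" "curve L' s = c \<sigma> k" "curve L' t = c \<sigma> k"
        using DM(3) by (auto simp: crossings_def)
      then have "curve L s \<in> d i" "curve L t \<in> d i"
        using ck st(4,5) delta_move_in_source(1)[OF DM(5)[OF di] st(1)]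
          delta_move_in_source(1)[OF DM(5)[OF di] st(2)] by auto
      then have "curve (replace_inside (\<Union>(E \<sigma>)) L' L) s = c \<sigma> k" "curve (replace_inside (\<Union>(E \<sigma>)) L' L) t = c \<sigma> k"
        using U st(4,5) unfolding curve_replace_inside by (meson subsetD)+
      then show ?thesis using st(1-3) unfolding crossings_def by (simp, metis)
    next
      case False
      then have ck: "c \<sigma> k \<in> crossings L \<inter> d i"
        using xy(3)[OF i] by (auto simp: c_def Let_def i_def)
      then obtain s t where st: "s \<in> source L" "t \<in> source L" "s \<noteq> t" "curve L s = c \<sigma> k" "curve L t = c \<sigma> k"
        by (auto simp: crossings_def)
      have "c \<sigma> k \<notin> \<Union>(E \<sigma>)"
      proof
        assume "c \<sigma> k \<in> \<Union>(E \<sigma>)"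
        then obtain D where D: "D \<in> B \<union> d ` \<sigma>" "c \<sigma> k \<in> D" by (auto simp: E_def)
        then have "D \<in> \<D>" using d(3) \<sigma> by blast
        then have "D = d i" using disjD[OF D(2) _ i] ck by blast
        moreover have "d i \<notin> B" using d(2) i by blast
        moreover have "d i \<notin> d ` \<sigma>" using d_ne[OF i] False \<sigma> by auto
        ultimately show False using D(1) by blast
      qed
      then have "curve (replace_inside (\<Union>(E \<sigma>)) L' L) s = c \<sigma> k" "curve (replace_inside (\<Union>(E \<sigma>)) L' L) t = c \<sigma> k"
        using st(4,5) unfolding curve_replace_inside by simp_all
      then show ?thesis using st(1-3) unfolding crossings_def by (simp, metis)
    qed
  qed
  define G where "G = (\<lambda>\<sigma> U. v (diagram_type (delta_result L L' (E \<sigma>) (c \<sigma> ` U))))"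
  have "altsum ?J (G \<sigma>) = 0" if \<sigma>: "\<sigma> \<subseteq> ?I" for \<sigma>
  proof -
    have "link_diagram (replace_inside (\<Union>(E \<sigma>)) L' L)"
      by (rule link_diagram_replace_inside[OF \<D>]) (use d(3) \<sigma> in \<open>auto simp: E_def\<close>)
    then have "linear_extension v (alternating_sum (2 * n)
        (\<lambda>T. change_crossings (c \<sigma> ` T) (replace_inside (\<Union>(E \<sigma>)) L' L))) = 0"
      using FT c_inj c_cr[OF \<sigma>] unfolding finite_type_less_def by blast
    then show ?thesis by (simp add: linear_extension_alternating_sum G_def delta_result_def)
  qed
  then have "altsum ?I (\<lambda>\<sigma>. altsum ?J (G \<sigma>)) = altsum ?I (\<lambda>_. 0)" by (rule altsum_cong)
  then have "altsum ?J (\<lambda>U. altsum ?I (\<lambda>\<sigma>. G \<sigma> U)) = 0"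
    by (simp add: altsum_zero altsum_commute[of ?I])
  moreover have "altsum ?I (\<lambda>\<sigma>. G \<sigma> U) = 0" if U: "U \<subseteq> ?J" "U \<noteq> {}" for U
  proof -
    obtain k where k: "k \<in> U" "k < 2 * n" using U by blast
    define i where "i = k div 2"
    have i: "i < n" using k by (auto simp: i_def)
    show ?thesis
    proof (rule altsum_pairing[of _ i])
      fix \<sigma> assume \<sigma>: "\<sigma> \<subseteq> ?I - {i}"
      let ?\<tau> = "insert i \<sigma>"
      have ni: "i \<notin> \<sigma>" using \<sigma> by blast
      have same: "c ?\<tau> l = c \<sigma> l" if "l div 2 \<noteq> i" for l
        using that by (auto simp: c_def)
      have vals: "c \<sigma> (2 * i) = x i" "c \<sigma> (2 * i + 1) = y i" "c ?\<tau> (2 * i) = x' i" "c ?\<tau> (2 * i + 1) = y' i"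
        using ni by (simp_all add: c_def)
      have lt: "2 * i < 2 * n" "2 * i + 1 < 2 * n" using i by simp_all
      have mem: "c \<rho> l \<in> c \<rho> ` U \<longleftrightarrow> l \<in> U" if "l < 2 * n" for \<rho> l
        using inj_on_image_mem_iff[OF c_inj[of \<rho>], of l U] U(1) that by simp
      have in_di: "l = 2 * i \<or> l = 2 * i + 1" if "l div 2 = i" for l using that by presburger
      have sub: "c \<rho> ` U \<inter> d i \<subseteq> {c \<rho> (2 * i), c \<rho> (2 * i + 1)}" for \<rho>
      proof
        fix w assume "w \<in> c \<rho> ` U \<inter> d i"
        then obtain l where l: "l \<in> U" "w = c \<rho> l" "c \<rho> l \<in> d i" by blast
        then have "l div 2 = i" using cD'[of l i \<rho>] i U(1) by auto
        from in_di[OF this] show "w \<in> {c \<rho> (2 * i), c \<rho> (2 * i + 1)}" using l(2) by blast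
      qed
      have diff: "c \<rho> ` U - d i = c \<rho> ` {l \<in> U. l div 2 \<noteq> i}" for \<rho>
        using cD'[of _ i \<rho>] i U(1) by blast
      have "diagram_type (delta_result L L' (E \<sigma>) (c \<sigma> ` U)) =
          diagram_type (delta_result L L' (insert (d i) (E \<sigma>)) (c ?\<tau> ` U))"
      proof (rule iso[OF i])
        have "d i \<notin> B" using d(2) i by blast
        moreover have "d i \<notin> d ` \<sigma>" using d_ne[OF i] \<sigma> by fastforce
        moreover have "E \<sigma> \<subseteq> \<D>" using d(3) \<sigma> unfolding E_def by blast
        ultimately show "E \<sigma> \<subseteq> \<D> - {d i}" unfolding E_def by blast
        show "c \<sigma> ` U \<inter> d i \<subseteq> {x i, y i}" "c ?\<tau> ` U \<inter> d i \<subseteq> {x' i, y' i}"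
          using sub[of \<sigma>] sub[of ?\<tau>] unfolding vals .
        show "c \<sigma> ` U - d i = c ?\<tau> ` U - d i"
          unfolding diff using same by (intro image_cong) auto
        show "x i \<in> c \<sigma> ` U \<longleftrightarrow> x' i \<in> c ?\<tau> ` U" "y i \<in> c \<sigma> ` U \<longleftrightarrow> y' i \<in> c ?\<tau> ` U"
          using mem[OF lt(1), of \<sigma>] mem[OF lt(1), of ?\<tau>] mem[OF lt(2), of \<sigma>] mem[OF lt(2), of ?\<tau>]
          unfolding vals by simp_all
        have "2 * i \<in> U \<or> 2 * i + 1 \<in> U" using in_di[of k] k(1) i_def by auto
        then show "x i \<in> c \<sigma> ` U \<or> y i \<in> c \<sigma> ` U"
          using mem[OF lt(1), of \<sigma>] mem[OF lt(2), of \<sigma>] unfolding vals by simp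
      qed
      moreover have "insert (d i) (E \<sigma>) = E ?\<tau>" by (auto simp: E_def)
      ultimately show "G \<sigma> U = G ?\<tau> U" by (simp add: G_def)
    qed (use i in auto)
  qed
  ultimately have "altsum ?I (\<lambda>\<sigma>. G \<sigma> {}) = 0"
    using altsum_only_empty[of ?J "\<lambda>U. altsum ?I (\<lambda>\<sigma>. G \<sigma> U)"] by simp
  then show ?thesis by (simp add: G_def E_def delta_result_def)
qed

theorem mainTheorem2:
  fixes n :: nat and v :: "link_type \<Rightarrow> 'a::ab_group_add"
  assumes "n > 0" and "finite_type_less (2 * n) v"
  shows "delta_finite_type_less n v"
  unfolding delta_finite_type_less_def delta_submodule_def
proof (rule ballI, rule linear_extension_span_eq_0)
  fix g assume "g \<in> {alternating_sum n (\<lambda>T. replace_inside (\<Union>i\<in>T. \<Union>(S i)) L' L) | S L L'.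
        disjoint_family_on S {..<n} \<and> delta_moves (\<Union>i<n. S i) L L'}"
  then obtain S L L' where g: "g = alternating_sum n (\<lambda>T. replace_inside (\<Union>i\<in>T. \<Union>(S i)) L' L)"
    and S: "disjoint_family_on S {..<n}" and \<D>: "delta_moves (\<Union>i<n. S i) L L'" by blast
  have "altsum {..<n} (\<lambda>T. v (diagram_type (replace_inside (\<Union>({} \<union> \<Union>(S ` T))) L' L))) = 0"
  proof (rule altsum_Union_eq_0[where f = "\<lambda>E. v (diagram_type (replace_inside (\<Union>E) L' L))" and \<D> = "\<Union>i<n. S i"])
    show "altsum {..<n} (\<lambda>T. v (diagram_type (replace_inside (\<Union>(B \<union> d ` T)) L' L))) = 0"
      if "inj_on d {..<n}" "B \<inter> d ` {..<n} = {}" "B \<union> d ` {..<n} \<subseteq> (\<Union>i<n. S i)" for B d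
      by (rule altsum_single_disks[OF assms(2) \<D> that])
    show "finite (S i)" if "i \<in> {..<n}" for i
      by (rule finite_subset[OF _ delta_moves_finite[OF \<D>]]) (use that in blast)
  qed (use S in auto)
  moreover have "\<Union>({} \<union> \<Union>(S ` T)) = (\<Union>i\<in>T. \<Union>(S i))" for T by blast
  ultimately show "linear_extension v g = 0"
    unfolding g linear_extension_alternating_sum by simp
qed

end
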